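(* Let $\varphi=\varphi(w)$ be a non-constant inner function, let $\{\lambda_k(w)\}_{k=0}^m$ ($m\le\infty$) be an orthonormal basis of $H^2(\Gamma_w)\ominus\varphi(w)H^2(\Gamma_w)$, and for integers $j\ge0$ let $$e_j(z,w)=\frac{w^j+w^{j-1}z+\cdots+z^j}{\sqrt{j+1}},\qquad E_{k,j}(z,w)=\lambda_k(w)\,e_j(z,\varphi(w)).$$ Then the operator $U:N_\varphi\to\left(H^2(\Gamma)\ominus\varphi H^2(\Gamma)\right)\otimes L^2_a(D)$ defined by $U(E_{k,j})=\lambda_k(w)\sqrt{j+1}\,\zeta^j$ is unitary, and $$US_z=(I\otimes B)U.$$
   Context: $D$ is the open unit disk, $\Gamma$ the unit circle. $H^2(\Gamma^2)$ is the Hardy space on the torus $\Gamma^2$, identified with holomorphic functions on $D^2$, with coordinate functions $z,w$; $H^2(\Gamma_w)$ is the Hardy space in the variable $w$, written $H^2(\Gamma)$ when there is no need to specify the variable. For $\varphi\in H^2(\Gamma_w)$, $M_\varphi=[z-\varphi]$ is the closure of $(z-\varphi(w))H^\infty(\Gamma^2)$ in $H^2(\Gamma^2)$, and $N_\varphi=H^2(\Gamma^2)\ominus M_\varphi$. $S_z$ is the compression of multiplication by $z$: $S_zf=P_{N_\varphi}(zf)$ for $f\in N_\varphi$, with $P_{N_\varphi}$ the orthogonal projection onto $N_\varphi$. $L^2_a(D)$ is the Bergman space on $D$ (variable $\zeta$, normalized area measure), with orthonormal basis $\{\sqrt{j+1}\,\zeta^j\}_{j\ge0}$, and $B$ is the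 Bergman shift, i.e. multiplication by $\zeta$ on $L^2_a(D)$. *)

theory Defs
  imports "HOL-Complex_Analysis.Complex_Analysis" "HOL-Library.Extended_Nat"
begin

section \<open>Complex Hilbert spaces with explicit carriers\<close>

record 'a cspace =
  hcarrier :: "'a set"
  hzero :: 'a
  hadd :: "'a \<Rightarrow> 'a \<Rightarrow> 'a"
  hscale :: "complex \<Rightarrow> 'a \<Rightarrow> 'a"
  hinner :: "'a \<Rightarrow> 'a \<Rightarrow> complex"

definition hdiff :: "'a cspace \<Rightarrow> 'a \<Rightarrow> 'a \<Rightarrow> 'a" where
  "hdiff H x y = hadd H x (hscale H (-1) y)"

definition hnorm :: "'a cspace \<Rightarrow> 'a \<Rightarrow> real" where
  "hnorm H x = sqrt (Re (hinner H x x))"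

text \<open>The inner product is linear in the first argument.\<close>

locale complex_hilbert_space =
  fixes H :: "'a cspace"
  assumes zero_closed: "hzero H \<in> hcarrier H"
    and add_closed: "\<lbrakk>x \<in> hcarrier H; y \<in> hcarrier H\<rbrakk> \<Longrightarrow> hadd H x y \<in> hcarrier H"
    and scale_closed: "x \<in> hcarrier H \<Longrightarrow> hscale H c x \<in> hcarrier H"
    and add_assoc: "\<lbrakk>x \<in> hcarrier H; y \<in> hcarrier H; z \<in> hcarrier H\<rbrakk>
      \<Longrightarrow> hadd H (hadd H x y) z = hadd H x (hadd H y z)"
    and add_comm: "\<lbrakk>x \<in> hcarrier H; y \<in> hcarrier H\<rbrakk> \<Longrightarrow> hadd H x y = hadd H y x"
    and add_zero: "x \<in> hcarrier H \<Longrightarrow> hadd H x (hzero H) = x"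
    and add_inverse: "x \<in> hcarrier H \<Longrightarrow> hadd H x (hscale H (-1) x) = hzero H"
    and scale_one: "x \<in> hcarrier H \<Longrightarrow> hscale H 1 x = x"
    and scale_scale: "x \<in> hcarrier H \<Longrightarrow> hscale H a (hscale H b x) = hscale H (a * b) x"
    and scale_add_left: "x \<in> hcarrier H \<Longrightarrow>
      hscale H (a + b) x = hadd H (hscale H a x) (hscale H b x)"
    and scale_add_right: "\<lbrakk>x \<in> hcarrier H; y \<in> hcarrier H\<rbrakk> \<Longrightarrow>
      hscale H c (hadd H x y) = hadd H (hscale H c x) (hscale H c y)"
    and inner_add: "\<lbrakk>x \<in> hcarrier H; y \<in> hcarrier H; z \<in> hcarrier H\<rbrakk>
      \<Longrightarrow> hinner H (hadd H x y) z = hinner H x z + hinner H y z"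
    and inner_scale: "\<lbrakk>x \<in> hcarrier H; y \<in> hcarrier H\<rbrakk>
      \<Longrightarrow> hinner H (hscale H c x) y = c * hinner H x y"
    and inner_cnj: "\<lbrakk>x \<in> hcarrier H; y \<in> hcarrier H\<rbrakk> \<Longrightarrow> hinner H y x = cnj (hinner H x y)"
    and inner_nonneg: "x \<in> hcarrier H \<Longrightarrow> 0 \<le> Re (hinner H x x)"
    and inner_definite: "\<lbrakk>x \<in> hcarrier H; hinner H x x = 0\<rbrakk> \<Longrightarrow> x = hzero H"
    and complete: "\<lbrakk>\<And>n. X n \<in> hcarrier H;
        \<forall>e>0. \<exists>N. \<forall>p\<ge>N. \<forall>q\<ge>N. hnorm H (hdiff H (X p) (X q)) < e\<rbrakk>
      \<Longrightarrow> \<exists>x\<in>hcarrier H. (\<lambda>n. hnorm H (hdiff H (X n) x)) \<longlonglongrightarrow> 0"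

definition hclosure :: "'a cspace \<Rightarrow> 'a set \<Rightarrow> 'a set" where
  "hclosure H S = {x \<in> hcarrier H. \<forall>e>0. \<exists>y\<in>S. hnorm H (hdiff H x y) < e}"

inductive_set hspan :: "'a cspace \<Rightarrow> 'a set \<Rightarrow> 'a set" for H S where
  zero: "hzero H \<in> hspan H S"
| step: "\<lbrakk>s \<in> S; x \<in> hspan H S\<rbrakk> \<Longrightarrow> hadd H (hscale H c s) x \<in> hspan H S"

definition hsubspace :: "'a cspace \<Rightarrow> 'a set \<Rightarrow> 'a cspace" where
  "hsubspace H S = H\<lparr>hcarrier := S\<rparr>"

definition hominus :: "'a cspace \<Rightarrow> 'a set \<Rightarrow> 'a cspace" (infixl "\<ominus>" 65) where
  "H \<ominus> S = hsubspace H {x \<in> hcarrier H. \<forall>y\<in>S. hinner H x y = 0}"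

definition hproj :: "'a cspace \<Rightarrow> 'a set \<Rightarrow> 'a \<Rightarrow> 'a" where
  "hproj H S x = (THE y. y \<in> S \<and> (\<forall>s\<in>S. hinner H (hdiff H x y) s = 0))"

definition orthonormal_basis :: "'a cspace \<Rightarrow> 'i set \<Rightarrow> ('i \<Rightarrow> 'a) \<Rightarrow> bool" where
  "orthonormal_basis H I e \<longleftrightarrow>
     e ` I \<subseteq> hcarrier H \<and>
     (\<forall>i\<in>I. \<forall>j\<in>I. hinner H (e i) (e j) = (if i = j then 1 else 0)) \<and>
     hclosure H (hspan H (e ` I)) = hcarrier H"

definition bounded_operator :: "'a cspace \<Rightarrow> 'b cspace \<Rightarrow> ('a \<Rightarrow> 'b) \<Rightarrow> bool" where
  "bounded_operator H K A \<longleftrightarrow>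
     (\<forall>x\<in>hcarrier H. A x \<in> hcarrier K) \<and>
     (\<forall>x\<in>hcarrier H. \<forall>y\<in>hcarrier H. A (hadd H x y) = hadd K (A x) (A y)) \<and>
     (\<forall>c. \<forall>x\<in>hcarrier H. A (hscale H c x) = hscale K c (A x)) \<and>
     (\<exists>C. \<forall>x\<in>hcarrier H. hnorm K (A x) \<le> C * hnorm H x)"

definition unitary_operator :: "'a cspace \<Rightarrow> 'b cspace \<Rightarrow> ('a \<Rightarrow> 'b) \<Rightarrow> bool" where
  "unitary_operator H K A \<longleftrightarrow>
     bounded_operator H K A \<and> bij_betw A (hcarrier H) (hcarrier K) \<and>
     (\<forall>x\<in>hcarrier H. \<forall>y\<in>hcarrier H. hinner K (A x) (A y) = hinner H x y)"

text \<open>\<open>T\<close> with the bilinear map \<open>t\<close> is the Hilbert space tensor product of \<open>H\<close> and \<open>K\<close>, i.e. the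
  completion of the algebraic tensor product for the product inner product. This determines
  \<open>(T, t)\<close> up to a unique unitary that respects elementary tensors.\<close>

definition hilbert_tensor_product ::
  "'a cspace \<Rightarrow> 'b cspace \<Rightarrow> 'c cspace \<Rightarrow> ('a \<Rightarrow> 'b \<Rightarrow> 'c) \<Rightarrow> bool" where
  "hilbert_tensor_product H K T t \<longleftrightarrow>
     complex_hilbert_space T \<and>
     (\<forall>x\<in>hcarrier H. \<forall>y\<in>hcarrier K. t x y \<in> hcarrier T) \<and>
     (\<forall>x\<in>hcarrier H. \<forall>x'\<in>hcarrier H. \<forall>y\<in>hcarrier K.
        t (hadd H x x') y = hadd T (t x y) (t x' y)) \<and>
     (\<forall>x\<in>hcarrier H. \<forall>y\<in>hcarrier K. \<forall>y'\<in>hcarrier K.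
        t x (hadd K y y') = hadd T (t x y) (t x y')) \<and>
     (\<forall>c. \<forall>x\<in>hcarrier H. \<forall>y\<in>hcarrier K.
        t (hscale H c x) y = hscale T c (t x y) \<and> t x (hscale K c y) = hscale T c (t x y)) \<and>
     (\<forall>x\<in>hcarrier H. \<forall>x'\<in>hcarrier H. \<forall>y\<in>hcarrier K. \<forall>y'\<in>hcarrier K.
        hinner T (t x y) (t x' y') = hinner H x x' * hinner K y y') \<and>
     hclosure T (hspan T {t x y | x y. x \<in> hcarrier H \<and> y \<in> hcarrier K}) = hcarrier T"

text \<open>The operator \<open>A \<otimes> B\<close> on \<open>T\<close>; \<open>extensional\<close> only makes the function unique off the carrier.\<close>

definition tensor_operator ::
  "'a cspace \<Rightarrow> 'b cspace \<Rightarrow> 'c cspace \<Rightarrow> ('a \<Rightarrow> 'b \<Rightarrow> 'c) \<Rightarrow> ('a \<Rightarrow> 'a) \<Rightarrow> ('b \<Rightarrow> 'b) \<Rightarrow> 'c \<Rightarrow> 'c" where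
  "tensor_operator H K T t A B =
     (THE R. R \<in> extensional (hcarrier T) \<and> bounded_operator T T R \<and>
        (\<forall>x\<in>hcarrier H. \<forall>y\<in>hcarrier K. R (t x y) = t (A x) (B y)))"

section \<open>Hardy and Bergman spaces\<close>

text \<open>Functions on the disc and the bidisc are total functions that vanish off the domain, so that
  equality of elements is equality on the domain.\<close>

abbreviation disc :: "complex set" where
  "disc \<equiv> ball 0 1"

definition fun_space :: "('x \<Rightarrow> complex) set \<Rightarrow>
    (('x \<Rightarrow> complex) \<Rightarrow> ('x \<Rightarrow> complex) \<Rightarrow> complex) \<Rightarrow> ('x \<Rightarrow> complex) cspace" where
  "fun_space S ip = \<lparr>hcarrier = S, hzero = (\<lambda>x. 0), hadd = (\<lambda>f g x. f x + g x),
     hscale = (\<lambda>c f x. c * f x), hinner = ip\<rparr>"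

definition zero_off :: "'x set \<Rightarrow> ('x \<Rightarrow> complex) \<Rightarrow> 'x \<Rightarrow> complex" where
  "zero_off S f = (\<lambda>x. if x \<in> S then f x else 0)"

subsection \<open>The Hardy space of the circle\<close>

definition circle_mean :: "real \<Rightarrow> (complex \<Rightarrow> complex) \<Rightarrow> complex" where
  "circle_mean r f = (LINT t:{0..2*pi}|lborel. f (of_real r * cis t)) / of_real (2 * pi)"

text \<open>The inner product of the boundary functions in \<open>L\<^sup>2\<close> of the circle is the limit of the inner
  products over the circles of radius \<open>r < 1\<close>.\<close>

definition hardy :: "(complex \<Rightarrow> complex) cspace" where
  "hardy = fun_space
     {f. f holomorphic_on disc \<and> (\<forall>z. z \<notin> disc \<longrightarrow> f z = 0) \<and>
         (\<exists>C. \<forall>r\<in>{0..<1}. Re (circle_mean r (\<lambda>z. of_real ((cmod (f z))\<^sup>2))) \<le> C)}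
     (\<lambda>f g. Lim (at_left 1) (\<lambda>r. circle_mean r (\<lambda>z. f z * cnj (g z))))"

definition inner_function :: "(complex \<Rightarrow> complex) \<Rightarrow> bool" where
  "inner_function \<phi> \<longleftrightarrow> \<phi> holomorphic_on disc \<and> bounded (\<phi> ` disc) \<and>
     (AE t in lborel. \<exists>l. ((\<lambda>r. \<phi> (of_real r * cis t)) \<longlongrightarrow> l) (at_left 1) \<and> cmod l = 1)"

definition model_space :: "(complex \<Rightarrow> complex) \<Rightarrow> (complex \<Rightarrow> complex) cspace" where
  "model_space \<phi> = hardy \<ominus> {\<lambda>w. \<phi> w * f w | f. f \<in> hcarrier hardy}"

subsection \<open>The Hardy space of the torus\<close>

definition holomorphic_bidisc :: "(complex \<times> complex \<Rightarrow> complex) \<Rightarrow> bool" where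
  "holomorphic_bidisc f \<longleftrightarrow>
     (\<forall>p \<in> disc \<times> disc. \<exists>a b. (f has_derivative (\<lambda>(u, v). a * u + b * v)) (at p))"

definition torus_mean :: "real \<Rightarrow> (complex \<times> complex \<Rightarrow> complex) \<Rightarrow> complex" where
  "torus_mean r f =
     (LINT p:{0..2*pi} \<times> {0..2*pi}|lborel. f (of_real r * cis (fst p), of_real r * cis (snd p)))
       / of_real ((2 * pi)\<^sup>2)"

definition hardy2 :: "(complex \<times> complex \<Rightarrow> complex) cspace" where
  "hardy2 = fun_space
     {f. holomorphic_bidisc f \<and> (\<forall>p. p \<notin> disc \<times> disc \<longrightarrow> f p = 0) \<and>
         (\<exists>C. \<forall>r\<in>{0..<1}. Re (torus_mean r (\<lambda>p. of_real ((cmod (f p))\<^sup>2))) \<le> C)}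
     (\<lambda>f g. Lim (at_left 1) (\<lambda>r. torus_mean r (\<lambda>p. f p * cnj (g p))))"

definition hardy2_bounded :: "(complex \<times> complex \<Rightarrow> complex) set" where
  "hardy2_bounded = {f. holomorphic_bidisc f \<and> (\<forall>p. p \<notin> disc \<times> disc \<longrightarrow> f p = 0) \<and> bounded (range f)}"

definition M_space :: "(complex \<Rightarrow> complex) \<Rightarrow> (complex \<times> complex \<Rightarrow> complex) set" where
  "M_space \<phi> = hclosure hardy2 {\<lambda>(z, w). (z - \<phi> w) * h (z, w) | h. h \<in> hardy2_bounded}"

definition N_space :: "(complex \<Rightarrow> complex) \<Rightarrow> (complex \<times> complex \<Rightarrow> complex) cspace" where
  "N_space \<phi> = hardy2 \<ominus> M_space \<phi>"

definition S_z :: "(complex \<Rightarrow> complex) \<Rightarrow> (complex \<times> complex \<Rightarrow> complex) \<Rightarrow> complex \<times> complex \<Rightarrow> complex" where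
  "S_z \<phi> f = hproj hardy2 (hcarrier (N_space \<phi>)) (\<lambda>(z, w). z * f (z, w))"

definition e_fun :: "nat \<Rightarrow> complex \<Rightarrow> complex \<Rightarrow> complex" where
  "e_fun j z w = (\<Sum>i\<le>j. w ^ (j - i) * z ^ i) / of_real (sqrt (real j + 1))"

definition E_fun :: "(complex \<Rightarrow> complex) \<Rightarrow> (nat \<Rightarrow> complex \<Rightarrow> complex) \<Rightarrow> nat \<Rightarrow> nat
    \<Rightarrow> complex \<times> complex \<Rightarrow> complex" where
  "E_fun \<phi> lam k j = zero_off (disc \<times> disc) (\<lambda>(z, w). lam k w * e_fun j z (\<phi> w))"

subsection \<open>The Bergman space\<close>

definition bergman :: "(complex \<Rightarrow> complex) cspace" where
  "bergman = fun_space
     {f. f holomorphic_on disc \<and> (\<forall>z. z \<notin> disc \<longrightarrow> f z = 0) \<and>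
         set_integrable lborel disc (\<lambda>z. (cmod (f z))\<^sup>2)}
     (\<lambda>f g. (LINT z:disc|lborel. f z * cnj (g z)) / of_real pi)"

definition bergman_basis :: "nat \<Rightarrow> complex \<Rightarrow> complex" where
  "bergman_basis j = zero_off disc (\<lambda>\<zeta>. of_real (sqrt (real j + 1)) * \<zeta> ^ j)"

definition bergman_shift :: "(complex \<Rightarrow> complex) \<Rightarrow> complex \<Rightarrow> complex" where
  "bergman_shift f = (\<lambda>\<zeta>. \<zeta> * f \<zeta>)"

end

theory Submission
  imports Defs
begin

text \<open>Write \<open>f \<in> H\<^sup>2(\<Gamma>\<^sup>2)\<close> as \<open>f(z, w) = \<Sum>\<^sub>i z\<^sup>i f\<^sub>i(w)\<close> with \<open>f\<^sub>i \<in> H\<^sup>2(\<Gamma>\<^sub>w)\<close>; then \<open>\<langle>f, g\<rangle> = \<Sum>\<^sub>i \<langle>f\<^sub>i, g\<^sub>i\<rangle>\<close>.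
  Testing against \<open>(z - \<phi>) z\<^sup>i w\<^sup>n\<close> shows that \<open>f \<in> N\<^sub>\<phi>\<close> iff \<open>\<langle>f\<^sub>i\<^sub>+\<^sub>1, h\<rangle> = \<langle>f\<^sub>i, \<phi> h\<rangle>\<close> for all \<open>i\<close> and all
  \<open>h \<in> H\<^sup>2(\<Gamma>\<^sub>w)\<close>. Hence \<open>\<langle>f, E\<^sub>k\<^sub>j\<rangle> = \<surd>(j + 1) \<langle>f\<^sub>j, \<lambda>\<^sub>k\<rangle>\<close> for \<open>f \<in> N\<^sub>\<phi>\<close>, which gives orthonormality of
  the \<open>E\<^sub>k\<^sub>j\<close>. If \<open>f\<close> is orthogonal to all of them, then every \<open>f\<^sub>j\<close> is orthogonal to \<open>H\<^sup>2 \<ominus> \<phi> H\<^sup>2\<close> and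
  so divisible by \<open>\<phi>\<close>; as multiplication by \<open>\<phi>\<close> is isometric, \<open>f\<^sub>j = \<phi> f\<^sub>j\<^sub>+\<^sub>1\<close>, thus
  \<open>f\<^sub>j = \<phi>\<^sup>n f\<^sub>j\<^sub>+\<^sub>n\<close> for all \<open>n\<close>, and \<open>f\<^sub>j = 0\<close> because \<open>|\<phi>| < 1\<close> on the disc. So \<open>U\<close> maps an
  orthonormal basis to an orthonormal basis. The operator \<open>I \<otimes> B\<close> is identified with \<open>U S\<^sub>z U\<^sup>-\<^sup>1\<close> by
  comparing coefficients on elementary tensors.\<close>

section \<open>Hilbert spaces with explicit carriers\<close>

text \<open>Both Hardy inner products are limits of means over circles or tori of radius r < 1; no
  boundary function is ever formed. Parseval at fixed r and Abel's limit theorem turn these limits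
  into sums over Taylor coefficients, and the geometry takes place in sequence spaces. The radial
  limits of \<phi> matter at a single place, the isometry of multiplication by \<phi>; |\<phi>| < 1
  then follows from isometry and the maximum principle. The Bergman weights arise by counting. The
  function E with indices k, j has j + 1 slices lam_k \<phi>^(j - i) / sqrt(j + 1). Against f in N
  each of them contributes <f_j, lam_k> / sqrt(j + 1), because the powers of \<phi> can be traded
  for an increase of the slice index. Multiplying f by z moves its slices up by one, so the sum for
  j becomes the sum for j - 1, divided by sqrt(j + 1) in place of sqrt(j). The ratio sqrt(j / (j +
  1)) is the weight of the Bergman shift in its orthonormal basis, and the projection in S_z is
  invisible to inner products with elements of N.\<close>

lemma cmod_sq: "z * cnj z = of_real ((cmod z)\<^sup>2)"
  by (simp add: complex_norm_square[symmetric])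

text \<open>The axioms of \<^locale>\<open>complex_hilbert_space\<close> without completeness.\<close>

locale pre_hilbert_space =
  fixes H :: "'a cspace"
  assumes zero_closed: "hzero H \<in> hcarrier H"
    and add_closed: "\<lbrakk>x \<in> hcarrier H; y \<in> hcarrier H\<rbrakk> \<Longrightarrow> hadd H x y \<in> hcarrier H"
    and scale_closed: "x \<in> hcarrier H \<Longrightarrow> hscale H c x \<in> hcarrier H"
    and add_assoc: "\<lbrakk>x \<in> hcarrier H; y \<in> hcarrier H; z \<in> hcarrier H\<rbrakk>
      \<Longrightarrow> hadd H (hadd H x y) z = hadd H x (hadd H y z)"
    and add_comm: "\<lbrakk>x \<in> hcarrier H; y \<in> hcarrier H\<rbrakk> \<Longrightarrow> hadd H x y = hadd H y x"
    and add_zero: "x \<in> hcarrier H \<Longrightarrow> hadd H x (hzero H) = x"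
    and add_inverse: "x \<in> hcarrier H \<Longrightarrow> hadd H x (hscale H (-1) x) = hzero H"
    and scale_one: "x \<in> hcarrier H \<Longrightarrow> hscale H 1 x = x"
    and scale_scale: "x \<in> hcarrier H \<Longrightarrow> hscale H a (hscale H b x) = hscale H (a * b) x"
    and scale_add_left: "x \<in> hcarrier H \<Longrightarrow>
      hscale H (a + b) x = hadd H (hscale H a x) (hscale H b x)"
    and scale_add_right: "\<lbrakk>x \<in> hcarrier H; y \<in> hcarrier H\<rbrakk> \<Longrightarrow>
      hscale H c (hadd H x y) = hadd H (hscale H c x) (hscale H c y)"
    and inner_add: "\<lbrakk>x \<in> hcarrier H; y \<in> hcarrier H; z \<in> hcarrier H\<rbrakk>
      \<Longrightarrow> hinner H (hadd H x y) z = hinner H x z + hinner H y z"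
    and inner_scale: "\<lbrakk>x \<in> hcarrier H; y \<in> hcarrier H\<rbrakk>
      \<Longrightarrow> hinner H (hscale H c x) y = c * hinner H x y"
    and inner_cnj: "\<lbrakk>x \<in> hcarrier H; y \<in> hcarrier H\<rbrakk> \<Longrightarrow> hinner H y x = cnj (hinner H x y)"
    and inner_nonneg: "x \<in> hcarrier H \<Longrightarrow> 0 \<le> Re (hinner H x x)"
    and inner_definite: "\<lbrakk>x \<in> hcarrier H; hinner H x x = 0\<rbrakk> \<Longrightarrow> x = hzero H"

sublocale complex_hilbert_space \<subseteq> pre_hilbert_space
  by unfold_locales
    (simp_all only: zero_closed add_closed scale_closed add_assoc add_zero add_inverse scale_one
      scale_scale scale_add_left scale_add_right inner_add inner_scale inner_nonneg,
      auto intro: add_comm inner_cnj inner_definite)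

section \<open>Inner product algebra, Cauchy-Schwarz and density arguments\<close>

context pre_hilbert_space
begin

lemma diff_closed: "x \<in> hcarrier H \<Longrightarrow> y \<in> hcarrier H \<Longrightarrow> hdiff H x y \<in> hcarrier H"
  by (simp add: hdiff_def add_closed scale_closed)

lemmas closed = zero_closed add_closed scale_closed diff_closed

lemma inner_diff: "\<lbrakk>x \<in> hcarrier H; y \<in> hcarrier H; z \<in> hcarrier H\<rbrakk>
    \<Longrightarrow> hinner H (hdiff H x y) z = hinner H x z - hinner H y z"
  by (simp add: hdiff_def inner_add inner_scale closed)

lemma inner_add_right: "\<lbrakk>x \<in> hcarrier H; y \<in> hcarrier H; z \<in> hcarrier H\<rbrakk>
    \<Longrightarrow> hinner H z (hadd H x y) = hinner H z x + hinner H z y"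
  by (subst (1 2 3) inner_cnj) (simp_all add: inner_add closed)

lemma inner_scale_right: "\<lbrakk>x \<in> hcarrier H; y \<in> hcarrier H\<rbrakk>
    \<Longrightarrow> hinner H y (hscale H c x) = cnj c * hinner H y x"
  by (subst (1 2) inner_cnj) (simp_all add: inner_scale closed)

lemma inner_diff_right: "\<lbrakk>x \<in> hcarrier H; y \<in> hcarrier H; z \<in> hcarrier H\<rbrakk>
    \<Longrightarrow> hinner H z (hdiff H x y) = hinner H z x - hinner H z y"
  by (simp add: hdiff_def inner_add_right inner_scale_right closed)

lemma inner_zero: "y \<in> hcarrier H \<Longrightarrow> hinner H (hzero H) y = 0"
  using inner_add[of "hzero H" "hzero H" y] add_zero[of "hzero H"] zero_closed by simp

lemma inner_zero_right: "y \<in> hcarrier H \<Longrightarrow> hinner H y (hzero H) = 0"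
  using inner_cnj[of "hzero H" y] inner_zero zero_closed by simp

lemmas inner_simps = inner_add inner_scale inner_diff inner_zero
  inner_add_right inner_scale_right inner_diff_right inner_zero_right

lemma inner_self: "x \<in> hcarrier H \<Longrightarrow> hinner H x x = of_real ((hnorm H x)\<^sup>2)"
  using inner_cnj[of x x] inner_nonneg[of x]
  by (auto simp: hnorm_def complex_eq_iff)

lemma norm_sq: "x \<in> hcarrier H \<Longrightarrow> (hnorm H x)\<^sup>2 = Re (hinner H x x)"
  by (simp add: inner_self)

lemma norm_nonneg: "x \<in> hcarrier H \<Longrightarrow> 0 \<le> hnorm H x"
  by (simp add: hnorm_def inner_nonneg)

lemma norm_eq_0: "x \<in> hcarrier H \<Longrightarrow> hnorm H x = 0 \<Longrightarrow> x = hzero H"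
  using inner_self inner_definite by simp

lemma diff_eq_zeroD:
  assumes x: "x \<in> hcarrier H" and y: "y \<in> hcarrier H" and d: "hdiff H x y = hzero H"
  shows "x = y"
proof -
  let ?m = "hscale H (-1) y"
  have m: "?m \<in> hcarrier H" using y by (rule scale_closed)
  have "x = hadd H x (hadd H ?m y)"
    using add_zero[OF x] add_inverse[OF y] add_comm[OF y m] by simp
  also have "\<dots> = hadd H (hzero H) y"
    using add_assoc[OF x m y] d by (simp add: hdiff_def)
  also have "\<dots> = y"
    using add_zero[OF y] add_comm[OF y zero_closed] by simp
  finally show ?thesis .
qed

lemma inner_eqI:
  assumes x: "x \<in> hcarrier H" and y: "y \<in> hcarrier H"
    and eq: "\<And>z. z \<in> hcarrier H \<Longrightarrow> hinner H x z = hinner H y z"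
  shows "x = y"
proof (rule diff_eq_zeroD[OF x y])
  show "hdiff H x y = hzero H"
    using eq[OF diff_closed[OF x y]] diff_closed[OF x y]
    by (intro inner_definite) (simp_all add: inner_diff x y)
qed

lemma cauchy_schwarz:
  assumes x: "x \<in> hcarrier H" and y: "y \<in> hcarrier H"
  shows "cmod (hinner H x y) \<le> hnorm H x * hnorm H y"
proof (cases "hnorm H y = 0")
  case True
  then have "y = hzero H" using norm_eq_0 y by simp
  then show ?thesis using True x by (simp add: inner_zero_right)
next
  case False
  define b where "b = (hnorm H y)\<^sup>2"
  define a where "a = hinner H x y"
  have b: "b > 0" using False by (simp add: b_def)
  \<comment> \<open>\<open>b\<close> times the component of x orthogonal to y; the factor
    \<open>b\<close> avoids a division.\<close>
  define z where "z = hdiff H (hscale H b x) (hscale H a y)"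
  have z: "z \<in> hcarrier H" using x y by (simp add: z_def closed)
  have ya: "hinner H y x = cnj a" using inner_cnj[OF x y] by (simp add: a_def)
  have "hinner H z z = b * b * hinner H x x - b * (a * cnj a)"
    using x y unfolding z_def
    by (simp add: inner_simps closed ya a_def[symmetric] inner_self[OF y] b_def[symmetric])
       (simp add: algebra_simps)
  also have "\<dots> = of_real (b * (b * (hnorm H x)\<^sup>2 - (cmod a)\<^sup>2))"
    using inner_self[OF x] by (simp add: cmod_sq algebra_simps)
  finally have "0 \<le> b * (b * (hnorm H x)\<^sup>2 - (cmod a)\<^sup>2)"
    using inner_nonneg[OF z] by simp
  then have "(cmod a)\<^sup>2 \<le> (hnorm H x * hnorm H y)\<^sup>2"
    using b by (simp add: zero_le_mult_iff b_def power_mult_distrib mult.commute)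
  then show ?thesis
    using power2_le_imp_le a_def norm_nonneg x y by (meson mult_nonneg_nonneg)
qed

lemma norm_diff_commute:
  "x \<in> hcarrier H \<Longrightarrow> y \<in> hcarrier H \<Longrightarrow> hnorm H (hdiff H x y) = hnorm H (hdiff H y x)"
  by (simp add: hnorm_def inner_simps closed)

lemma norm_add_le:
  assumes x: "x \<in> hcarrier H" and y: "y \<in> hcarrier H"
  shows "hnorm H (hadd H x y) \<le> hnorm H x + hnorm H y"
proof (rule power2_le_imp_le)
  have "(hnorm H (hadd H x y))\<^sup>2 = (hnorm H x)\<^sup>2 + (hnorm H y)\<^sup>2 + 2 * Re (hinner H x y)"
    using x y inner_cnj[OF x y] by (simp add: norm_sq inner_simps closed)
  also have "Re (hinner H x y) \<le> hnorm H x * hnorm H y"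
    using cauchy_schwarz[OF x y] complex_Re_le_cmod order_trans by blast
  finally show "(hnorm H (hadd H x y))\<^sup>2 \<le> (hnorm H x + hnorm H y)\<^sup>2"
    by (simp add: power2_sum)
  show "0 \<le> hnorm H x + hnorm H y" using norm_nonneg x y by simp
qed

lemma tendsto_inner:
  assumes X: "\<And>n. X n \<in> hcarrier H" and x: "x \<in> hcarrier H" and y: "y \<in> hcarrier H"
    and lim: "(\<lambda>n. hnorm H (hdiff H (X n) x)) \<longlonglongrightarrow> 0"
  shows "(\<lambda>n. hinner H (X n) y) \<longlonglongrightarrow> hinner H x y"
proof -
  have "(\<lambda>n. hinner H (X n) y - hinner H x y) \<longlonglongrightarrow> 0"
  proof (rule Lim_null_comparison)
    show "\<forall>\<^sub>F n in sequentially. cmod (hinner H (X n) y - hinner H x y)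
        \<le> hnorm H (hdiff H (X n) x) * hnorm H y"
      using cauchy_schwarz[OF diff_closed[OF X x] y] by (simp add: inner_diff X x y)
    show "(\<lambda>n. hnorm H (hdiff H (X n) x) * hnorm H y) \<longlonglongrightarrow> 0"
      using tendsto_mult_right[OF lim] by simp
  qed
  then show ?thesis by (simp add: LIM_zero_iff)
qed

text \<open>The density argument used throughout: F is continuous, so it vanishes on the closed span
  of its zeros. F is a bare function with additivity and homogeneity as hypotheses, so inner
  products against a fixed vector, differences of these and their conjugates can be inserted
  directly.\<close>

lemma functional_zero_on_closure:
  assumes S: "S \<subseteq> hcarrier H"
    and add: "\<And>x y. x \<in> hcarrier H \<Longrightarrow> y \<in> hcarrier H \<Longrightarrow> F (hadd H x y) = F x + F y"
    and scale: "\<And>c x. x \<in> hcarrier H \<Longrightarrow> F (hscale H c x) = c * F x"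
    and bound: "\<And>x. x \<in> hcarrier H \<Longrightarrow> cmod (F x) \<le> C * hnorm H x"
    and zero: "\<And>s. s \<in> S \<Longrightarrow> F s = 0"
    and x: "x \<in> hclosure H (hspan H S)"
  shows "F x = (0::complex)"
proof -
  have F0: "F (hzero H) = 0"
    using add[of "hzero H" "hzero H"] add_zero[of "hzero H"] zero_closed by simp
  have span: "y \<in> hcarrier H \<and> F y = 0" if "y \<in> hspan H S" for y
    using that by induction (use S in \<open>auto simp: closed F0 add scale zero\<close>)
  have xc: "x \<in> hcarrier H" using x by (simp add: hclosure_def)
  have "cmod (F x) \<le> \<bar>C\<bar> * e" if e: "e > 0" for e
  proof -
    obtain y where y: "y \<in> hspan H S" "hnorm H (hdiff H x y) < e"
      using x e unfolding hclosure_def by blast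
    note yc = conjunct1[OF span[OF y(1)]]
    have "F (hdiff H x y) = F x"
      using span[OF y(1)] xc by (simp add: hdiff_def add scale closed)
    then have "cmod (F x) \<le> C * hnorm H (hdiff H x y)"
      using bound[OF diff_closed[OF xc yc]] by simp
    also have "\<dots> \<le> \<bar>C\<bar> * e"
      using y(2) norm_nonneg[OF diff_closed[OF xc yc]]
      by (intro mult_mono) auto
    finally show ?thesis .
  qed
  from this[of "inverse (of_nat (Suc n))" for n]
  have "\<forall>\<^sub>F n in sequentially. cmod (F x) \<le> \<bar>C\<bar> * inverse (of_nat (Suc n))"
    by (intro always_eventually) auto
  moreover have "(\<lambda>n. \<bar>C\<bar> * inverse (of_nat (Suc n))) \<longlonglongrightarrow> \<bar>C\<bar> * 0"
    by (intro tendsto_mult tendsto_const LIMSEQ_inverse_real_of_nat)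
  ultimately have "cmod (F x) \<le> 0"
    using tendsto_lowerbound trivial_limit_sequentially by fastforce
  then show ?thesis by simp
qed

text \<open>Continuity of the inner product along a sequence in S. The closure is that of S itself
  and not of its span, which matches the definition of \<open>M_space\<close>.\<close>

lemma orthogonal_closure:
  assumes S: "S \<subseteq> hcarrier H" and x: "x \<in> hcarrier H" and y: "y \<in> hclosure H S"
    and orth: "\<And>s. s \<in> S \<Longrightarrow> hinner H x s = 0"
  shows "hinner H x y = 0"
proof -
  have yc: "y \<in> hcarrier H" using y by (simp add: hclosure_def)
  have "\<exists>s. s \<in> S \<and> hnorm H (hdiff H s y) < inverse (of_nat (Suc n))" for n
  proof -
    have "inverse (real (Suc n)) > 0" by simp
    then obtain s where "s \<in> S" "hnorm H (hdiff H y s) < inverse (of_nat (Suc n))"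
      using y unfolding hclosure_def by blast
    moreover from this have "s \<in> hcarrier H" using S by auto
    ultimately show ?thesis using norm_diff_commute[OF yc, of s] by auto
  qed
  then obtain s where s: "\<And>n. s n \<in> S"
      "\<And>n. hnorm H (hdiff H (s n) y) < inverse (of_nat (Suc n))" by metis
  have sc: "s n \<in> hcarrier H" for n using s(1) S by auto
  have "(\<lambda>n. hnorm H (hdiff H (s n) y)) \<longlonglongrightarrow> 0"
    by (rule tendsto_sandwich[OF _ _ tendsto_const LIMSEQ_inverse_real_of_nat])
       (intro always_eventually allI less_imp_le[OF s(2)] norm_nonneg diff_closed sc yc)+
  from tendsto_inner[OF sc yc x this] have "hinner H y x = 0"
    using orth[OF s(1)] inner_cnj[OF x sc] by (simp add: LIMSEQ_const_iff)
  then show ?thesis using inner_cnj[OF yc x] by simp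
qed

subsection \<open>Orthonormal systems\<close>

text \<open>Indices are natural numbers so that expansions are limits of partial sums in a fixed
  order; doubly indexed systems enter through a pairing function.\<close>

definition orthonormal :: "nat set \<Rightarrow> (nat \<Rightarrow> 'a) \<Rightarrow> bool" where
  "orthonormal I e \<longleftrightarrow> (\<forall>i\<in>I. e i \<in> hcarrier H) \<and>
    (\<forall>i\<in>I. \<forall>j\<in>I. hinner H (e i) (e j) = (if i = j then 1 else 0))"

text \<open>Stated as a zero orthogonal complement, the form that a comparison of coefficients uses;
  \<open>closure_span_basis\<close> and \<open>closure_span_total\<close> translate to and from
  density of the span.\<close>

definition total :: "nat set \<Rightarrow> (nat \<Rightarrow> 'a) \<Rightarrow> bool" where
  "total I e \<longleftrightarrow> (\<forall>x\<in>hcarrier H. (\<forall>i\<in>I. hinner H x (e i) = 0) \<longrightarrow> x = hzero H)"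

text \<open>Addition is a field of the record, hence a recursion in place of a finite sum. Indices
  outside I are skipped, so a finite I gives an eventually constant sequence.\<close>

primrec psum :: "nat set \<Rightarrow> (nat \<Rightarrow> complex) \<Rightarrow> (nat \<Rightarrow> 'a) \<Rightarrow> nat \<Rightarrow> 'a" where
  "psum I a e 0 = hzero H"
| "psum I a e (Suc n) =
    (if n \<in> I then hadd H (hscale H (a n) (e n)) (psum I a e n) else psum I a e n)"

lemma psum_closed: "orthonormal I e \<Longrightarrow> psum I a e n \<in> hcarrier H"
  by (induction n) (auto simp: closed orthonormal_def)

lemma psum_span: "psum I a e n \<in> hspan H (e ` I)"
  by (induction n) (auto intro: hspan.intros)

lemma inner_psum:
  assumes "orthonormal I e" "y \<in> hcarrier H"
  shows "hinner H (psum I a e n) y = (\<Sum>i<n. if i \<in> I then a i * hinner H (e i) y else 0)"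
  using assms psum_closed[OF assms(1)]
  by (induction n) (auto simp: inner_simps closed orthonormal_def)

lemma inner_psum_basis:
  assumes "orthonormal I e" "i \<in> I"
  shows "hinner H (psum I a e n) (e i) = (if i < n then a i else 0)"
proof -
  have "e i \<in> hcarrier H" using assms by (simp add: orthonormal_def)
  then have "hinner H (psum I a e n) (e i) = (\<Sum>j<n. if j \<in> I then a j * hinner H (e j) (e i) else 0)"
    by (rule inner_psum[OF assms(1)])
  also have "\<dots> = (\<Sum>j<n. if j = i then a j else 0)"
    using assms by (intro sum.cong) (auto simp: orthonormal_def)
  finally have "hinner H (psum I a e n) (e i) = (\<Sum>j<n. if j = i then a j else 0)" .
  then show ?thesis by simp
qed

lemma inner_psum_psum:
  assumes o: "orthonormal I e"
  shows "hinner H (psum I a e n) (psum I b e k) =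
    (\<Sum>i<min n k. if i \<in> I then a i * cnj (b i) else 0)"
proof -
  have "hinner H (psum I a e n) (psum I b e k) =
      (\<Sum>i<n. if i \<in> I then a i * hinner H (e i) (psum I b e k) else 0)"
    by (simp add: inner_psum o psum_closed)
  also have "\<dots> = (\<Sum>i<n. if i < k then if i \<in> I then a i * cnj (b i) else 0 else 0)"
  proof (rule sum.cong)
    fix i assume "i \<in> {..<n}"
    show "(if i \<in> I then a i * hinner H (e i) (psum I b e k) else 0) =
        (if i < k then if i \<in> I then a i * cnj (b i) else 0 else 0)"
      using inner_cnj[of "psum I b e k" "e i"] o psum_closed[OF o]
      by (auto simp: inner_psum_basis[OF o] orthonormal_def)
  qed simp
  also have "\<dots> = (\<Sum>i<min n k. if i \<in> I then a i * cnj (b i) else 0)"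
    by (rule sum.mono_neutral_cong_right) auto
  finally show ?thesis .
qed

text \<open>The partial sum p satisfies <p, p> = <p, x> = <x, p>, so the claim is the nonnegativity
  of <x - p, x - p>.\<close>

lemma bessel_partial:
  assumes o: "orthonormal I e" and x: "x \<in> hcarrier H"
  shows "(\<Sum>i<n. if i \<in> I then (cmod (hinner H x (e i)))\<^sup>2 else 0) \<le> (hnorm H x)\<^sup>2"
proof -
  let ?a = "\<lambda>i. hinner H x (e i)"
  let ?S = "\<Sum>i<n. if i \<in> I then (cmod (?a i))\<^sup>2 else 0"
  let ?p = "psum I ?a e n"
  note p = psum_closed[OF o, of ?a n]
  have pp: "hinner H ?p ?p = of_real ?S"
    unfolding inner_psum_psum[OF o] of_real_sum
    by (intro sum.cong) (auto simp: cmod_sq)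
  have "hinner H ?p x = of_real ?S"
    unfolding inner_psum[OF o x] of_real_sum
    by (rule sum.cong) (use o x in \<open>auto simp: inner_cnj[of x "e i" for i] orthonormal_def
        cmod_sq\<close>)
  moreover from this have "hinner H x ?p = of_real ?S"
    using inner_cnj[OF p x] by simp
  ultimately have "Re (hinner H (hdiff H x ?p) (hdiff H x ?p)) = (hnorm H x)\<^sup>2 - ?S"
    using x p pp by (simp add: inner_simps closed inner_self[OF x])
  then show ?thesis
    using inner_nonneg[OF diff_closed[OF x p]] by simp
qed

lemma bessel_summable:
  assumes o: "orthonormal I e" and x: "x \<in> hcarrier H"
  shows "summable (\<lambda>i. if i \<in> I then (cmod (hinner H x (e i)))\<^sup>2 else 0)"
  using bessel_partial[OF o x] by (intro summableI_nonneg_bounded) auto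

text \<open>Reduces the Cauchy property of partial sums to that of a real series; the absolute value
  treats both orders of p and q at once.\<close>

lemma norm_diff_psum:
  assumes o: "orthonormal I e"
  shows "(hnorm H (hdiff H (psum I a e p) (psum I a e q)))\<^sup>2 =
    \<bar>(\<Sum>i<p. if i \<in> I then (cmod (a i))\<^sup>2 else 0) - (\<Sum>i<q. if i \<in> I then (cmod (a i))\<^sup>2 else 0)\<bar>"
proof -
  define S where "S n = (\<Sum>i<n. if i \<in> I then (cmod (a i))\<^sup>2 else 0)" for n
  have S: "(\<Sum>i<n. if i \<in> I then a i * cnj (a i) else 0) = of_real (S n)" for n
    unfolding S_def of_real_sum
    by (intro sum.cong) (auto simp: cmod_sq)
  have mono: "S m \<le> S n" if "m \<le> n" for m n
    unfolding S_def using that by (intro sum_mono2) auto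
  show ?thesis
    unfolding S_def[symmetric]
    using mono[of p q] mono[of q p]
    by (cases "p \<le> q")
       (auto simp: norm_sq inner_simps psum_closed[OF o] closed inner_psum_psum[OF o] S
         min_def)
qed

end

section \<open>Riesz-Fischer, basis expansions and Parseval\<close>

context complex_hilbert_space
begin

text \<open>Completeness is applied to the partial sums. For fixed i the coefficient of the n-th
  partial sum equals \<open>a i\<close> once n > i, so the limit has the prescribed
  coefficients.\<close>

lemma riesz_fischer:
  assumes o: "orthonormal I e"
    and a: "summable (\<lambda>i. if i \<in> I then (cmod (a i))\<^sup>2 else 0)"
  obtains x where "x \<in> hcarrier H" "\<And>i. i \<in> I \<Longrightarrow> hinner H x (e i) = a i"
    "(\<lambda>n. hnorm H (hdiff H (psum I a e n) x)) \<longlonglongrightarrow> 0"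
proof -
  define S where "S n = (\<Sum>i<n. if i \<in> I then (cmod (a i))\<^sup>2 else 0)" for n
  have "Cauchy S"
    unfolding S_def using a by (simp add: summable_iff_convergent convergent_Cauchy)
  have "\<forall>d>0. \<exists>N. \<forall>p\<ge>N. \<forall>q\<ge>N. hnorm H (hdiff H (psum I a e p) (psum I a e q)) < d"
  proof (intro allI impI)
    fix d :: real assume d: "d > 0"
    obtain N where N: "\<And>p q. p \<ge> N \<Longrightarrow> q \<ge> N \<Longrightarrow> dist (S p) (S q) < d\<^sup>2"
      using \<open>Cauchy S\<close> d by (meson metric_CauchyD zero_less_power)
    have "hnorm H (hdiff H (psum I a e p) (psum I a e q)) < d" if "p \<ge> N" "q \<ge> N" for p q
      using N[OF that] d norm_diff_psum[OF o, of a p q]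
      by (intro power2_less_imp_less[where y = d]) (auto simp: S_def dist_real_def)
    then show "\<exists>N. \<forall>p\<ge>N. \<forall>q\<ge>N. hnorm H (hdiff H (psum I a e p) (psum I a e q)) < d"
      by blast
  qed
  then obtain x where x: "x \<in> hcarrier H"
      and lim: "(\<lambda>n. hnorm H (hdiff H (psum I a e n) x)) \<longlonglongrightarrow> 0"
    using complete[of "psum I a e", OF psum_closed[OF o]] by blast
  have "hinner H x (e i) = a i" if i: "i \<in> I" for i
  proof -
    have ei: "e i \<in> hcarrier H" using o i by (simp add: orthonormal_def)
    have "(\<lambda>n. hinner H (psum I a e n) (e i)) \<longlonglongrightarrow> a i"
      by (rule tendsto_eventually)
         (auto simp: inner_psum_basis[OF o i] eventually_sequentially intro!: exI[of _ "Suc i"])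
    with tendsto_inner[OF psum_closed[OF o] x ei lim] show ?thesis
      using LIMSEQ_unique by blast
  qed
  with x lim that show thesis by blast
qed

text \<open>Bessel makes the expansion converge to some y with the coefficients of x, and totality
  forces y = x.\<close>

lemma basis_expansion:
  assumes o: "orthonormal I e" and tot: "total I e" and x: "x \<in> hcarrier H"
  shows "(\<lambda>n. hnorm H (hdiff H (psum I (\<lambda>i. hinner H x (e i)) e n) x)) \<longlonglongrightarrow> 0"
proof -
  obtain y where y: "y \<in> hcarrier H" "\<And>i. i \<in> I \<Longrightarrow> hinner H y (e i) = hinner H x (e i)"
    "(\<lambda>n. hnorm H (hdiff H (psum I (\<lambda>i. hinner H x (e i)) e n) y)) \<longlonglongrightarrow> 0"
    using riesz_fischer[OF o bessel_summable[OF o x]] by metis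
  have "hdiff H y x = hzero H"
    using tot y x o unfolding total_def
    by (auto simp: closed inner_simps orthonormal_def)
  then have "y = x" using diff_eq_zeroD y x by blast
  with y show ?thesis by simp
qed

lemma parseval:
  assumes o: "orthonormal I e" and tot: "total I e"
    and x: "x \<in> hcarrier H" and y: "y \<in> hcarrier H"
  shows "(\<lambda>i. if i \<in> I then hinner H x (e i) * cnj (hinner H y (e i)) else 0) sums hinner H x y"
proof -
  have *: "cnj (hinner H y (e i)) = hinner H (e i) y" if "i \<in> I" for i
    using inner_cnj[of y "e i"] y o that by (auto simp: orthonormal_def)
  show ?thesis
    using tendsto_inner[OF psum_closed[OF o] x y basis_expansion[OF o tot x]]
    unfolding sums_def inner_psum[OF o y] by (simp add: * cong: if_cong)
qed

lemma closure_span_basis: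
  assumes o: "orthonormal I e" and tot: "total I e"
  shows "hclosure H (hspan H (e ` I)) = hcarrier H"
proof -
  have "\<exists>y\<in>hspan H (e ` I). hnorm H (hdiff H x y) < d" if x: "x \<in> hcarrier H" and d: "d > 0" for x d
  proof -
    obtain n where "hnorm H (hdiff H (psum I (\<lambda>i. hinner H x (e i)) e n) x) < d"
      using order_tendstoD(2)[OF basis_expansion[OF o tot x] d]
      by (auto simp: eventually_sequentially)
    then show ?thesis
      using psum_span norm_diff_commute[OF x psum_closed[OF o]] by (metis (no_types, lifting))
  qed
  then show ?thesis by (auto simp: hclosure_def)
qed

end

text \<open>Summing over the fourth roots of unity cancels every term except
  \<open>hinner H x y\<close>. This turns equalities of norms into equalities of inner
  products.\<close>

lemma (in pre_hilbert_space) inner_polarization: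
  assumes x: "x \<in> hcarrier H" and y: "y \<in> hcarrier H"
  shows "hinner H x y =
    (\<Sum>k<4. (\<i> ^ k / 4) * of_real ((hnorm H (hadd H x (hscale H (\<i> ^ k) y)))\<^sup>2))"
proof -
  have "complex_of_real ((hnorm H (hadd H x (hscale H (\<i> ^ k) y)))\<^sup>2) =
      hinner H x x + cnj (\<i> ^ k) * hinner H x y + \<i> ^ k * hinner H y x +
      \<i> ^ k * cnj (\<i> ^ k) * hinner H y y" for k :: nat
    unfolding inner_self[OF add_closed[OF x scale_closed[OF y]], symmetric]
    using x y by (simp add: inner_simps closed algebra_simps)
  then show ?thesis
    by (simp only:) (simp add: numeral_eq_Suc algebra_simps)
qed

text \<open>The functional \<open>\<lambda>y. hinner H y x\<close> vanishes on S, hence on the whole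
  carrier, in particular at x itself.\<close>

lemma closure_span_total:
  assumes "pre_hilbert_space H" and S: "S \<subseteq> hcarrier H"
    and cl: "hclosure H (hspan H S) = hcarrier H" and x: "x \<in> hcarrier H"
    and orth: "\<And>s. s \<in> S \<Longrightarrow> hinner H x s = 0"
  shows "x = hzero H"
proof -
  interpret pre_hilbert_space H by fact
  have "hinner H x x = 0"
  proof (rule functional_zero_on_closure[where S = S and F = "\<lambda>y. hinner H y x" and C = "hnorm H x"])
    show "hinner H s x = 0" if "s \<in> S" for s
      using orth[OF that] inner_cnj[of x s] S x that by auto
    show "cmod (hinner H y x) \<le> hnorm H x * hnorm H y" if "y \<in> hcarrier H" for y
      using cauchy_schwarz[OF that x] by (simp add: mult.commute)
  qed (use S x cl in \<open>auto simp: inner_simps\<close>)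
  then show ?thesis using inner_definite x by simp
qed

lemma (in pre_hilbert_space) complex_hilbert_spaceI:
  assumes "\<And>X. \<lbrakk>\<And>n. X n \<in> hcarrier H;
        \<forall>e>0. \<exists>N. \<forall>p\<ge>N. \<forall>q\<ge>N. hnorm H (hdiff H (X p) (X q)) < e\<rbrakk>
      \<Longrightarrow> \<exists>x\<in>hcarrier H. (\<lambda>n. hnorm H (hdiff H (X n) x)) \<longlonglongrightarrow> 0"
  shows "complex_hilbert_space H"
proof (intro complex_hilbert_space.intro, goal_cases)
  case (17 X)
  then show ?case by (rule assms)
qed (fact zero_closed add_closed scale_closed add_assoc add_comm add_zero add_inverse scale_one
  scale_scale scale_add_left scale_add_right inner_add inner_scale inner_cnj inner_nonneg
  inner_definite)+

section \<open>Orthogonal complements as Hilbert spaces\<close>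

lemma ominus_simps [simp]:
  "hcarrier (H \<ominus> S) = {x \<in> hcarrier H. \<forall>y\<in>S. hinner H x y = 0}"
  "hzero (H \<ominus> S) = hzero H" "hadd (H \<ominus> S) = hadd H" "hscale (H \<ominus> S) = hscale H"
  "hinner (H \<ominus> S) = hinner H" "hnorm (H \<ominus> S) = hnorm H" "hdiff (H \<ominus> S) = hdiff H"
  by (simp_all add: hominus_def hsubspace_def hnorm_def hdiff_def fun_eq_iff)

lemma pre_hilbert_ominus:
  assumes "pre_hilbert_space H" "S \<subseteq> hcarrier H"
  shows "pre_hilbert_space (H \<ominus> S)"
proof -
  interpret pre_hilbert_space H by fact
  show ?thesis
    using assms(2)
    by unfold_locales
      (auto simp: closed inner_simps subset_iff add_assoc add_zero add_inverse scale_one scale_scale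
        scale_add_left scale_add_right inner_nonneg intro: add_comm inner_definite inner_cnj)
qed

text \<open>Each condition \<open>hinner H x y = 0\<close> survives limits, so a limit found in H
  stays in the complement.\<close>

lemma hilbert_ominus:
  fixes H :: "'a cspace"
  assumes "complex_hilbert_space H" "S \<subseteq> hcarrier H"
  shows "complex_hilbert_space (H \<ominus> S)"
proof -
  interpret complex_hilbert_space H by fact
  interpret K: pre_hilbert_space "H \<ominus> S"
    using assms(2) by (rule pre_hilbert_ominus[OF pre_hilbert_space_axioms])
  show ?thesis
  proof (rule K.complex_hilbert_spaceI)
    fix X :: "nat \<Rightarrow> 'a"
    assume X: "\<And>n. X n \<in> hcarrier (H \<ominus> S)"
      and "\<forall>e>0. \<exists>N. \<forall>p\<ge>N. \<forall>q\<ge>N. hnorm (H \<ominus> S) (hdiff (H \<ominus> S) (X p) (X q)) < e"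
    then obtain x where x: "x \<in> hcarrier H" "(\<lambda>n. hnorm H (hdiff H (X n) x)) \<longlonglongrightarrow> 0"
      using complete[of X] by auto
    have "hinner H x y = 0" if y: "y \<in> S" for y
    proof -
      have "(\<lambda>n. hinner H (X n) y) \<longlonglongrightarrow> hinner H x y"
        using X y assms(2) by (intro tendsto_inner x) auto
      moreover have "hinner H (X n) y = 0" for n using X[of n] y by simp
      ultimately show ?thesis by (simp add: LIMSEQ_const_iff)
    qed
    with x show "\<exists>x\<in>hcarrier (H \<ominus> S). (\<lambda>n. hnorm (H \<ominus> S) (hdiff (H \<ominus> S) (X n) x)) \<longlonglongrightarrow> 0"
      by auto
  qed
qed

section \<open>Operators determined by orthonormal bases\<close>

lemma (in pre_hilbert_space) subset_closure:
  assumes "x \<in> S" "S \<subseteq> hcarrier H"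
  shows "x \<in> hclosure H S"
proof -
  have x: "x \<in> hcarrier H" using assms by auto
  have "hnorm H (hdiff H x x) = 0"
    using x by (simp add: hnorm_def hdiff_def add_inverse inner_zero closed)
  then show ?thesis using x assms(1) by (auto simp: hclosure_def intro!: bexI[of _ x])
qed

lemma (in pre_hilbert_space) total_eqI:
  assumes tot: "total I e" and o: "orthonormal I e" and x: "x \<in> hcarrier H" and y: "y \<in> hcarrier H"
    and eq: "\<And>i. i \<in> I \<Longrightarrow> hinner H x (e i) = hinner H y (e i)"
  shows "x = y"
proof (rule diff_eq_zeroD[OF x y])
  have "hinner H (hdiff H x y) (e i) = 0" if "i \<in> I" for i
    using o that eq[OF that] by (simp add: inner_diff[OF x y] orthonormal_def)
  then show "hdiff H x y = hzero H"
    using tot diff_closed[OF x y] unfolding total_def by blast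
qed

text \<open>With y = U x - V x, the density argument for z \<mapsto> <U z - V z, y> gives <y, y> = 0
  at z = x. Both uniqueness claims, for U and for the tensor operator, rest on this.\<close>

lemma bounded_operator_eqI:
  assumes H: "pre_hilbert_space H" and K: "pre_hilbert_space K"
    and U: "bounded_operator H K U" and V: "bounded_operator H K V"
    and S: "S \<subseteq> hcarrier H" "hclosure H (hspan H S) = hcarrier H"
    and eq: "\<And>s. s \<in> S \<Longrightarrow> U s = V s" and x: "x \<in> hcarrier H"
  shows "U x = V x"
proof -
  interpret H: pre_hilbert_space H by fact
  interpret K: pre_hilbert_space K by fact
  obtain C where C: "\<And>z. z \<in> hcarrier H \<Longrightarrow> hnorm K (U z) \<le> C * hnorm H z"
    using U unfolding bounded_operator_def by blast
  obtain D where D: "\<And>z. z \<in> hcarrier H \<Longrightarrow> hnorm K (V z) \<le> D * hnorm H z"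
    using V unfolding bounded_operator_def by blast
  have Uc: "U z \<in> hcarrier K" and Vc: "V z \<in> hcarrier K" if "z \<in> hcarrier H" for z
    using U V that unfolding bounded_operator_def by auto
  define y where "y = hdiff K (U x) (V x)"
  have y: "y \<in> hcarrier K" unfolding y_def using x by (intro K.diff_closed Uc Vc)
  have "hinner K (U x) y - hinner K (V x) y = 0"
  proof (rule H.functional_zero_on_closure[where S = S and F = "\<lambda>z. hinner K (U z) y - hinner K (V z) y"
        and C = "(C + D) * hnorm K y"])
    show "hinner K (U (hadd H a b)) y - hinner K (V (hadd H a b)) y =
        hinner K (U a) y - hinner K (V a) y + (hinner K (U b) y - hinner K (V b) y)"
      if "a \<in> hcarrier H" "b \<in> hcarrier H" for a b
      using U V that y unfolding bounded_operator_def by (simp add: K.inner_add)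
    show "hinner K (U (hscale H c a)) y - hinner K (V (hscale H c a)) y =
        c * (hinner K (U a) y - hinner K (V a) y)" if "a \<in> hcarrier H" for c a
      using U V that y unfolding bounded_operator_def by (simp add: K.inner_scale right_diff_distrib)
    show "cmod (hinner K (U a) y - hinner K (V a) y) \<le> (C + D) * hnorm K y * hnorm H a"
      if a: "a \<in> hcarrier H" for a
    proof -
      have "cmod (hinner K (U a) y - hinner K (V a) y) \<le> hnorm K (U a) * hnorm K y + hnorm K (V a) * hnorm K y"
        using K.cauchy_schwarz[OF Uc[OF a] y] K.cauchy_schwarz[OF Vc[OF a] y]
          norm_triangle_ineq4[of "hinner K (U a) y" "hinner K (V a) y"] by linarith
      also have "\<dots> \<le> (C * hnorm H a) * hnorm K y + (D * hnorm H a) * hnorm K y"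
        by (intro add_mono mult_right_mono C D a K.norm_nonneg y)
      finally show ?thesis by (simp add: algebra_simps)
    qed
  qed (use S eq x in auto)
  then have "hinner K y y = 0"
    using K.inner_diff[OF Uc[OF x] Vc[OF x] y] by (simp add: y_def)
  then show ?thesis
    using K.diff_eq_zeroD[OF Uc[OF x] Vc[OF x]] K.inner_definite[OF y] by (simp add: y_def)
qed

text \<open>U x is the vector of K with the coefficients of x, which exists by Bessel and
  Riesz-Fischer. Linearity and bijectivity are comparisons of coefficients, isometry is Parseval.
  The coefficient identity is exported because it evaluates U away from the basis.\<close>

lemma unitary_operator_of_bases:
  assumes H: "complex_hilbert_space H" and K: "complex_hilbert_space K"
    and e: "pre_hilbert_space.orthonormal H I e" "pre_hilbert_space.total H I e"
    and f: "pre_hilbert_space.orthonormal K I f" "pre_hilbert_space.total K I f"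
  obtains U where "unitary_operator H K U" "\<And>i. i \<in> I \<Longrightarrow> U (e i) = f i"
    "\<And>x i. x \<in> hcarrier H \<Longrightarrow> i \<in> I \<Longrightarrow> hinner K (U x) (f i) = hinner H x (e i)"
proof -
  interpret H: complex_hilbert_space H by fact
  interpret K: complex_hilbert_space K by fact
  have fc: "f i \<in> hcarrier K" and ec: "e i \<in> hcarrier H" if "i \<in> I" for i
    using e(1) f(1) that by (auto simp: H.orthonormal_def K.orthonormal_def)
  have "\<exists>y. y \<in> hcarrier K \<and> (\<forall>i\<in>I. hinner K y (f i) = hinner H x (e i))" if "x \<in> hcarrier H" for x
    using K.riesz_fischer[OF f(1) H.bessel_summable[OF e(1) that]] by metis
  then obtain U where Uc: "\<And>x. x \<in> hcarrier H \<Longrightarrow> U x \<in> hcarrier K"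
    and U: "\<And>x i. x \<in> hcarrier H \<Longrightarrow> i \<in> I \<Longrightarrow> hinner K (U x) (f i) = hinner H x (e i)"
    by metis
  have iso: "hinner K (U x) (U y) = hinner H x y" if x: "x \<in> hcarrier H" and y: "y \<in> hcarrier H" for x y
  proof -
    have "(\<lambda>i. if i \<in> I then hinner K (U x) (f i) * cnj (hinner K (U y) (f i)) else 0) =
        (\<lambda>i. if i \<in> I then hinner H x (e i) * cnj (hinner H y (e i)) else 0)"
      using U x y by auto
    then show ?thesis
      using K.parseval[OF f Uc[OF x] Uc[OF y]] H.parseval[OF e x y] sums_unique2 by simp
  qed
  have "bounded_operator H K U"
    unfolding bounded_operator_def
  proof (intro conjI ballI allI exI[of _ 1])
    fix x y assume x: "x \<in> hcarrier H" and y: "y \<in> hcarrier H"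
    show "U (hadd H x y) = hadd K (U x) (U y)"
      by (rule K.total_eqI[OF f(2,1)])
         (use x y in \<open>auto simp: H.closed K.closed Uc U H.inner_add K.inner_add ec fc\<close>)
  next
    fix c x assume x: "x \<in> hcarrier H"
    show "U (hscale H c x) = hscale K c (U x)"
      by (rule K.total_eqI[OF f(2,1)])
         (use x in \<open>auto simp: H.closed K.closed Uc U H.inner_scale K.inner_scale ec fc\<close>)
  next
    fix x assume x: "x \<in> hcarrier H"
    show "hnorm K (U x) \<le> 1 * hnorm H x" using iso[OF x x] by (simp add: hnorm_def)
  qed (rule Uc)
  moreover have "bij_betw U (hcarrier H) (hcarrier K)"
    unfolding bij_betw_def
  proof
    show "inj_on U (hcarrier H)"
    proof (rule inj_onI)
      fix x y assume "x \<in> hcarrier H" "y \<in> hcarrier H" "U x = U y"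
      then show "x = y" using U by (intro H.total_eqI[OF e(2,1)]) metis+
    qed
    have "\<exists>x\<in>hcarrier H. U x = y" if y: "y \<in> hcarrier K" for y
    proof -
      obtain x where "x \<in> hcarrier H" "\<And>i. i \<in> I \<Longrightarrow> hinner H x (e i) = hinner K y (f i)"
        using H.riesz_fischer[OF e(1) K.bessel_summable[OF f(1) y]] by metis
      then show ?thesis
        using y U Uc by (intro bexI[of _ x] K.total_eqI[OF f(2,1)]) auto
    qed
    then show "U ` hcarrier H = hcarrier K" using Uc by (force simp: image_iff)
  qed
  moreover have "U (e i) = f i" if i: "i \<in> I" for i
    by (rule K.total_eqI[OF f(2,1)])
       (use i e(1) f(1) in \<open>auto simp: Uc ec fc U H.orthonormal_def K.orthonormal_def\<close>)
  ultimately show thesis using that[of U] U iso by (auto simp: unitary_operator_def)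
qed

text \<open>\<open>hproj\<close> is a definite description, so existence and uniqueness of the
  projection have to be established first. A basis of the complement supplies it: u gets the
  coefficients of x, which are square summable by Bessel in H.\<close>

lemma hproj_complement:
  assumes H: "pre_hilbert_space H" and N: "complex_hilbert_space (H \<ominus> M)"
    and e: "pre_hilbert_space.orthonormal (H \<ominus> M) I e" "pre_hilbert_space.total (H \<ominus> M) I e"
    and x: "x \<in> hcarrier H"
  defines "y \<equiv> hproj H (hcarrier (H \<ominus> M)) x"
  shows "y \<in> hcarrier (H \<ominus> M)" "\<And>s. s \<in> hcarrier (H \<ominus> M) \<Longrightarrow> hinner H y s = hinner H x s"
proof -
  interpret H: pre_hilbert_space H by fact
  interpret N: complex_hilbert_space "H \<ominus> M" by fact
  let ?N = "hcarrier (H \<ominus> M)"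
  have eN: "e i \<in> ?N" if "i \<in> I" for i using e(1) that by (auto simp: N.orthonormal_def)
  have oH: "H.orthonormal I e" using e(1) by (auto simp: N.orthonormal_def H.orthonormal_def)
  obtain u where u: "u \<in> ?N" "\<And>i. i \<in> I \<Longrightarrow> hinner (H \<ominus> M) u (e i) = hinner H x (e i)"
    using N.riesz_fischer[OF e(1) H.bessel_summable[OF oH x]] by metis
  define d where "d = hdiff H x u"
  have uH: "u \<in> hcarrier H" using u(1) by simp
  have d: "d \<in> hcarrier H" unfolding d_def using x uH by (rule H.diff_closed)
  \<comment> \<open>Orthogonality to the basis spreads to the whole complement by density; s stands
    in the first slot, where the inner product is linear.\<close>
  have "hinner H s d = 0" if s: "s \<in> ?N" for s
  proof (rule N.functional_zero_on_closure[where S = "e ` I" and F = "\<lambda>s. hinner H s d" and C = "hnorm H d"])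
    show "hinner H s d = 0" if "s \<in> e ` I" for s
    proof -
      obtain i where i: "i \<in> I" "s = e i" using \<open>s \<in> e ` I\<close> by blast
      have sH: "s \<in> hcarrier H" using eN[OF i(1)] i(2) by simp
      have "hinner H d s = 0" using u(2)[OF i(1)] H.inner_diff[OF x uH sH] by (simp add: d_def i(2))
      then show ?thesis using H.inner_cnj[OF d sH] by simp
    qed
    show "cmod (hinner H a d) \<le> hnorm H d * hnorm (H \<ominus> M) a" if "a \<in> ?N" for a
      using H.cauchy_schwarz[of a d] that d by (simp add: mult.commute)
  qed (use eN s d N.closure_span_basis[OF e] in \<open>auto simp: H.inner_add H.inner_scale\<close>)
  then have ds: "hinner H (hdiff H x u) s = 0" if "s \<in> ?N" for s
    using H.inner_cnj[of s d] that d by (simp add: d_def)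
  have "y = u"
    unfolding y_def hproj_def
  proof (rule the_equality)
    show "u \<in> ?N \<and> (\<forall>s\<in>?N. hinner H (hdiff H x u) s = 0)" using u(1) ds by blast
    fix v assume v: "v \<in> ?N \<and> (\<forall>s\<in>?N. hinner H (hdiff H x v) s = 0)"
    show "v = u"
    proof (rule N.inner_eqI)
      fix s assume s: "s \<in> ?N"
      have "hinner H v s = hinner H x s" "hinner H u s = hinner H x s"
        using v ds[OF s] s x uH H.inner_diff[of x v s] H.inner_diff[of x u s] by auto
      then show "hinner (H \<ominus> M) v s = hinner (H \<ominus> M) u s" by simp
    qed (use v u in auto)
  qed
  then show "y \<in> ?N" using u(1) by simp
  show "hinner H y s = hinner H x s" if "s \<in> ?N" for s
    using ds[OF that] that x uH H.inner_diff[of x u s] \<open>y = u\<close> by simp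
qed

text \<open>Density in two stages: \<open>t a r\<close> for fixed r is bounded and linear in a, then
  \<open>t a b\<close> for fixed a is so in b, and finally elementary tensors span T. Boundedness
  comes from the multiplicative norm \<open>tn\<close>.\<close>

lemma tensor_basis_total:
  assumes tp: "hilbert_tensor_product H L T t"
    and H: "pre_hilbert_space H" and L: "pre_hilbert_space L"
    and S: "S \<subseteq> hcarrier H" "hclosure H (hspan H S) = hcarrier H"
    and R: "R \<subseteq> hcarrier L" "hclosure L (hspan L R) = hcarrier L"
    and x: "x \<in> hcarrier T" and orth: "\<And>s r. s \<in> S \<Longrightarrow> r \<in> R \<Longrightarrow> hinner T x (t s r) = 0"
  shows "x = hzero T"
proof -
  interpret H: pre_hilbert_space H by fact
  interpret L: pre_hilbert_space L by fact
  interpret T: complex_hilbert_space T using tp by (simp add: hilbert_tensor_product_def)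
  have tc: "t a b \<in> hcarrier T" if "a \<in> hcarrier H" "b \<in> hcarrier L" for a b
    using tp that unfolding hilbert_tensor_product_def by blast
  have ta: "t (hadd H a a') b = hadd T (t a b) (t a' b)"
    if "a \<in> hcarrier H" "a' \<in> hcarrier H" "b \<in> hcarrier L" for a a' b
    using tp that unfolding hilbert_tensor_product_def by blast
  have tb: "t a (hadd L b b') = hadd T (t a b) (t a b')"
    if "a \<in> hcarrier H" "b \<in> hcarrier L" "b' \<in> hcarrier L" for a b b'
    using tp that unfolding hilbert_tensor_product_def by blast
  have ts: "t (hscale H c a) b = hscale T c (t a b)" "t a (hscale L c b) = hscale T c (t a b)"
    if "a \<in> hcarrier H" "b \<in> hcarrier L" for a b c
    using tp that unfolding hilbert_tensor_product_def by blast+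
  have ti: "hinner T (t a b) (t a b) = hinner H a a * hinner L b b"
    if "a \<in> hcarrier H" "b \<in> hcarrier L" for a b
    using tp that unfolding hilbert_tensor_product_def by blast
  have tn: "hnorm T (t a b) = hnorm H a * hnorm L b" if "a \<in> hcarrier H" "b \<in> hcarrier L" for a b
  proof -
    have "(hnorm T (t a b))\<^sup>2 = (hnorm H a * hnorm L b)\<^sup>2"
      using ti[OF that] H.inner_self[OF that(1)] L.inner_self[OF that(2)] T.norm_sq[OF tc[OF that]]
      by (simp add: power_mult_distrib flip: of_real_mult of_real_power)
    then show ?thesis
      by (rule power2_eq_imp_eq) (use that in \<open>auto intro!: mult_nonneg_nonneg T.norm_nonneg H.norm_nonneg L.norm_nonneg tc\<close>)
  qed
  have bound: "cmod (hinner T (t a b) x) \<le> hnorm H a * hnorm L b * hnorm T x"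
    if "a \<in> hcarrier H" "b \<in> hcarrier L" for a b
    using T.cauchy_schwarz[OF tc[OF that] x] by (simp add: tn[OF that])
  have 1: "hinner T (t a r) x = 0" if a: "a \<in> hcarrier H" and r: "r \<in> R" for a r
  proof (rule H.functional_zero_on_closure[where S = S and F = "\<lambda>a. hinner T (t a r) x" and C = "hnorm L r * hnorm T x"])
    have rL: "r \<in> hcarrier L" using r R by auto
    show "hinner T (t s r) x = 0" if "s \<in> S" for s
    proof -
      have "s \<in> hcarrier H" using that S by auto
      then show ?thesis using orth[OF that r] T.inner_cnj[OF x tc[OF _ rL], of s] by simp
    qed
    show "cmod (hinner T (t u r) x) \<le> hnorm L r * hnorm T x * hnorm H u" if "u \<in> hcarrier H" for u
      using bound[OF that rL] by (simp add: mult_ac)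
    show "hinner T (t (hadd H u v) r) x = hinner T (t u r) x + hinner T (t v r) x"
      if "u \<in> hcarrier H" "v \<in> hcarrier H" for u v
      using that rL x by (simp add: ta tc T.inner_add)
    show "hinner T (t (hscale H c u) r) x = c * hinner T (t u r) x" if "u \<in> hcarrier H" for c u
      using that rL x by (simp add: ts tc T.inner_scale)
  qed (use S a in auto)
  have 2: "hinner T (t a b) x = 0" if a: "a \<in> hcarrier H" and b: "b \<in> hcarrier L" for a b
  proof (rule L.functional_zero_on_closure[where S = R and F = "\<lambda>b. hinner T (t a b) x" and C = "hnorm H a * hnorm T x"])
    show "cmod (hinner T (t a u) x) \<le> hnorm H a * hnorm T x * hnorm L u" if "u \<in> hcarrier L" for u
      using bound[OF a that] by (simp add: mult_ac)
    show "hinner T (t a (hadd L u v)) x = hinner T (t a u) x + hinner T (t a v) x"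
      if "u \<in> hcarrier L" "v \<in> hcarrier L" for u v
      using that a x by (simp add: tb tc T.inner_add)
    show "hinner T (t a (hscale L c u)) x = c * hinner T (t a u) x" if "u \<in> hcarrier L" for c u
      using that a x by (simp add: ts tc T.inner_scale)
  qed (use R b 1[OF a] in auto)
  show ?thesis
  proof (rule closure_span_total[where H = T and S = "{t a b | a b. a \<in> hcarrier H \<and> b \<in> hcarrier L}"])
    show "pre_hilbert_space T" by unfold_locales
    show "hclosure T (hspan T {t a b |a b. a \<in> hcarrier H \<and> b \<in> hcarrier L}) = hcarrier T"
      using tp by (simp add: hilbert_tensor_product_def)
    show "hinner T x s = 0" if "s \<in> {t a b |a b. a \<in> hcarrier H \<and> b \<in> hcarrier L}" for s
      using that 2 T.inner_cnj[OF tc x] by auto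
  qed (use x tc in auto)
qed

section \<open>Function spaces isomorphic to a sequence space\<close>

text \<open>Unordered summation, so that one notion serves sequences and families indexed by
  \<open>nat \<times> nat\<close>.\<close>

definition square_summable :: "('i \<Rightarrow> complex) \<Rightarrow> bool" where
  "square_summable a \<longleftrightarrow> (\<lambda>i. (cmod (a i))\<^sup>2) summable_on UNIV"

lemma square_summable_mult:
  assumes "square_summable a" "square_summable b"
  shows "(\<lambda>i. cmod (a i * cnj (b i))) summable_on UNIV"
proof (rule Infinite_Sum.abs_summable_on_comparison_test')
  show "(\<lambda>i. (cmod (a i))\<^sup>2 + (cmod (b i))\<^sup>2) summable_on UNIV"
    using assms unfolding square_summable_def by (rule summable_on_add)
  show "cmod (a i * cnj (b i)) \<le> (cmod (a i))\<^sup>2 + (cmod (b i))\<^sup>2" for i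
    using sum_squares_bound[of "cmod (a i)" "cmod (b i)"]
      mult_nonneg_nonneg[OF norm_ge_zero[of "a i"] norm_ge_zero[of "b i"]]
    by (simp add: norm_mult del: mult_nonneg_nonneg)
qed

lemma square_summable_add:
  assumes "square_summable a" "square_summable b"
  shows "square_summable (\<lambda>i. a i + b i)"
  unfolding square_summable_def
proof (rule summable_on_comparison_test)
  show "(\<lambda>i. 2 * (cmod (a i))\<^sup>2 + 2 * (cmod (b i))\<^sup>2) summable_on UNIV"
    using assms unfolding square_summable_def by (intro summable_on_add summable_on_cmult_right)
  show "(cmod (a i + b i))\<^sup>2 \<le> 2 * (cmod (a i))\<^sup>2 + 2 * (cmod (b i))\<^sup>2" for i
  proof -
    have "(cmod (a i + b i))\<^sup>2 \<le> (cmod (a i) + cmod (b i))\<^sup>2"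
      by (intro power_mono norm_triangle_ineq) simp
    also have "\<dots> \<le> 2 * (cmod (a i))\<^sup>2 + 2 * (cmod (b i))\<^sup>2"
      using sum_squares_bound[of "cmod (a i)" "cmod (b i)"] by (simp add: power2_sum)
    finally show ?thesis .
  qed
qed simp

lemma square_summable_scale: "square_summable a \<Longrightarrow> square_summable (\<lambda>i. c * a i)"
  unfolding square_summable_def norm_mult power_mult_distrib by (rule summable_on_cmult_right)

lemma square_summableI_bounded:
  assumes "\<And>F. finite F \<Longrightarrow> (\<Sum>i\<in>F. (cmod (a i))\<^sup>2) \<le> C"
  shows "square_summable a"
  unfolding square_summable_def
  by (rule nonneg_bdd_above_summable_on) (auto intro!: bdd_aboveI[of _ C] assms)

lemma square_summable_bounded:
  assumes "square_summable a"
  obtains C where "\<And>i. cmod (a i) \<le> C"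
proof -
  have "(cmod (a i))\<^sup>2 \<le> (\<Sum>\<^sub>\<infinity>i. (cmod (a i))\<^sup>2)" for i
    using finite_sum_le_infsum[of "\<lambda>i. (cmod (a i))\<^sup>2" UNIV "{i}"] assms
    by (simp add: square_summable_def)
  then have "cmod (a i) \<le> sqrt (\<Sum>\<^sub>\<infinity>i. (cmod (a i))\<^sup>2)" for i
    by (rule real_le_rsqrt)
  then show thesis using that by blast
qed

lemma fun_space_simps [simp]:
  "hcarrier (fun_space S ip) = S" "hzero (fun_space S ip) = (\<lambda>x. 0)"
  "hadd (fun_space S ip) = (\<lambda>f g x. f x + g x)" "hscale (fun_space S ip) = (\<lambda>c f x. c * f x)"
  "hinner (fun_space S ip) = ip"
  "hdiff (fun_space S ip) = (\<lambda>f g x. f x - g x)"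
  by (simp_all add: fun_space_def hdiff_def fun_eq_iff)

text \<open>The common pattern of the three function spaces: a linear, injective coefficient map
  into l2 that carries \<open>ip\<close> to the standard inner product. The equations are required
  on S only, where the limits and integrals behind \<open>ip\<close> make sense. Surjectivity onto
  l2 is a hypothesis of \<open>hilbert\<close>, since it is what yields completeness.\<close>

locale coefficient_space =
  fixes S :: "('x \<Rightarrow> complex) set"
    and ip :: "('x \<Rightarrow> complex) \<Rightarrow> ('x \<Rightarrow> complex) \<Rightarrow> complex"
    and c :: "('x \<Rightarrow> complex) \<Rightarrow> 'i \<Rightarrow> complex"
  assumes S_zero: "(\<lambda>x. 0) \<in> S"
    and S_add: "f \<in> S \<Longrightarrow> g \<in> S \<Longrightarrow> (\<lambda>x. f x + g x) \<in> S"
    and S_scale: "f \<in> S \<Longrightarrow> (\<lambda>x. k * f x) \<in> S"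
    and c_add: "f \<in> S \<Longrightarrow> g \<in> S \<Longrightarrow> c (\<lambda>x. f x + g x) i = c f i + c g i"
    and c_scale: "f \<in> S \<Longrightarrow> c (\<lambda>x. k * f x) i = k * c f i"
    and c_square_summable: "f \<in> S \<Longrightarrow> square_summable (c f)"
    and ip_coef: "f \<in> S \<Longrightarrow> g \<in> S \<Longrightarrow> ip f g = (\<Sum>\<^sub>\<infinity>i. c f i * cnj (c g i))"
    and c_inj: "f \<in> S \<Longrightarrow> (\<And>i. c f i = 0) \<Longrightarrow> f = (\<lambda>x. 0)"
begin

lemma summable_product:
  "f \<in> S \<Longrightarrow> g \<in> S \<Longrightarrow> (\<lambda>i. c f i * cnj (c g i)) summable_on UNIV"
  by (rule abs_summable_summable[OF square_summable_mult[OF c_square_summable c_square_summable]])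

lemma c_diff: "f \<in> S \<Longrightarrow> g \<in> S \<Longrightarrow> c (\<lambda>x. f x - g x) i = c f i - c g i"
  using c_add[OF _ S_scale, of f g "-1"] c_scale[of g "-1"] by simp

lemma S_diff: "f \<in> S \<Longrightarrow> g \<in> S \<Longrightarrow> (\<lambda>x. f x - g x) \<in> S"
  using S_add[OF _ S_scale, of f g "-1"] by simp

lemma ip_self: "f \<in> S \<Longrightarrow> ip f f = of_real (\<Sum>\<^sub>\<infinity>i. (cmod (c f i))\<^sup>2)"
  using c_square_summable[of f] unfolding ip_coef square_summable_def cmod_sq
  by (intro infsumI has_sum_of_real has_sum_infsum)

lemma pre_hilbert: "pre_hilbert_space (fun_space S ip)"
proof (unfold_locales, unfold fun_space_simps)
  fix x assume x: "x \<in> S" "ip x x = 0"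
  have "(cmod (c x i))\<^sup>2 = 0" for i
    by (rule nonneg_infsum_le_0D[where A = UNIV])
       (use x ip_self[OF x(1)] c_square_summable[OF x(1)] in \<open>auto simp: square_summable_def\<close>)
  then show "x = (\<lambda>x. 0)" using c_inj[OF x(1)] by simp
next
  fix x assume "x \<in> S"
  then show "0 \<le> Re (ip x x)" by (simp add: ip_self infsum_nonneg)
next
  fix x y z assume "x \<in> S" "y \<in> S" "z \<in> S"
  then show "ip (\<lambda>xa. x xa + y xa) z = ip x z + ip y z"
    by (simp add: ip_coef S_add c_add distrib_right infsum_add summable_product)
next
  fix x y k assume "x \<in> S" "y \<in> S"
  then show "ip (\<lambda>xa. k * x xa) y = k * ip x y"
    by (simp add: ip_coef S_scale c_scale mult.assoc infsum_cmult_right')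
next
  fix x y assume "x \<in> S" "y \<in> S"
  then show "ip y x = cnj (ip x y)"
    by (simp add: ip_coef mult.commute flip: infsum_cnj)
qed (auto simp: S_zero S_add S_scale algebra_simps fun_eq_iff)

lemma norm_sq_coef:
  "f \<in> S \<Longrightarrow> (hnorm (fun_space S ip) f)\<^sup>2 = (\<Sum>\<^sub>\<infinity>i. (cmod (c f i))\<^sup>2)"
  using pre_hilbert_space.norm_sq[OF pre_hilbert, of f] by (simp add: ip_self)

text \<open>Completeness of l2, pulled back along \<open>c\<close>. The estimates are made on finite
  index sets F, because there the limit in the second index q can be taken term by term; letting F
  grow afterwards bounds the full norm.\<close>

lemma hilbert:
  assumes surj: "\<And>a. square_summable a \<Longrightarrow> \<exists>f\<in>S. \<forall>i. c f i = a i"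
  shows "complex_hilbert_space (fun_space S ip)"
proof -
  let ?H = "fun_space S ip"
  interpret P: pre_hilbert_space ?H by (rule pre_hilbert)
  have "\<exists>x\<in>hcarrier ?H. (\<lambda>n. hnorm ?H (hdiff ?H (X n) x)) \<longlonglongrightarrow> 0"
    if "\<And>n. X n \<in> hcarrier ?H"
      and cau: "\<forall>e>0. \<exists>N. \<forall>p\<ge>N. \<forall>q\<ge>N. hnorm ?H (hdiff ?H (X p) (X q)) < e" for X
  proof -
    have X: "X n \<in> S" for n using that(1) by simp
    have fin: "(\<Sum>i\<in>F. (cmod (c (X p) i - c (X q) i))\<^sup>2) \<le> (hnorm ?H (hdiff ?H (X p) (X q)))\<^sup>2"
      if "finite F" for F p q
      using that X S_diff[OF X X, of p q] c_square_summable[OF S_diff[OF X X], of p q]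
      by (simp add: norm_sq_coef square_summable_def flip: c_diff)
         (rule finite_sum_le_infsum, auto)
    have fin_lt: "\<exists>N. \<forall>p\<ge>N. \<forall>q\<ge>N. \<forall>F. finite F \<longrightarrow>
        (\<Sum>i\<in>F. (cmod (c (X p) i - c (X q) i))\<^sup>2) \<le> e\<^sup>2" if e: "e > 0" for e
    proof -
      obtain N where N: "\<And>p q. p \<ge> N \<Longrightarrow> q \<ge> N \<Longrightarrow> hnorm ?H (hdiff ?H (X p) (X q)) < e"
        using cau e by blast
      have "(\<Sum>i\<in>F. (cmod (c (X p) i - c (X q) i))\<^sup>2) \<le> e\<^sup>2"
        if "p \<ge> N" "q \<ge> N" "finite F" for p q F
      proof -
        have "(hnorm ?H (hdiff ?H (X p) (X q)))\<^sup>2 \<le> e\<^sup>2"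
          using N[OF that(1,2)] X by (intro power_mono P.norm_nonneg P.diff_closed) auto
        then show ?thesis using fin[OF that(3)] order_trans by blast
      qed
      then show ?thesis by blast
    qed
    have "Cauchy (\<lambda>p. c (X p) i)" for i
    proof (rule metric_CauchyI)
      fix e :: real assume e: "e > 0"
      obtain N where N: "\<forall>p\<ge>N. \<forall>q\<ge>N. \<forall>F. finite F \<longrightarrow>
          (\<Sum>i\<in>F. (cmod (c (X p) i - c (X q) i))\<^sup>2) \<le> (e/2)\<^sup>2"
        using fin_lt[of "e/2"] e by auto
      have "dist (c (X p) i) (c (X q) i) < e" if "p \<ge> N" "q \<ge> N" for p q
      proof -
        have "(cmod (c (X p) i - c (X q) i))\<^sup>2 \<le> (e/2)\<^sup>2"
          using N[rule_format, OF that, of "{i}"] by simp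
        then have "cmod (c (X p) i - c (X q) i) \<le> e/2"
          by (rule power2_le_imp_le) (use e in simp)
        then show ?thesis using e by (simp add: dist_norm)
      qed
      then show "\<exists>N. \<forall>p\<ge>N. \<forall>q\<ge>N. dist (c (X p) i) (c (X q) i) < e" by blast
    qed
    then have "\<forall>i. \<exists>l. (\<lambda>p. c (X p) i) \<longlonglongrightarrow> l"
      by (auto simp: Cauchy_convergent_iff convergent_def)
    then obtain a where a: "\<And>i. (\<lambda>p. c (X p) i) \<longlonglongrightarrow> a i" by metis
    have lim_lt: "\<exists>N. \<forall>p\<ge>N. \<forall>F. finite F \<longrightarrow> (\<Sum>i\<in>F. (cmod (c (X p) i - a i))\<^sup>2) \<le> e\<^sup>2"
      if e: "e > 0" for e
    proof -
      obtain N where N: "\<forall>p\<ge>N. \<forall>q\<ge>N. \<forall>F. finite F \<longrightarrow>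
          (\<Sum>i\<in>F. (cmod (c (X p) i - c (X q) i))\<^sup>2) \<le> e\<^sup>2"
        using fin_lt[OF e] by blast
      have "(\<Sum>i\<in>F. (cmod (c (X p) i - a i))\<^sup>2) \<le> e\<^sup>2" if "p \<ge> N" "finite F" for p F
      proof (rule tendsto_upperbound)
        show "(\<lambda>q. \<Sum>i\<in>F. (cmod (c (X p) i - c (X q) i))\<^sup>2) \<longlonglongrightarrow> (\<Sum>i\<in>F. (cmod (c (X p) i - a i))\<^sup>2)"
          by (intro tendsto_intros a)
        show "\<forall>\<^sub>F q in sequentially. (\<Sum>i\<in>F. (cmod (c (X p) i - c (X q) i))\<^sup>2) \<le> e\<^sup>2"
          using N that by (auto simp: eventually_sequentially)
      qed simp
      then show ?thesis by blast
    qed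
    \<comment> \<open>The limit a is square summable as the difference of \<open>c (X N)\<close> and
      \<open>\<lambda>i. c (X N) i - a i\<close>.\<close>
    have "\<exists>N. \<forall>p\<ge>N. square_summable (\<lambda>i. c (X p) i - a i)"
      using lim_lt[of 1] square_summableI_bounded by (metis zero_less_one)
    then obtain N where "square_summable (\<lambda>i. c (X N) i - a i)" by blast
    from square_summable_add[OF c_square_summable[OF X, of N] square_summable_scale[OF this, of "-1"]]
    have "square_summable a" by simp
    then obtain f where f: "f \<in> S" "\<And>i. c f i = a i" using surj by blast
    have "(\<lambda>n. hnorm ?H (hdiff ?H (X n) f)) \<longlonglongrightarrow> 0"
    proof (rule LIMSEQ_I)
      fix e :: real assume e: "e > 0"
      obtain N where N: "\<And>p F. p \<ge> N \<Longrightarrow> finite F \<Longrightarrow>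
          (\<Sum>i\<in>F. (cmod (c (X p) i - a i))\<^sup>2) \<le> (e/2)\<^sup>2"
        using lim_lt[of "e/2"] e by auto
      have "norm (hnorm ?H (hdiff ?H (X p) f) - 0) < e" if "p \<ge> N" for p
      proof -
        have d: "(\<lambda>x. X p x - f x) \<in> S" using X f by (intro S_diff)
        have "(hnorm ?H (hdiff ?H (X p) f))\<^sup>2 \<le> (e/2)\<^sup>2"
          using N[OF that] X f c_square_summable[OF d] d
          by (simp add: norm_sq_coef c_diff square_summable_def)
             (rule infsum_le_finite_sums, auto)
        then have "hnorm ?H (hdiff ?H (X p) f) \<le> e/2"
          by (rule power2_le_imp_le) (use e in simp)
        then show ?thesis using e P.norm_nonneg[of "\<lambda>x. X p x - f x"] d by simp
      qed
      then show "\<exists>N. \<forall>n\<ge>N. norm (hnorm ?H (hdiff ?H (X n) f) - 0) < e" by blast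
    qed
    with f(1) show ?thesis by auto
  qed
  then show ?thesis by (rule P.complex_hilbert_spaceI)
qed

end

section \<open>Abel means\<close>

lemma eventually_at_left_1: "\<forall>\<^sub>F r in at_left (1::real). r \<in> {0..<1}"
  using eventually_at_left[of 0 "1::real"] by (auto intro!: exI[of _ 0])

text \<open>Abel's theorem for absolutely summable families over any index type. The function d is
  the degree of a monomial, n on the disc and i + n on the bidisc; it is doubled because both
  factors of f times conjugate g scale with r.\<close>

lemma abel_limit_infsum:
  fixes a :: "'i \<Rightarrow> complex" and d :: "'i \<Rightarrow> nat"
  assumes a: "(\<lambda>i. cmod (a i)) summable_on UNIV"
  shows "((\<lambda>r. \<Sum>\<^sub>\<infinity>i. a i * of_real (r ^ (2 * d i))) \<longlongrightarrow> (\<Sum>\<^sub>\<infinity>i. a i)) (at_left (1::real))"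
proof -
  have r_le: "r ^ n \<le> 1" if "r \<in> {0..<1}" for r :: real and n
    using that by (simp add: power_le_one)
  have scaled: "cmod (a i * of_real s) \<le> cmod (a i)" if "0 \<le> s" "s \<le> 1" for s i
    using mult_left_le[OF that(2) norm_ge_zero[of "a i"]] that(1) by (simp add: norm_mult)
  have bound: "cmod (a i * of_real (1 - r ^ (2 * d i))) \<le> cmod (a i)" if "r \<in> {0..<1}" for r i
    using r_le[OF that, of "2 * d i"] that by (intro scaled) auto
  have diff: "(\<Sum>\<^sub>\<infinity>i. a i) - (\<Sum>\<^sub>\<infinity>i. a i * of_real (r ^ (2 * d i))) =
      (\<Sum>\<^sub>\<infinity>i. a i * of_real (1 - r ^ (2 * d i)))" if r: "r \<in> {0..<1}" for r
  proof -
    have 1: "(\<lambda>i. a i * of_real (r ^ (2 * d i))) summable_on UNIV"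
      by (rule abs_summable_summable[OF Infinite_Sum.abs_summable_on_comparison_test[OF a scaled]])
        (use r_le[OF r] r in auto)
    have 2: "(\<lambda>i. a i * of_real (1 - r ^ (2 * d i))) summable_on UNIV"
      by (rule abs_summable_summable[OF Infinite_Sum.abs_summable_on_comparison_test[OF a bound[OF r]]])
    show ?thesis
      using infsum_add[OF 1 2] by (simp add: algebra_simps)
  qed
  have "\<forall>\<^sub>F r in at_left 1. dist (\<Sum>\<^sub>\<infinity>i. a i * of_real (r ^ (2 * d i))) (\<Sum>\<^sub>\<infinity>i. a i) < e"
    if e: "e > 0" for e
  proof -
    \<comment> \<open>Outside F the factor 1 - r^(2 d) is at most 1, so the tail stays below e/2
      uniformly in r; on F finitely many terms tend to 0 as r tends to 1.\<close>
    obtain F where F: "finite F" "dist (\<Sum>i\<in>F. cmod (a i)) (\<Sum>\<^sub>\<infinity>i. cmod (a i)) \<le> e/2"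
      using infsum_finite_approximation[OF a, of "e/2"] e by auto
    have tail: "(\<Sum>\<^sub>\<infinity>i\<in>-F. cmod (a i)) \<le> e/2"
    proof -
      have "(\<lambda>i. cmod (a i)) summable_on -F"
        using a by (rule summable_on_subset_banach) auto
      then have "(\<Sum>\<^sub>\<infinity>i. cmod (a i)) = (\<Sum>i\<in>F. cmod (a i)) + (\<Sum>\<^sub>\<infinity>i\<in>-F. cmod (a i))"
        using infsum_Un_disjoint[of "\<lambda>i. cmod (a i)" F "-F"] F(1) by (simp add: Compl_partition)
      then show ?thesis using F(2) by (simp add: dist_real_def)
    qed
    have "((\<lambda>r::real. \<Sum>i\<in>F. cmod (a i * of_real (1 - r ^ (2 * d i)))) \<longlongrightarrow>
        (\<Sum>i\<in>F. cmod (a i * of_real (1 - 1 ^ (2 * d i))))) (at_left 1)"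
      by (intro tendsto_intros)
    then have "\<forall>\<^sub>F r in at_left (1::real). (\<Sum>i\<in>F. cmod (a i * of_real (1 - r ^ (2 * d i)))) < e/2"
      using e by (intro order_tendstoD(2)) auto
    moreover note eventually_at_left_1
    ultimately show ?thesis
    proof eventually_elim
      case (elim r)
      let ?b = "\<lambda>i. a i * of_real (1 - r ^ (2 * d i))"
      have bs: "(\<lambda>i. cmod (?b i)) summable_on UNIV"
        by (intro Infinite_Sum.abs_summable_on_comparison_test[OF a] bound elim(2))
      have bs': "(\<lambda>i. cmod (?b i)) summable_on -F" "(\<lambda>i. cmod (a i)) summable_on -F"
        using bs a by (auto intro: summable_on_subset_banach)
      have "cmod (\<Sum>\<^sub>\<infinity>i. ?b i) \<le> (\<Sum>\<^sub>\<infinity>i. cmod (?b i))"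
        by (rule norm_infsum_bound[OF bs])
      also have "\<dots> = (\<Sum>i\<in>F. cmod (?b i)) + (\<Sum>\<^sub>\<infinity>i\<in>-F. cmod (?b i))"
        using infsum_Un_disjoint[of "\<lambda>i. cmod (?b i)" F "-F"] F(1) bs'(1)
        by (simp add: Compl_partition)
      also have "(\<Sum>\<^sub>\<infinity>i\<in>-F. cmod (?b i)) \<le> (\<Sum>\<^sub>\<infinity>i\<in>-F. cmod (a i))"
        by (intro infsum_mono bs' bound elim(2))
      finally have "cmod (\<Sum>\<^sub>\<infinity>i. ?b i) < e" using elim(1) tail by linarith
      then show ?case
        using diff[OF elim(2)] by (metis dist_commute dist_norm)
    qed
  qed
  then show ?thesis by (auto intro: tendstoI)
qed

lemma Lim_abel:
  fixes a :: "'i \<Rightarrow> complex" and d :: "'i \<Rightarrow> nat"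
  assumes a: "(\<lambda>i. cmod (a i)) summable_on UNIV"
    and M: "\<And>r. r \<in> {0..<1} \<Longrightarrow> M r = (\<Sum>\<^sub>\<infinity>i. a i * of_real (r ^ (2 * d i)))"
  shows "(M \<longlongrightarrow> (\<Sum>\<^sub>\<infinity>i. a i)) (at_left (1::real))"
    and "Lim (at_left (1::real)) M = (\<Sum>\<^sub>\<infinity>i. a i)"
proof -
  note eventually_at_left_1
  then have "\<forall>\<^sub>F r in at_left (1::real). (\<Sum>\<^sub>\<infinity>i. a i * of_real (r ^ (2 * d i))) = M r"
    by eventually_elim (simp add: M)
  with abel_limit_infsum[OF a, of d] show "(M \<longlongrightarrow> (\<Sum>\<^sub>\<infinity>i. a i)) (at_left (1::real))"
    by (rule Lim_transform_eventually)
  then show "Lim (at_left (1::real)) M = (\<Sum>\<^sub>\<infinity>i. a i)"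
    by (intro tendsto_Lim) auto
qed

text \<open>Translates bounded means, the growth condition in the Hardy spaces, into square summable
  coefficients. Forward, each finite sum is bounded by C for r < 1 and passes to the limit;
  backward, r^(2 d) \<le> 1.\<close>

lemma square_summable_iff_abel:
  fixes a :: "'i \<Rightarrow> complex" and d :: "'i \<Rightarrow> nat"
  assumes s: "\<And>r. r \<in> {0..<1} \<Longrightarrow> (\<lambda>i. (cmod (a i))\<^sup>2 * r ^ (2 * d i)) summable_on UNIV"
    and M: "\<And>r. r \<in> {0..<1} \<Longrightarrow> M r = (\<Sum>\<^sub>\<infinity>i. (cmod (a i))\<^sup>2 * r ^ (2 * d i))"
  shows "(\<exists>C. \<forall>r\<in>{0..<1::real}. M r \<le> C) \<longleftrightarrow> square_summable a"
proof
  assume "\<exists>C. \<forall>r\<in>{0..<1}. M r \<le> C"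
  then obtain C where C: "\<And>r. r \<in> {0..<1} \<Longrightarrow> M r \<le> C" by blast
  show "square_summable a"
  proof (rule square_summableI_bounded)
    fix F :: "'i set" assume F: "finite F"
    have "((\<lambda>r. \<Sum>i\<in>F. (cmod (a i))\<^sup>2 * r ^ (2 * d i)) \<longlongrightarrow> (\<Sum>i\<in>F. (cmod (a i))\<^sup>2 * 1 ^ (2 * d i)))
        (at_left (1::real))"
      by (intro tendsto_intros)
    moreover note eventually_at_left_1
    then have "\<forall>\<^sub>F r in at_left (1::real). (\<Sum>i\<in>F. (cmod (a i))\<^sup>2 * r ^ (2 * d i)) \<le> C"
    proof eventually_elim
      case (elim r)
      have "(\<Sum>i\<in>F. (cmod (a i))\<^sup>2 * r ^ (2 * d i)) \<le> M r"
        unfolding M[OF elim] using F elim by (intro finite_sum_le_infsum s) auto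
      with C[OF elim] show ?case by linarith
    qed
    ultimately have "(\<Sum>i\<in>F. (cmod (a i))\<^sup>2 * 1 ^ (2 * d i)) \<le> C"
      by (intro tendsto_upperbound) auto
    then show "(\<Sum>i\<in>F. (cmod (a i))\<^sup>2) \<le> C" by simp
  qed
next
  assume a: "square_summable a"
  have "M r \<le> (\<Sum>\<^sub>\<infinity>i. (cmod (a i))\<^sup>2)" if "r \<in> {0..<1}" for r
    unfolding M[OF that] using a s[OF that] that
    by (intro infsum_mono) (auto simp: square_summable_def mult_left_le power_le_one)
  then show "\<exists>C. \<forall>r\<in>{0..<1}. M r \<le> C" by blast
qed

section \<open>Taylor coefficients on the disc\<close>

definition taylor_coeff :: "(complex \<Rightarrow> complex) \<Rightarrow> nat \<Rightarrow> complex" where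
  "taylor_coeff f n = (deriv ^^ n) f 0 / fact n"

lemma taylor_sums:
  assumes "f holomorphic_on disc" "z \<in> disc"
  shows "(\<lambda>n. taylor_coeff f n * z ^ n) sums f z"
  using holomorphic_power_series[OF assms] by (simp add: taylor_coeff_def)

text \<open>Uniqueness of power series; later coefficients are read off from expansions through this
  rule.\<close>

lemma taylor_coeff_eqI:
  assumes "\<And>z. z \<in> disc \<Longrightarrow> (\<lambda>n. a n * z ^ n) sums f z"
  shows "taylor_coeff f n = a n"
proof -
  have "f has_fps_expansion Abs_fps a"
    using assms by (intro has_fps_expansionI eventually_nhds_in_open[THEN eventually_mono, of disc]) auto
  from fps_nth_fps_expansion[OF this, of n] show ?thesis by (simp add: taylor_coeff_def)
qed

lemma power_series_holomorphic_disc: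
  assumes "\<And>z. z \<in> disc \<Longrightarrow> (\<lambda>n. a n * z ^ n) sums f z"
  shows "f holomorphic_on disc"
  using power_series_holomorphic[of 0 1 a f] assms by simp

lemma taylor_summable:
  assumes f: "f holomorphic_on disc" and r: "0 \<le> r" "r < 1"
  shows "summable (\<lambda>n. cmod (taylor_coeff f n) * r ^ n)"
proof -
  \<comment> \<open>The midpoint of r and 1: convergence there gives absolute convergence at radius
    r.\<close>
  let ?x = "of_real ((r + 1) / 2) :: complex"
  have nx: "cmod ?x = (r + 1) / 2" using r by (simp del: of_real_divide of_real_add)
  have "summable (\<lambda>n. taylor_coeff f n * ?x ^ n)"
    using taylor_sums[OF f, of ?x] nx r by (auto simp: sums_iff)
  from powser_insidea[OF this, of "of_real r"] nx r show ?thesis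
    by (simp add: norm_mult norm_power)
qed

lemma taylor_coeff_add:
  assumes "f holomorphic_on disc" "g holomorphic_on disc"
  shows "taylor_coeff (\<lambda>z. f z + g z) n = taylor_coeff f n + taylor_coeff g n"
  using assms by (intro taylor_coeff_eqI) (auto simp: distrib_right intro!: sums_add taylor_sums)

lemma taylor_coeff_scale:
  assumes "f holomorphic_on disc"
  shows "taylor_coeff (\<lambda>z. c * f z) n = c * taylor_coeff f n"
  using assms by (intro taylor_coeff_eqI) (auto simp: mult.assoc intro!: sums_mult taylor_sums)

lemma taylor_coeff_shift:
  assumes f: "f holomorphic_on disc"
  shows "taylor_coeff (\<lambda>z. z * f z) n = (case n of 0 \<Rightarrow> 0 | Suc k \<Rightarrow> taylor_coeff f k)"
proof (rule taylor_coeff_eqI)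
  fix z :: complex assume z: "z \<in> disc"
  have "(\<lambda>n. z * (taylor_coeff f n * z ^ n)) sums (z * f z)"
    by (intro sums_mult taylor_sums f z)
  then show "(\<lambda>n. (case n of 0 \<Rightarrow> 0 | Suc k \<Rightarrow> taylor_coeff f k) * z ^ n) sums (z * f z)"
    using sums_Suc_iff[of "\<lambda>n. (case n of 0 \<Rightarrow> 0 | Suc k \<Rightarrow> taylor_coeff f k) * z ^ n" "z * f z"]
    by (simp add: algebra_simps)
qed

lemma taylor_coeff_cong:
  assumes "\<And>z. z \<in> disc \<Longrightarrow> f z = g z" "g holomorphic_on disc"
  shows "taylor_coeff f n = taylor_coeff g n"
  using assms by (intro taylor_coeff_eqI) (simp add: taylor_sums)

lemma taylor_coeff_eq_0:
  assumes "f holomorphic_on disc" "\<And>n. taylor_coeff f n = 0" "z \<in> disc"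
  shows "f z = 0"
  using taylor_sums[OF assms(1,3)] assms(2) sums_unique2[OF _ sums_zero] by auto

lemma taylor_coeff_bound:
  assumes f: "f holomorphic_on disc" and r: "0 < r" "r < 1"
    and M: "\<And>z. cmod z = r \<Longrightarrow> cmod (f z) \<le> M"
  shows "cmod (taylor_coeff f n) \<le> M / r ^ n"
proof -
  have "cball 0 r \<subseteq> disc" using r by auto
  then have "continuous_on (cball 0 r) f" "f holomorphic_on ball 0 r"
    using f by (auto intro!: holomorphic_on_imp_continuous_on elim!: holomorphic_on_subset)
  from Cauchy_inequality[OF this(2,1) r(1), of M n] M
  have "cmod ((deriv ^^ n) f 0) \<le> fact n * M / r ^ n" by simp
  then show ?thesis by (simp add: taylor_coeff_def norm_divide field_simps)
qed

section \<open>Integrals over circles\<close>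

text \<open>Termwise integration under a summable majorant, for Fourier series on the circle and for
  the slice expansion on the torus.\<close>

lemma series_set_integral:
  fixes h :: "nat \<Rightarrow> real \<Rightarrow> complex"
  assumes ab: "a \<le> b" and cont: "\<And>i. continuous_on {a..b} (h i)"
    and bound: "\<And>i x. x \<in> {a..b} \<Longrightarrow> cmod (h i x) \<le> C i" and C: "summable C"
  shows "(\<lambda>i. LINT x:{a..b}|lborel. h i x) sums (LINT x:{a..b}|lborel. \<Sum>i. h i x)"
proof -
  let ?h = "\<lambda>i x. indicator {a..b} x *\<^sub>R h i x"
  have int: "integrable lborel (?h i)" for i
    using borel_integrable_atLeastAtMost'[OF cont] by (simp add: set_integrable_def)
  have bnd: "cmod (?h i x) \<le> indicator {a..b} x * \<bar>C i\<bar>" for i and x :: real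
    using bound[of x i] by (auto simp: indicator_def)
  have "summable (\<lambda>i. cmod (?h i x))" for x :: real
  proof (cases "x \<in> {a..b}")
    case True
    show ?thesis
      by (rule summable_comparison_test'[OF C]) (use True bound in auto)
  qed simp
  moreover have "summable (\<lambda>i. \<integral>x. cmod (?h i x) \<partial>lborel)"
  proof (rule summable_comparison_test'[where g = "\<lambda>i. \<bar>b - a\<bar> * C i"])
    show "summable (\<lambda>i. \<bar>b - a\<bar> * C i)" using C by (rule summable_mult)
    fix i
    show "norm (\<integral>x. cmod (?h i x) \<partial>lborel) \<le> \<bar>b - a\<bar> * C i"
    proof -
      have C0: "0 \<le> C i" using order_trans[OF norm_ge_zero bound[of a i]] ab by simp
      have "(\<integral>x. cmod (?h i x) \<partial>lborel) \<le> (\<integral>x. indicator {a..b} x *\<^sub>R C i \<partial>lborel)"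
      proof (rule integral_mono)
        show "integrable lborel (\<lambda>x. cmod (?h i x))" using int by (rule integrable_norm)
        show "integrable lborel (\<lambda>x. indicator {a..b} x *\<^sub>R C i)"
          using borel_integrable_atLeastAtMost'[of a b "\<lambda>x. C i"] by (simp add: set_integrable_def)
        show "cmod (?h i x) \<le> indicator {a..b} x *\<^sub>R C i" for x :: real
          using bnd[of x i] C0 by simp
      qed
      then show ?thesis using ab C0 by (simp add: integral_nonneg_AE)
    qed
  qed
  ultimately have "(\<lambda>i. integral\<^sup>L lborel (?h i)) sums (\<integral>x. (\<Sum>i. ?h i x) \<partial>lborel)"
    by (intro sums_integral int) auto
  moreover have "(\<Sum>i. ?h i x) = indicator {a..b} x *\<^sub>R (\<Sum>i. h i x)" for x :: real
    by (cases "x \<in> {a..b}") simp_all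
  ultimately show ?thesis by (simp add: set_lebesgue_integral_def)
qed

lemma integral_cis:
  "(LINT t:{0..2*pi}|lborel. cis (real n * t) * cnj (cis (real m * t))) = (if n = m then 2 * pi else 0)"
proof (cases "n = m")
  case True
  then show ?thesis by (simp add: set_lebesgue_integral_def cis_cnj cis_mult scaleR_conv_of_real)
next
  case False
  define k where "k = real n - real m"
  have k: "k \<noteq> 0" using False by (simp add: k_def)
  have eq: "cis (real n * t) * cnj (cis (real m * t)) = cis (k * t)" for t
    by (simp add: k_def cis_cnj cis_mult algebra_simps)
  have "(LINT t:{0..2*pi}|lborel. cis (k * t)) =
      cis (k * (2 * pi)) / (\<i> * of_real k) - cis (k * 0) / (\<i> * of_real k)"
    unfolding set_lebesgue_integral_def
  proof (rule integral_FTC_atLeastAtMost)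
    fix t :: real
    have "((\<lambda>z. exp (\<i> * of_real k * z) / (\<i> * of_real k)) has_field_derivative
        exp (\<i> * of_real k * of_real t)) (at (of_real t))"
      using k by (auto intro!: derivative_eq_intros)
    from has_vector_derivative_real_field[OF this, of "{0..2*pi}"]
    show "((\<lambda>t. cis (k * t) / (\<i> * of_real k)) has_vector_derivative cis (k * t))
        (at t within {0..2*pi})"
      by (simp add: cis_conv_exp mult.assoc)
  qed (auto intro!: continuous_intros)
  \<comment> \<open>Read off at t = 2 pi from the product of two characters, each of which equals 1
    there.\<close>
  also have "cis (k * (2 * pi)) = 1"
    using eq[of "2 * pi"] cis_multiple_2pi[of "real n"] cis_multiple_2pi[of "real m"]
    by (simp add: mult.commute)
  finally show ?thesis using False by (simp add: eq)
qed

lemma summable_cmod_mult_cnj: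
  assumes A: "summable (\<lambda>n. cmod (A n))" and B: "summable (\<lambda>n. cmod (B n))"
  shows "summable (\<lambda>n. cmod (A n * cnj (B n)))"
proof (rule summable_comparison_test'[where g = "\<lambda>n. (\<Sum>n. cmod (A n)) * cmod (B n)"])
  show "summable (\<lambda>n. (\<Sum>n. cmod (A n)) * cmod (B n))" using B by (rule summable_mult)
  have "cmod (A n) \<le> (\<Sum>n. cmod (A n))" for n
    using sum_le_suminf[OF A, of "{n}"] by simp
  then show "norm (cmod (A n * cnj (B n))) \<le> (\<Sum>n. cmod (A n)) * cmod (B n)" for n
    by (simp add: norm_mult mult_right_mono)
qed

text \<open>Parseval with one series expanded at a time: the first integration isolates the Fourier
  coefficient \<open>A m\<close>, the second expands the conjugated factor. No double series has to
  be rearranged.\<close>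

lemma circle_integral_series:
  assumes A: "summable (\<lambda>n. cmod (A n))" and B: "summable (\<lambda>n. cmod (B n))"
  shows "(LINT t:{0..2*pi}|lborel. (\<Sum>n. A n * cis (real n * t)) * cnj (\<Sum>n. B n * cis (real n * t)))
    = 2 * pi * (\<Sum>n. A n * cnj (B n))"
proof -
  have sumA: "summable (\<lambda>n. A n * cis (real n * t))" for t
    by (rule summable_norm_cancel) (simp add: norm_mult A)
  have sumB: "summable (\<lambda>n. B n * cis (real n * t))" for t
    by (rule summable_norm_cancel) (simp add: norm_mult B)
  define F where "F t = (\<Sum>n. A n * cis (real n * t))" for t
  define K where "K = (\<Sum>n. cmod (A n))"
  have F_bound: "cmod (F t) \<le> K" for t
    unfolding F_def K_def using summable_norm[of "\<lambda>n. A n * cis (real n * t)"] A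
    by (simp add: norm_mult)
  have F_cont: "continuous_on UNIV F"
    unfolding F_def
    by (rule uniform_limit_theorem[OF _ Weierstrass_m_test[OF _ A]])
       (auto intro!: always_eventually continuous_intros simp: norm_mult)
  have one: "(LINT t:{0..2*pi}|lborel. F t * cnj (cis (real m * t))) = 2 * pi * A m" for m
  proof -
    have "(\<lambda>n. LINT t:{0..2*pi}|lborel. A n * cis (real n * t) * cnj (cis (real m * t))) sums
      (LINT t:{0..2*pi}|lborel. \<Sum>n. A n * cis (real n * t) * cnj (cis (real m * t)))"
      by (rule series_set_integral[OF _ _ _ A]) (auto intro!: continuous_intros simp: norm_mult)
    also have "(\<lambda>n. LINT t:{0..2*pi}|lborel. A n * cis (real n * t) * cnj (cis (real m * t))) =
        (\<lambda>n. if n = m then 2 * pi * A n else 0)"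
      by (simp add: mult.assoc integral_cis if_distrib cong: if_cong) (auto simp: fun_eq_iff)
    also have "(\<lambda>t. \<Sum>n. A n * cis (real n * t) * cnj (cis (real m * t))) = (\<lambda>t. F t * cnj (cis (real m * t)))"
      unfolding F_def by (intro ext suminf_mult2[symmetric] sumA)
    finally show ?thesis
      using sums_unique2 sums_single[of m "\<lambda>n. 2 * pi * A n"] by blast
  qed
  have "(\<lambda>n. LINT t:{0..2*pi}|lborel. cnj (B n) * (F t * cnj (cis (real n * t)))) sums
      (LINT t:{0..2*pi}|lborel. \<Sum>n. cnj (B n) * (F t * cnj (cis (real n * t))))"
  proof (rule series_set_integral)
    show "summable (\<lambda>n. cmod (B n) * K)" using B by (rule summable_mult2)
    show "cmod (cnj (B i) * (F x * cnj (cis (real i * x)))) \<le> cmod (B i) * K" for i x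
      using F_bound[of x] by (simp add: norm_mult mult_left_mono)
    show "continuous_on {0..2*pi} (\<lambda>t. cnj (B i) * (F t * cnj (cis (real i * t))))" for i
      by (intro continuous_intros continuous_on_subset[OF F_cont]) auto
  qed simp
  also have "(\<lambda>t. \<Sum>n. cnj (B n) * (F t * cnj (cis (real n * t)))) =
      (\<lambda>t. F t * cnj (\<Sum>n. B n * cis (real n * t)))"
  proof
    fix t
    have "(\<lambda>n. F t * cnj (B n * cis (real n * t))) sums (F t * cnj (\<Sum>n. B n * cis (real n * t)))"
      by (intro sums_mult sums_cnj[THEN iffD2] summable_sums sumB)
    then show "(\<Sum>n. cnj (B n) * (F t * cnj (cis (real n * t)))) = F t * cnj (\<Sum>n. B n * cis (real n * t))"
      by (simp add: sums_iff algebra_simps)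
  qed
  finally have sums: "(\<lambda>n. LINT t:{0..2*pi}|lborel. cnj (B n) * (F t * cnj (cis (real n * t)))) sums
      (LINT t:{0..2*pi}|lborel. F t * cnj (\<Sum>n. B n * cis (real n * t)))" .
  have "(\<lambda>n. 2 * pi * (A n * cnj (B n))) sums
      (LINT t:{0..2*pi}|lborel. F t * cnj (\<Sum>n. B n * cis (real n * t)))"
  proof -
    have "(LINT t:{0..2*pi}|lborel. cnj (B n) * (F t * cnj (cis (real n * t)))) =
        2 * pi * (A n * cnj (B n))" for n
      by (simp only: set_integral_mult_right one) simp
    with sums show ?thesis by (simp only:)
  qed
  moreover have "summable (\<lambda>n. A n * cnj (B n))"
    using summable_cmod_mult_cnj[OF A B] by (rule summable_norm_cancel)
  then have "(\<lambda>n. 2 * pi * (A n * cnj (B n))) sums (2 * pi * (\<Sum>n. A n * cnj (B n)))"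
    by (intro sums_mult summable_sums)
  ultimately show ?thesis unfolding F_def using sums_unique2 by blast
qed

text \<open>Absorbing r^n into the coefficients makes them absolutely summable for r < 1, and
  Parseval applies. The formula thus covers all holomorphic f and g, before any membership in
  \<open>hardy\<close> is known.\<close>

lemma circle_mean_mult_cnj:
  assumes f: "f holomorphic_on disc" and g: "g holomorphic_on disc" and r: "r \<in> {0..<1}"
  shows "circle_mean r (\<lambda>z. f z * cnj (g z)) =
    (\<Sum>\<^sub>\<infinity>n. taylor_coeff f n * cnj (taylor_coeff g n) * of_real (r ^ (2 * n)))"
    and "(\<lambda>n. cmod (taylor_coeff f n * cnj (taylor_coeff g n) * of_real (r ^ (2 * n)))) summable_on UNIV"
proof -
  have r0: "0 \<le> r" "r < 1" using r by auto
  define A where "A n = taylor_coeff f n * of_real r ^ n" for n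
  define B where "B n = taylor_coeff g n * of_real r ^ n" for n
  have A: "summable (\<lambda>n. cmod (A n))" and B: "summable (\<lambda>n. cmod (B n))"
    using taylor_summable[OF f r0] taylor_summable[OF g r0] r0
    by (simp_all add: A_def B_def norm_mult norm_power)
  have in_disc: "of_real r * cis t \<in> disc" for t
    using r0 by (simp add: norm_mult)
  have fA: "f (of_real r * cis t) = (\<Sum>n. A n * cis (real n * t))" for t
    using taylor_sums[OF f in_disc, of t]
    by (simp add: sums_iff A_def power_mult_distrib Complex.DeMoivre mult.assoc)
  have gB: "g (of_real r * cis t) = (\<Sum>n. B n * cis (real n * t))" for t
    using taylor_sums[OF g in_disc, of t]
    by (simp add: sums_iff B_def power_mult_distrib Complex.DeMoivre mult.assoc)
  have eq: "taylor_coeff f n * cnj (taylor_coeff g n) * of_real (r ^ (2 * n)) = A n * cnj (B n)" for n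
    by (simp add: A_def B_def power_mult power2_eq_square power_mult_distrib mult_ac)
  note ab = summable_cmod_mult_cnj[OF A B]
  show "(\<lambda>n. cmod (taylor_coeff f n * cnj (taylor_coeff g n) * of_real (r ^ (2 * n)))) summable_on UNIV"
    unfolding eq using ab by (intro norm_summable_imp_summable_on) simp
  have "(\<Sum>\<^sub>\<infinity>n. A n * cnj (B n)) = (\<Sum>n. A n * cnj (B n))"
    by (rule infsumI[OF norm_summable_imp_has_sum[OF ab summable_sums[OF summable_norm_cancel[OF ab]]]])
  then show "circle_mean r (\<lambda>z. f z * cnj (g z)) =
    (\<Sum>\<^sub>\<infinity>n. taylor_coeff f n * cnj (taylor_coeff g n) * of_real (r ^ (2 * n)))"
    unfolding circle_mean_def fA gB circle_integral_series[OF A B] eq by simp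
qed

section \<open>The Hardy space of the disc\<close>

text \<open>Parseval with g = f turns the means into Abel sums of the squared moduli of the
  coefficients.\<close>

lemma hardy_carrier_iff:
  "f \<in> hcarrier hardy \<longleftrightarrow> f holomorphic_on disc \<and> (\<forall>z. z \<notin> disc \<longrightarrow> f z = 0) \<and>
    square_summable (taylor_coeff f)"
proof -
  have "(\<exists>C. \<forall>r\<in>{0..<1}. Re (circle_mean r (\<lambda>z. of_real ((cmod (f z))\<^sup>2))) \<le> C) \<longleftrightarrow>
      square_summable (taylor_coeff f)" if f: "f holomorphic_on disc"
  proof (rule square_summable_iff_abel[where d = "\<lambda>n. n"])
    fix r :: real assume r: "r \<in> {0..<1}"
    have eq: "taylor_coeff f n * cnj (taylor_coeff f n) * of_real (r ^ (2 * n)) =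
        of_real ((cmod (taylor_coeff f n))\<^sup>2 * r ^ (2 * n))" for n
      by (simp add: cmod_sq)
    show s: "(\<lambda>n. (cmod (taylor_coeff f n))\<^sup>2 * r ^ (2 * n)) summable_on UNIV"
      using circle_mean_mult_cnj(2)[OF f f r] r unfolding eq norm_of_real by simp
    show "Re (circle_mean r (\<lambda>z. of_real ((cmod (f z))\<^sup>2))) =
        (\<Sum>\<^sub>\<infinity>n. (cmod (taylor_coeff f n))\<^sup>2 * r ^ (2 * n))"
    proof -
      have "(\<Sum>\<^sub>\<infinity>n. complex_of_real ((cmod (taylor_coeff f n))\<^sup>2 * r ^ (2 * n))) =
          of_real (\<Sum>\<^sub>\<infinity>n. (cmod (taylor_coeff f n))\<^sup>2 * r ^ (2 * n))"
        by (intro infsumI has_sum_of_real has_sum_infsum s)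
      then show ?thesis
        using circle_mean_mult_cnj(1)[OF f f r] unfolding eq cmod_sq by simp
    qed
  qed
  then show ?thesis by (auto simp: hardy_def)
qed

text \<open>Gives the inner product a name of its own, so that \<open>hardy\<close> takes the form
  \<open>fun_space S ip\<close> expected by the locale.\<close>

definition hardy_ip :: "(complex \<Rightarrow> complex) \<Rightarrow> (complex \<Rightarrow> complex) \<Rightarrow> complex" where
  "hardy_ip f g = Lim (at_left 1) (\<lambda>r. circle_mean r (\<lambda>z. f z * cnj (g z)))"

lemma hardy_fun_space: "hardy = fun_space (hcarrier hardy) hardy_ip"
  by (simp add: hardy_def hardy_ip_def[abs_def])

lemma hardy_simps [simp]:
  "hzero hardy = (\<lambda>x. 0)"
  "hadd hardy = (\<lambda>f g x. f x + g x)" "hscale hardy = (\<lambda>c f x. c * f x)"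
  "hdiff hardy = (\<lambda>f g x. f x - g x)"
  by (simp_all add: hardy_def)

text \<open>Besides the value of \<open>Lim\<close> the convergence itself is recorded, because the
  isometry of multiplication by \<phi> is proved by following the means as r tends to 1.\<close>

lemma circle_mean_tendsto:
  assumes f: "f \<in> hcarrier hardy" and g: "g \<in> hcarrier hardy"
  shows "((\<lambda>r. circle_mean r (\<lambda>z. f z * cnj (g z))) \<longlongrightarrow>
      (\<Sum>\<^sub>\<infinity>n. taylor_coeff f n * cnj (taylor_coeff g n))) (at_left 1)"
    and hardy_ip_coeff: "hardy_ip f g = (\<Sum>\<^sub>\<infinity>n. taylor_coeff f n * cnj (taylor_coeff g n))"
  unfolding hardy_ip_def
  using Lim_abel[OF square_summable_mult circle_mean_mult_cnj(1)] f g
  unfolding hardy_carrier_iff by blast+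

lemma hardy_zero_off: "f \<in> hcarrier hardy \<Longrightarrow> z \<notin> disc \<Longrightarrow> f z = 0"
  by (simp add: hardy_carrier_iff)

lemma hardy_holomorphic: "f \<in> hcarrier hardy \<Longrightarrow> f holomorphic_on disc"
  by (simp add: hardy_carrier_iff)

interpretation Hc: coefficient_space "hcarrier hardy" hardy_ip taylor_coeff
proof
  show "(\<lambda>x. 0) \<in> hcarrier hardy"
    using taylor_coeff_eqI[of "\<lambda>_. 0" "\<lambda>_. 0"]
    by (simp add: hardy_carrier_iff square_summable_def)
  show "(\<lambda>x. f x + g x) \<in> hcarrier hardy" if "f \<in> hcarrier hardy" "g \<in> hcarrier hardy" for f g
    using that square_summable_add[of "taylor_coeff f" "taylor_coeff g"]
      ext[of "taylor_coeff (\<lambda>x. f x + g x)", OF taylor_coeff_add[of f g]]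
    by (auto simp: hardy_carrier_iff intro!: holomorphic_intros)
  show "(\<lambda>x. k * f x) \<in> hcarrier hardy" if "f \<in> hcarrier hardy" for f k
    using that square_summable_scale[of "taylor_coeff f" k]
      ext[of "taylor_coeff (\<lambda>x. k * f x)", OF taylor_coeff_scale[of f k]]
    by (auto simp: hardy_carrier_iff intro!: holomorphic_intros)
  show "f = (\<lambda>x. 0)" if "f \<in> hcarrier hardy" "\<And>i. taylor_coeff f i = 0" for f
    using that taylor_coeff_eq_0[of f] hardy_zero_off[of f] hardy_holomorphic[of f] by blast
qed (auto simp: hardy_carrier_iff taylor_coeff_add taylor_coeff_scale hardy_ip_coeff)

text \<open>Square summable coefficients are bounded, so inside the disc a geometric series
  dominates.\<close>

lemma hardy_from_coeff:
  assumes a: "square_summable a"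
  obtains f where "f \<in> hcarrier hardy" "\<And>n. taylor_coeff f n = a n"
    "\<And>z. z \<in> disc \<Longrightarrow> (\<lambda>n. a n * z ^ n) sums f z"
proof -
  define f where "f = zero_off disc (\<lambda>z. \<Sum>n. a n * z ^ n)"
  obtain K where K: "\<And>n. cmod (a n) \<le> K" using square_summable_bounded[OF a] by blast
  have ss: "(\<lambda>n. a n * z ^ n) sums f z" if z: "z \<in> disc" for z
  proof -
    have "summable (\<lambda>n. a n * z ^ n)"
    proof (rule summable_norm_cancel, rule summable_comparison_test')
      show "summable (\<lambda>n. K * cmod z ^ n)"
        using z by (intro summable_mult summable_geometric) simp
      show "norm (cmod (a n * z ^ n)) \<le> K * cmod z ^ n" for n
        using K[of n] by (simp add: norm_mult norm_power mult_right_mono)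
    qed
    then show ?thesis using z by (simp add: f_def zero_off_def summable_sums)
  qed
  have c: "taylor_coeff f n = a n" for n using ss by (rule taylor_coeff_eqI)
  have "f \<in> hcarrier hardy"
    using power_series_holomorphic_disc[OF ss] a ext[of "taylor_coeff f" a, OF c]
    by (auto simp: hardy_carrier_iff f_def zero_off_def)
  with c ss show thesis using that by blast
qed

lemma hardy_hilbert: "complex_hilbert_space hardy"
  by (subst hardy_fun_space, rule Hc.hilbert) (metis hardy_from_coeff)

interpretation hardy: pre_hilbert_space hardy
  by (subst hardy_fun_space, rule Hc.pre_hilbert)

lemma hinner_hardy: "hinner hardy = hardy_ip"
  by (subst hardy_fun_space) simp

definition hmonom :: "nat \<Rightarrow> complex \<Rightarrow> complex" where
  "hmonom n = zero_off disc (\<lambda>z. z ^ n)"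

lemma taylor_coeff_hmonom: "taylor_coeff (hmonom n) k = (if k = n then 1 else 0)"
proof (rule taylor_coeff_eqI)
  fix z :: complex assume "z \<in> disc"
  then show "(\<lambda>k. (if k = n then 1 else 0) * z ^ k) sums hmonom n z"
    using sums_single[of n "\<lambda>k. z ^ k"]
    by (simp add: hmonom_def zero_off_def if_distrib[of "\<lambda>x. x * _"] cong: if_cong)
qed

lemma hmonom_hardy: "hmonom n \<in> hcarrier hardy"
proof -
  have "hmonom n holomorphic_on disc"
    by (rule holomorphic_transform[of "\<lambda>z. z ^ n"])
       (auto simp: hmonom_def zero_off_def intro!: holomorphic_intros)
  moreover have "square_summable (taylor_coeff (hmonom n))"
    unfolding square_summable_def taylor_coeff_hmonom
    by (rule finite_nonzero_values_imp_summable_on) (rule finite_subset[of _ "{n}"], auto)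
  ultimately show ?thesis by (simp add: hardy_carrier_iff hmonom_def zero_off_def)
qed

lemma hardy_ip_hmonom:
  assumes f: "f \<in> hcarrier hardy"
  shows "hardy_ip f (hmonom n) = taylor_coeff f n"
proof -
  have "hardy_ip f (hmonom n) = (\<Sum>\<^sub>\<infinity>k\<in>{n}. taylor_coeff f k)"
    unfolding hardy_ip_coeff[OF f hmonom_hardy] taylor_coeff_hmonom
    by (rule infsum_cong_neutral) auto
  then show ?thesis by simp
qed

lemma hmonom_basis: "hardy.orthonormal UNIV hmonom" "hardy.total UNIV hmonom"
  using Hc.c_inj
  by (auto simp: hardy.orthonormal_def hardy.total_def hmonom_hardy hinner_hardy hardy_ip_hmonom
      taylor_coeff_hmonom)

text \<open>Cauchy-Schwarz against the Szego kernel at z, whose coefficients are the powers of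
  \<open>cnj z\<close> and whose squared norm is 1 / (1 - |z|^2). Keeping r apart from |z| gives one
  bound on the whole disc of radius r.\<close>

lemma hardy_pointwise_bound:
  assumes f: "f \<in> hcarrier hardy" and r: "0 \<le> r" "r < 1" and z: "cmod z \<le> r"
  shows "cmod (f z) \<le> hnorm hardy f / sqrt (1 - r\<^sup>2)"
proof -
  have z1: "z \<in> disc" using z r by simp
  have gs: "(\<lambda>n. (cmod (cnj z ^ n))\<^sup>2) sums (1 / (1 - (cmod z)\<^sup>2))"
    using geometric_sums[of "(cmod z)\<^sup>2"] z1
    by (simp add: norm_power power_mult[symmetric] mult.commute abs_square_less_1)
  have hs: "((\<lambda>n. (cmod (cnj z ^ n))\<^sup>2) has_sum (1 / (1 - (cmod z)\<^sup>2))) UNIV"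
    using gs by (rule sums_nonneg_imp_has_sum) simp
  then have ss: "square_summable (\<lambda>n. cnj z ^ n)"
    unfolding square_summable_def by (rule has_sum_imp_summable)
  obtain k where k: "k \<in> hcarrier hardy" "\<And>n. taylor_coeff k n = cnj z ^ n"
    using hardy_from_coeff[OF ss] by metis
  have nk: "(hnorm hardy k)\<^sup>2 = 1 / (1 - (cmod z)\<^sup>2)"
    using Hc.norm_sq_coef[OF k(1)] infsumI[OF hs] unfolding k(2) hardy_fun_space[symmetric] by simp
  have sq: "(cmod z)\<^sup>2 \<le> r\<^sup>2" using z by (simp add: power_mono)
  have r2: "r\<^sup>2 < 1" using r by (simp add: power_less_one_iff abs_square_less_1)
  have "hnorm hardy k \<le> 1 / sqrt (1 - r\<^sup>2)"
  proof (rule power2_le_imp_le)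
    show "(hnorm hardy k)\<^sup>2 \<le> (1 / sqrt (1 - r\<^sup>2))\<^sup>2"
      unfolding nk using sq r2 by (simp add: power_divide frac_le)
    show "0 \<le> 1 / sqrt (1 - r\<^sup>2)" using r2 by simp
  qed
  moreover have "hinner hardy f k = f z"
  proof -
    have "(\<lambda>n. taylor_coeff f n * cnj (taylor_coeff k n)) sums hinner hardy f k"
      unfolding hinner_hardy hardy_ip_coeff[OF f k(1)]
      by (intro has_sum_imp_sums has_sum_infsum Hc.summable_product f k)
    then have "(\<lambda>n. taylor_coeff f n * z ^ n) sums hinner hardy f k"
      by (simp add: k(2))
    with taylor_sums[OF hardy_holomorphic[OF f] z1] show ?thesis
      using sums_unique2 by blast
  qed
  ultimately show ?thesis
    using hardy.cauchy_schwarz[OF f k(1)] mult_left_mono[OF _ hardy.norm_nonneg[OF f]]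
    by (fastforce simp: field_simps)
qed

section \<open>Holomorphic functions on the bidisc\<close>

text \<open>A coefficient in z with w as a parameter; holomorphy in w is not built in but proved in
  \<open>slice_coeff_holomorphic\<close>.\<close>

definition slice_coeff :: "(complex \<times> complex \<Rightarrow> complex) \<Rightarrow> nat \<Rightarrow> complex \<Rightarrow> complex" where
  "slice_coeff f i = (\<lambda>w. taylor_coeff (\<lambda>z. f (z, w)) i)"

definition coeff2 :: "(complex \<times> complex \<Rightarrow> complex) \<Rightarrow> nat \<times> nat \<Rightarrow> complex" where
  "coeff2 f = (\<lambda>(i, n). taylor_coeff (slice_coeff f i) n)"

lemma holomorphic_bidisc_continuous:
  assumes "holomorphic_bidisc f"
  shows "continuous_on (disc \<times> disc) f"
proof (rule continuous_at_imp_continuous_on, rule ballI)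
  fix p assume "p \<in> disc \<times> disc"
  then show "isCont f p"
    using assms has_derivative_continuous unfolding holomorphic_bidisc_def by blast
qed

lemma holomorphic_bidisc_fst:
  assumes f: "holomorphic_bidisc f" and w: "w \<in> disc"
  shows "(\<lambda>z. f (z, w)) holomorphic_on disc"
proof (rule holomorphic_onI)
  fix z :: complex assume z: "z \<in> disc"
  then obtain a b where "(f has_derivative (\<lambda>(u, v). a * u + b * v)) (at (z, w))"
    using f w unfolding holomorphic_bidisc_def by blast
  then have "((\<lambda>z. f (z, w)) has_derivative (\<lambda>u. a * u)) (at z)"
    by (rule has_derivative_eq_rhs[OF has_derivative_compose[where g = f, rotated]])
       (auto intro!: derivative_eq_intros)
  then show "(\<lambda>z. f (z, w)) field_differentiable at z within disc"
    by (auto simp: field_differentiable_def has_field_derivative_def intro!: has_derivative_at_withinI)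
qed

lemma holomorphic_bidisc_snd:
  assumes f: "holomorphic_bidisc f" and z: "z \<in> disc"
  shows "(\<lambda>w. f (z, w)) holomorphic_on disc"
proof (rule holomorphic_onI)
  fix w :: complex assume w: "w \<in> disc"
  then obtain a b where "(f has_derivative (\<lambda>(u, v). a * u + b * v)) (at (z, w))"
    using f z unfolding holomorphic_bidisc_def by blast
  then have "((\<lambda>w. f (z, w)) has_derivative (\<lambda>u. b * u)) (at w)"
    by (rule has_derivative_eq_rhs[OF has_derivative_compose[where g = f, rotated]])
       (auto intro!: derivative_eq_intros)
  then show "(\<lambda>w. f (z, w)) field_differentiable at w within disc"
    by (auto simp: field_differentiable_def has_field_derivative_def intro!: has_derivative_at_withinI)
qed

lemma holomorphic_bidisc_bounded:
  assumes f: "holomorphic_bidisc f" and r: "r < 1"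
  obtains M where "M \<ge> 0" "\<And>z w. cmod z \<le> r \<Longrightarrow> cmod w \<le> r \<Longrightarrow> cmod (f (z, w)) \<le> M"
proof -
  have "continuous_on (cball 0 r \<times> cball 0 r) f"
    using r by (intro continuous_on_subset[OF holomorphic_bidisc_continuous[OF f]]) auto
  then have "bounded (f ` (cball 0 r \<times> cball 0 r))"
    by (intro compact_imp_bounded compact_continuous_image compact_Times compact_cball)
  then obtain M where "\<And>p. p \<in> cball 0 r \<times> cball 0 r \<Longrightarrow> cmod (f p) \<le> M"
    by (auto simp: bounded_iff)
  then have "\<And>z w. cmod z \<le> r \<Longrightarrow> cmod w \<le> r \<Longrightarrow> cmod (f (z, w)) \<le> \<bar>M\<bar>"
    by fastforce
  then show thesis using that abs_ge_zero by blast
qed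

lemma slice_coeff_sums:
  assumes "holomorphic_bidisc f" "z \<in> disc" "w \<in> disc"
  shows "(\<lambda>i. slice_coeff f i w * z ^ i) sums f (z, w)"
  unfolding slice_coeff_def
  using assms taylor_sums[OF holomorphic_bidisc_fst] by blast

lemma slice_coeff_bound:
  assumes f: "holomorphic_bidisc f" and r: "0 < r" "r < 1" and w: "cmod w \<le> r"
    and M: "\<And>z w. cmod z \<le> r \<Longrightarrow> cmod w \<le> r \<Longrightarrow> cmod (f (z, w)) \<le> M"
  shows "cmod (slice_coeff f i w) \<le> M / r ^ i"
  unfolding slice_coeff_def
  by (rule taylor_coeff_bound[OF holomorphic_bidisc_fst[OF f] r]) (use w r M in auto)

lemma slice_coeff_zero_off:
  assumes "\<And>p. p \<notin> disc \<times> disc \<Longrightarrow> f p = 0" "w \<notin> disc"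
  shows "slice_coeff f i w = 0"
proof -
  have "(\<lambda>z. f (z, w)) = (\<lambda>z. 0)" using assms by auto
  then show ?thesis
    using taylor_coeff_eqI[of "\<lambda>_. 0" "\<lambda>_. 0"] by (simp add: slice_coeff_def)
qed

lemma norm_le_of_mem_cball: "w \<in> cball w0 (r - cmod w0) \<Longrightarrow> cmod w \<le> r"
  using norm_triangle_sub[of w w0] by (simp add: dist_norm norm_minus_commute)

text \<open>At z = z_n, subtracting the slices below i and dividing by z_n^i leaves the i-th slice
  plus an error of order z_n, locally uniformly in w. The functions \<open>h n\<close> are
  holomorphic by strong induction, hence so is their limit.\<close>

lemma slice_coeff_holomorphic:
  assumes f: "holomorphic_bidisc f"
  shows "slice_coeff f i holomorphic_on disc"
proof (induction i rule: less_induct)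
  case (less i)
  \<comment> \<open>The shift by 4 gives |z_n| \<le> 1/4. With r \<ge> 1/2 the ratio q = |z_n| / r
    is then at most 1/2, and the geometric tail q / (1 - q) at most 2 q.\<close>
  define zn where "zn n = (inverse (of_nat (n + 4)) :: complex)" for n :: nat
  define h where "h n w = (f (zn n, w) - (\<Sum>j<i. slice_coeff f j w * zn n ^ j)) / zn n ^ i" for n w
  have norm_zn: "cmod (zn n) = inverse (real (n + 4))" for n
  proof -
    have "zn n = of_real (inverse (real (n + 4)))" by (simp add: zn_def)
    then show ?thesis by (simp only: norm_of_real) simp
  qed
  have zn: "zn n \<noteq> 0" "cmod (zn n) \<le> 1/4" for n
  proof -
    show "cmod (zn n) \<le> 1/4" unfolding norm_zn by (simp add: field_simps)
    have "cmod (zn n) > 0" unfolding norm_zn by simp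
    then show "zn n \<noteq> 0" by simp
  qed
  have zd: "zn n \<in> disc" for n using zn(2)[of n] by simp
  show ?case
  proof (rule holomorphic_uniform_sequence[of disc h])
    show "h n holomorphic_on disc" for n
      unfolding h_def using zn zd
      by (auto intro!: holomorphic_intros holomorphic_bidisc_snd[OF f] less)
    fix w0 :: complex assume w0: "w0 \<in> disc"
    define r where "r = max (1/2) ((1 + cmod w0) / 2)"
    have r: "1/2 \<le> r" "r < 1" "cmod w0 < r" using w0 by (auto simp: r_def max_def)
    define d where "d = r - cmod w0"
    have d: "d > 0" "\<And>w. w \<in> cball w0 d \<Longrightarrow> cmod w \<le> r"
      using r norm_le_of_mem_cball[of _ w0 r] by (auto simp: d_def)
    obtain M where M: "M \<ge> 0" "\<And>z w. cmod z \<le> r \<Longrightarrow> cmod w \<le> r \<Longrightarrow> cmod (f (z, w)) \<le> M"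
      using holomorphic_bidisc_bounded[OF f r(2)] by metis
    have est: "cmod (h n w - slice_coeff f i w) \<le> M / r ^ i * (4 * cmod (zn n))"
      if w: "cmod w \<le> r" for n w
    proof -
      have wd: "w \<in> disc" using w r by simp
      define q where "q = cmod (zn n) / r"
      have q: "0 \<le> q" "q \<le> 1/2" "q \<le> 2 * cmod (zn n)"
      proof -
        show "0 \<le> q" using r by (simp add: q_def)
        have "q \<le> cmod (zn n) / (1/2)" unfolding q_def using r by (intro divide_left_mono) auto
        then show "q \<le> 2 * cmod (zn n)" by simp
        with zn(2)[of n] show "q \<le> 1/2" by simp
      qed
      have "(\<lambda>k. slice_coeff f (k + i) w * zn n ^ (k + i)) sums
          (f (zn n, w) - (\<Sum>j<i. slice_coeff f j w * zn n ^ j))"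
        using slice_coeff_sums[OF f zd wd] by (rule sums_split_initial_segment)
      from sums_divide[OF this, of "zn n ^ i"]
      have s: "(\<lambda>k. slice_coeff f (k + i) w * zn n ^ k) sums h n w"
        using zn(1)[of n] by (simp add: h_def power_add)
      have "(\<lambda>k. slice_coeff f (Suc k + i) w * zn n ^ Suc k) sums (h n w - slice_coeff f i w)"
        using sums_Suc_iff[of "\<lambda>k. slice_coeff f (k + i) w * zn n ^ k" "h n w - slice_coeff f i w"] s
        by simp
      moreover have "(\<lambda>k. M / r ^ i * (q * q ^ k)) sums (M / r ^ i * (q * (1 / (1 - q))))"
        using q by (intro sums_mult geometric_sums) simp
      moreover have "cmod (slice_coeff f (Suc k + i) w * zn n ^ Suc k) \<le> M / r ^ i * (q * q ^ k)" for k
      proof -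
        have "cmod (slice_coeff f (Suc k + i) w * zn n ^ Suc k) \<le> M / r ^ (Suc k + i) * cmod (zn n) ^ Suc k"
          unfolding norm_mult norm_power using r w M
          by (intro mult_right_mono slice_coeff_bound[OF f]) auto
        also have "\<dots> = M / r ^ i * (q * q ^ k)"
          using r by (simp add: q_def power_add power_divide)
        finally show ?thesis .
      qed
      ultimately have "cmod (h n w - slice_coeff f i w) \<le> M / r ^ i * (q * (1 / (1 - q)))"
        by (metis (no_types, lifting) norm_suminf_le sums_iff)
      also have "\<dots> \<le> M / r ^ i * (q * 2)"
        using M(1) r q by (intro mult_left_mono) (auto simp: field_simps)
      also have "\<dots> \<le> M / r ^ i * (4 * cmod (zn n))"
        using M(1) r q by (intro mult_left_mono) auto
      finally show ?thesis .
    qed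
    have "(\<lambda>n. inverse (real (n + 4))) \<longlonglongrightarrow> 0"
      by (rule LIMSEQ_ignore_initial_segment[OF lim_inverse_n])
    then have "(\<lambda>n. M / r ^ i * (4 * cmod (zn n))) \<longlonglongrightarrow> M / r ^ i * (4 * 0)"
      unfolding norm_zn by (intro tendsto_mult tendsto_const)
    then have lim: "(\<lambda>n. M / r ^ i * (4 * cmod (zn n))) \<longlonglongrightarrow> 0" by simp
    have "uniform_limit (cball w0 d) h (slice_coeff f i) sequentially"
    proof (rule uniform_limitI)
      fix e :: real assume "e > 0"
      from order_tendstoD(2)[OF lim this]
      show "\<forall>\<^sub>F n in sequentially. \<forall>w\<in>cball w0 d. dist (h n w) (slice_coeff f i w) < e"
        by eventually_elim (use est d in \<open>fastforce simp: dist_norm intro: le_less_trans\<close>)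
    qed
    moreover have "cball w0 d \<subseteq> disc" using d(2) r by force
    ultimately show "\<exists>d>0. cball w0 d \<subseteq> disc \<and> uniform_limit (cball w0 d) h (slice_coeff f i) sequentially"
      using d(1) by blast
  qed simp
qed

text \<open>Joint differentiability follows from differentiability in each variable because the partial
  derivative in \<open>z\<close> is again a locally uniformly convergent series, hence jointly continuous.\<close>

lemma holomorphic_bidisc_series:
  assumes hol: "\<And>i. g i holomorphic_on disc"
    and bound: "\<And>r. 0 < r \<Longrightarrow> r < 1 \<Longrightarrow> \<exists>C. \<forall>i w. cmod w \<le> r \<longrightarrow> cmod (g i w) \<le> C"
    and F: "\<And>z w. z \<in> disc \<Longrightarrow> w \<in> disc \<Longrightarrow> F (z, w) = (\<Sum>i. g i w * z ^ i)"
  shows "\<And>z w. z \<in> disc \<Longrightarrow> w \<in> disc \<Longrightarrow> (\<lambda>i. g i w * z ^ i) sums F (z, w)"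
    and "holomorphic_bidisc F"
    and "\<And>i w. w \<in> disc \<Longrightarrow> slice_coeff F i w = g i w"
proof -
  have summ: "summable (\<lambda>i. g i w * z ^ i)" if "z \<in> disc" "w \<in> disc" for z w
  proof -
    define r where "r = max (cmod w) (1/2)"
    have r: "0 < r" "r < 1" "cmod w \<le> r" using that by (auto simp: r_def max_def)
    obtain C where C: "\<And>i. cmod (g i w) \<le> C" using bound[OF r(1,2)] r(3) by blast
    show ?thesis
    proof (rule summable_norm_cancel, rule summable_comparison_test')
      show "summable (\<lambda>i. C * cmod z ^ i)" using that by (intro summable_mult summable_geometric) simp
      show "norm (cmod (g i w * z ^ i)) \<le> C * cmod z ^ i" for i
        using C[of i] by (simp add: norm_mult norm_power mult_right_mono)
    qed
  qed
  then show sums: "\<And>z w. z \<in> disc \<Longrightarrow> w \<in> disc \<Longrightarrow> (\<lambda>i. g i w * z ^ i) sums F (z, w)"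
    using F by (simp add: summable_sums)
  then show "\<And>i w. w \<in> disc \<Longrightarrow> slice_coeff F i w = g i w"
    unfolding slice_coeff_def by (rule taylor_coeff_eqI)
  \<comment> \<open>The partial derivative in z, with w as first argument: the criterion for joint
    differentiability used below takes the continuous partial in the second variable. The arguments
    are swapped back at the end.\<close>
  define D where "D = (\<lambda>(w, z). \<Sum>i. diffs (\<lambda>i. g i w) i * z ^ i)"
  have local: "\<exists>r. 0 < r \<and> r < 1 \<and> cmod z < r \<and> cmod w < r" if "z \<in> disc" "w \<in> disc" for z w :: complex
    using that dense[of "max (cmod z) (cmod w)" 1] by (auto intro: le_less_trans[OF norm_ge_zero])
  have contD: "isCont D (w, z)" if wz: "w \<in> disc" "z \<in> disc" for w z
  proof -
    obtain r where r: "0 < r" "r < 1" "cmod z < r" "cmod w < r" using local wz by blast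
    obtain C where C: "\<And>i w. cmod w \<le> r \<Longrightarrow> cmod (g i w) \<le> C" using bound[OF r(1,2)] by blast
    \<comment> \<open>The majorant is C times the derivative of the geometric series at r.\<close>
    have summ_r: "summable (\<lambda>i. C * (diffs (\<lambda>_. 1) i * r ^ i))"
    proof (intro summable_mult)
      have "summable (\<lambda>n. (1::real) * x ^ n)" if "norm x < 1" for x :: real
        using that by (simp add: summable_geometric)
      then show "summable (\<lambda>i. diffs (\<lambda>_. 1) i * r ^ i)"
        using termdiff_converges[of r 1 "\<lambda>_. 1"] r by simp
    qed
    have "continuous_on (ball 0 r \<times> ball 0 r) D"
      unfolding D_def case_prod_beta
    proof (rule uniform_limit_theorem[OF _ Weierstrass_m_test[OF _ summ_r]])
      have "continuous_on (ball 0 r) (g i)" for i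
        using hol[of i] r by (intro holomorphic_on_imp_continuous_on) (auto elim!: holomorphic_on_subset)
      then have "continuous_on (ball 0 r \<times> ball 0 r) (\<lambda>p. g i (fst p))" for i
        by (rule continuous_on_compose2) (auto intro!: continuous_intros)
      then show "\<forall>\<^sub>F n in sequentially. continuous_on (ball 0 r \<times> ball 0 r)
          (\<lambda>p. \<Sum>i<n. diffs (\<lambda>i. g i (fst p)) i * snd p ^ i)"
        unfolding diffs_def by (intro always_eventually allI continuous_intros)
      fix i and p :: "complex \<times> complex" assume p: "p \<in> ball 0 r \<times> ball 0 r"
      have "cmod (g (Suc i) (fst p)) * cmod (snd p) ^ i \<le> C * r ^ i"
        using p C[of "fst p" "Suc i"] r
        by (intro mult_mono power_mono) (auto simp: mem_Times_iff intro: order_trans[OF norm_ge_zero])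
      then have "real (Suc i) * (cmod (g (Suc i) (fst p)) * cmod (snd p) ^ i) \<le> real (Suc i) * (C * r ^ i)"
        by (rule mult_left_mono) simp
      moreover have "cmod (1 + complex_of_nat i) = 1 + real i"
        by (metis norm_of_nat of_nat_Suc)
      ultimately show "cmod (diffs (\<lambda>i. g i (fst p)) i * snd p ^ i) \<le> C * (diffs (\<lambda>_. 1) i * r ^ i)"
        unfolding diffs_def norm_mult norm_power
        by (simp add: mult_ac)
    qed simp
    then show ?thesis
      using r by (subst (asm) continuous_on_eq_continuous_at) (auto simp: open_Times)
  qed
  have dz: "((\<lambda>z. F (z, w)) has_field_derivative D (w, z)) (at z)" if "w \<in> disc" "z \<in> disc" for w z
  proof (rule has_field_derivative_transform_within_open[where S = disc])
    show "((\<lambda>z. \<Sum>i. g i w * z ^ i) has_field_derivative D (w, z)) (at z)"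
      unfolding D_def case_prod_conv using that summ
      by (intro termdiffs_strong'[of 1]) auto
  qed (use that F in auto)
  \<comment> \<open>In w only the existence of a derivative is asked for; locally uniform
    convergence of the partial sums provides it.\<close>
  have dw: "(\<lambda>w. F (z, w)) holomorphic_on disc" if z: "z \<in> disc" for z
  proof (rule holomorphic_uniform_sequence[of disc "\<lambda>n w. \<Sum>i<n. g i w * z ^ i"])
    show "(\<lambda>w. \<Sum>i<n. g i w * z ^ i) holomorphic_on disc" for n
      by (intro holomorphic_intros hol)
    fix w0 :: complex assume w0: "w0 \<in> disc"
    obtain r where r: "0 < r" "r < 1" "cmod w0 < r" using local[OF z w0] by blast
    obtain C where C: "\<And>i w. cmod w \<le> r \<Longrightarrow> cmod (g i w) \<le> C" using bound[OF r(1,2)] by blast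
    define d where "d = r - cmod w0"
    have d: "d > 0" "\<And>w. w \<in> cball w0 d \<Longrightarrow> cmod w \<le> r"
      using r norm_le_of_mem_cball[of _ w0 r] by (auto simp: d_def)
    have sz: "summable (\<lambda>i. C * cmod z ^ i)"
      using z by (intro summable_mult summable_geometric) simp
    have "uniform_limit (cball w0 d) (\<lambda>n w. \<Sum>i<n. g i w * z ^ i) (\<lambda>w. \<Sum>i. g i w * z ^ i) sequentially"
      by (rule Weierstrass_m_test[OF _ sz])
         (use C d(2) in \<open>auto simp: norm_mult norm_power intro!: mult_right_mono\<close>)
    moreover have sub: "cball w0 d \<subseteq> disc" using d(2) r by force
    moreover have "(\<Sum>i. g i w * z ^ i) = F (z, w)" if "w \<in> cball w0 d" for w
      using F[of z w] z that sub by auto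
    ultimately have "uniform_limit (cball w0 d) (\<lambda>n w. \<Sum>i<n. g i w * z ^ i) (\<lambda>w. F (z, w)) sequentially"
      by (subst (asm) uniform_limit_cong'[where f = "\<lambda>n w. \<Sum>i<n. g i w * z ^ i"]) auto
    then show "\<exists>d>0. cball w0 d \<subseteq> disc \<and>
        uniform_limit (cball w0 d) (\<lambda>n w. \<Sum>i<n. g i w * z ^ i) (\<lambda>w. F (z, w)) sequentially"
      using d(1) sub by blast
  qed simp
  show "holomorphic_bidisc F"
    unfolding holomorphic_bidisc_def
  proof (clarify)
    fix z w :: complex assume z: "z \<in> disc" and w: "w \<in> disc"
    obtain a where "((\<lambda>w. F (z, w)) has_field_derivative a) (at w)"
      using dw[OF z] w by (metis holomorphic_on_imp_differentiable_at open_ball field_differentiable_def)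
    then have fx: "((\<lambda>w. F (z, w)) has_derivative (*) a) (at w within disc)"
      unfolding has_field_derivative_def by (rule has_derivative_at_withinI)
    have "((\<lambda>(w, z). F (z, w)) has_derivative (\<lambda>(tx, ty). a * tx + blinfun_mult_right (D (w, z)) ty))
        (at (w, z) within disc \<times> disc)"
    proof (rule has_derivative_partialsI[where f = "\<lambda>w z. F (z, w)"
          and fy = "\<lambda>w z. blinfun_mult_right (D (w, z))", OF fx])
      show "((\<lambda>z. F (z, w')) has_derivative blinfun_apply (blinfun_mult_right (D (w', z'))))
          (at z' within disc)" if "w' \<in> disc" "z' \<in> disc" for w' z'
        using dz[OF that] by (auto simp: has_field_derivative_def intro: has_derivative_at_withinI)
      have "isCont (\<lambda>p. blinfun_mult_right (D p)) (w, z)"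
        by (intro bounded_linear.isCont[OF bounded_linear_blinfun_mult_right] contD w z)
      then show "continuous (at (w, z) within disc \<times> disc) (\<lambda>(x, y). blinfun_mult_right (D (x, y)))"
        unfolding case_prod_unfold prod.collapse by (rule continuous_at_imp_continuous_at_within)
    qed (use z in auto)
    then have "((\<lambda>(w, z). F (z, w)) has_derivative (\<lambda>(tx, ty). a * tx + D (w, z) * ty)) (at (w, z))"
      using z w by (subst (asm) at_within_open) (auto simp: open_Times)
    then have "((\<lambda>p. (\<lambda>(w, z). F (z, w)) (snd p, fst p)) has_derivative
        (\<lambda>q. (\<lambda>(tx, ty). a * tx + D (w, z) * ty) (snd q, fst q))) (at (z, w))"
      by (intro has_derivative_compose[where g = "\<lambda>(w, z). F (z, w)" and f = "\<lambda>p. (snd p, fst p)"])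
         (auto intro!: derivative_eq_intros)
    then have "(F has_derivative (\<lambda>(u, v). D (w, z) * u + a * v)) (at (z, w))"
      by (simp add: case_prod_unfold add.commute)
    then show "\<exists>a b. (F has_derivative (\<lambda>(u, v). a * u + b * v)) (at (z, w))" by blast
  qed
qed

section \<open>The Hardy space of the bidisc\<close>

text \<open>Fubini with the z-circle inside, so that the inner mean expands into slices at fixed
  w.\<close>

lemma torus_mean_iterated:
  assumes cont: "continuous_on ({0..2*pi} \<times> {0..2*pi})
      (\<lambda>p. F (of_real r * cis (fst p), of_real r * cis (snd p)))"
  shows "torus_mean r F = circle_mean r (\<lambda>w. circle_mean r (\<lambda>z. F (z, w)))"
proof -
  let ?S = "{0..2*pi}"
  let ?G = "\<lambda>t s. F (of_real r * cis t, of_real r * cis s)"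
  let ?f = "\<lambda>t s. indicator ?S s *\<^sub>R (indicator ?S t *\<^sub>R ?G t s)"
  have eq: "indicator (?S \<times> ?S) p *\<^sub>R ?G (fst p) (snd p) = (\<lambda>(t, s). ?f t s) p" for p
    by (simp add: indicator_times case_prod_unfold mult.commute)
  have "integrable lborel (\<lambda>p. indicator (?S \<times> ?S) p *\<^sub>R ?G (fst p) (snd p))"
    by (intro borel_integrable_compact compact_Times compact_Icc cont)
  then have int: "integrable (lborel \<Otimes>\<^sub>M lborel) (\<lambda>(t, s). ?f t s)"
    unfolding eq lborel_prod .
  have "(LINT p:?S \<times> ?S|lborel. ?G (fst p) (snd p)) = (\<integral>p. (\<lambda>(t, s). ?f t s) p \<partial>(lborel \<Otimes>\<^sub>M lborel))"
    unfolding set_lebesgue_integral_def eq lborel_prod ..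
  also have "\<dots> = (\<integral>s. (\<integral>t. ?f t s \<partial>lborel) \<partial>lborel)"
    using lborel_pair.integral_snd[OF int] by simp
  also have "\<dots> = (LINT s:?S|lborel. (LINT t:?S|lborel. ?G t s))"
    by (simp add: set_lebesgue_integral_def del: scaleR_scaleR)
  finally show ?thesis
    by (simp add: torus_mean_def circle_mean_def power2_eq_square)
qed

lemma coeff2_bound:
  assumes f: "holomorphic_bidisc f" and r: "0 < r" "r < 1"
    and M: "\<And>z w. cmod z \<le> r \<Longrightarrow> cmod w \<le> r \<Longrightarrow> cmod (f (z, w)) \<le> M"
  shows "cmod (coeff2 f (i, n)) \<le> M / r ^ i / r ^ n"
  unfolding coeff2_def case_prod_conv
  by (rule taylor_coeff_bound[OF slice_coeff_holomorphic[OF f] r], rule slice_coeff_bound[OF f r _ M]) auto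

lemma geometric_pair_summable:
  fixes q :: real
  assumes "0 \<le> q" "q < 1"
  shows "(\<lambda>(i, n). q ^ i * q ^ n) summable_on (UNIV :: (nat \<times> nat) set)"
proof -
  have g: "((\<lambda>n. q ^ n) has_sum (1 / (1 - q))) UNIV"
    using assms by (intro sums_nonneg_imp_has_sum geometric_sums) auto
  have "(\<lambda>(i, n). q ^ i * q ^ n) summable_on (Sigma (UNIV :: nat set) (\<lambda>_. UNIV :: nat set))"
  proof (rule summable_on_SigmaI)
    show "((\<lambda>n. (\<lambda>(i, n). q ^ i * q ^ n) (i, n)) has_sum (q ^ i * (1 / (1 - q)))) UNIV" for i :: nat
      unfolding case_prod_conv by (intro has_sum_cmult_right g)
    show "(\<lambda>i. q ^ i * (1 / (1 - q))) summable_on UNIV"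
      by (intro summable_on_cmult_left has_sum_imp_summable[OF g])
  qed (use assms in auto)
  then show ?thesis by simp
qed

text \<open>Cauchy estimates at the radius s halfway between r and 1 bound the terms by M K q^i q^n
  with q = (r / s)^2 < 1.\<close>

lemma coeff2_product_summable:
  assumes f: "holomorphic_bidisc f" and g: "holomorphic_bidisc g" and r: "r \<in> {0..<1}"
  shows "(\<lambda>p. cmod (coeff2 f p * cnj (coeff2 g p) * of_real (r ^ (2 * (fst p + snd p))))) summable_on UNIV"
proof -
  define s where "s = (r + 1) / 2"
  have s: "0 < s" "s < 1" "r < s" "0 \<le> r" using r by (auto simp: s_def)
  obtain M where M: "M \<ge> 0" "\<And>z w. cmod z \<le> s \<Longrightarrow> cmod w \<le> s \<Longrightarrow> cmod (f (z, w)) \<le> M"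
    using holomorphic_bidisc_bounded[OF f s(2)] by metis
  obtain K where K: "K \<ge> 0" "\<And>z w. cmod z \<le> s \<Longrightarrow> cmod w \<le> s \<Longrightarrow> cmod (g (z, w)) \<le> K"
    using holomorphic_bidisc_bounded[OF g s(2)] by metis
  define q where "q = (r / s)\<^sup>2"
  have q: "0 \<le> q" "q < 1" using s by (auto simp: q_def power_less_one_iff)
  show ?thesis
  proof (rule Infinite_Sum.abs_summable_on_comparison_test')
    show "(\<lambda>p. M * K * (\<lambda>(i, n). q ^ i * q ^ n) p) summable_on (UNIV :: (nat \<times> nat) set)"
      by (intro summable_on_cmult_right geometric_pair_summable q)
    fix p :: "nat \<times> nat"
    obtain i n where p: "p = (i, n)" by fastforce
    have "cmod (coeff2 f p * cnj (coeff2 g p) * of_real (r ^ (2 * (fst p + snd p)))) =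
        cmod (coeff2 f (i, n)) * cmod (coeff2 g (i, n)) * r ^ (2 * (i + n))"
      using s by (simp add: p norm_mult norm_power)
    also have "\<dots> \<le> (M / s ^ i / s ^ n) * (K / s ^ i / s ^ n) * r ^ (2 * (i + n))"
      using s M K by (intro mult_right_mono mult_mono coeff2_bound[OF f] coeff2_bound[OF g]) auto
    also have "\<dots> = M * K * (q ^ i * q ^ n)"
      by (simp add: q_def power_divide power_add power_mult power2_eq_square power_mult_distrib)
    finally show "cmod (coeff2 f p * cnj (coeff2 g p) * of_real (r ^ (2 * (fst p + snd p))))
        \<le> M * K * (\<lambda>(i, n). q ^ i * q ^ n) p" by (simp add: p)
  qed
qed

text \<open>Parseval twice: in z at fixed w, giving a series of products of slices, then in w for
  each slice. The Cauchy bound M K q^i allows integrating that series term by term.\<close>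

lemma torus_mean_mult_cnj:
  assumes f: "holomorphic_bidisc f" and g: "holomorphic_bidisc g" and r: "r \<in> {0..<1}"
  shows "torus_mean r (\<lambda>p. f p * cnj (g p)) =
    (\<Sum>\<^sub>\<infinity>p. coeff2 f p * cnj (coeff2 g p) * of_real (r ^ (2 * (fst p + snd p))))"
proof -
  have r0: "0 \<le> r" "r < 1" using r by auto
  let ?c = "\<lambda>t. of_real r * cis t :: complex"
  have in_disc: "?c t \<in> disc" for t using r0 by (simp add: norm_mult)
  define s where "s = (r + 1) / 2"
  have s: "0 < s" "s < 1" "r < s" "0 \<le> r" using r by (auto simp: s_def)
  obtain M where M: "M \<ge> 0" "\<And>z w. cmod z \<le> s \<Longrightarrow> cmod w \<le> s \<Longrightarrow> cmod (f (z, w)) \<le> M"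
    using holomorphic_bidisc_bounded[OF f s(2)] by metis
  obtain K where K: "K \<ge> 0" "\<And>z w. cmod z \<le> s \<Longrightarrow> cmod w \<le> s \<Longrightarrow> cmod (g (z, w)) \<le> K"
    using holomorphic_bidisc_bounded[OF g s(2)] by metis
  define q where "q = (r / s)\<^sup>2"
  have q: "0 \<le> q" "q < 1" using s by (auto simp: q_def power_less_one_iff)
  let ?a = "slice_coeff f" and ?b = "slice_coeff g"
  have cont: "continuous_on A (\<lambda>p. h (?c (fst p), ?c (snd p)))" if "holomorphic_bidisc h" for h A
    by (rule continuous_on_compose2[OF holomorphic_bidisc_continuous[OF that]])
       (use in_disc in \<open>auto intro!: continuous_intros\<close>)
  have cont_slice: "continuous_on A (\<lambda>t. slice_coeff h i (?c t))" if "holomorphic_bidisc h" for A h i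
    by (rule continuous_on_compose2[OF holomorphic_on_imp_continuous_on[OF slice_coeff_holomorphic[OF that]]])
       (use in_disc in \<open>auto intro!: continuous_intros\<close>)
  have bound: "cmod (?a i (?c t) * cnj (?b i (?c t)) * of_real (r ^ (2 * i))) \<le> M * K * q ^ i" for i t
  proof -
    have "cmod (?a i (?c t) * cnj (?b i (?c t)) * of_real (r ^ (2 * i))) =
        cmod (?a i (?c t)) * cmod (?b i (?c t)) * r ^ (2 * i)"
      using s by (simp add: norm_mult norm_power)
    also have "\<dots> \<le> (M / s ^ i) * (K / s ^ i) * r ^ (2 * i)"
      using s M K by (intro mult_right_mono mult_mono slice_coeff_bound[OF f] slice_coeff_bound[OF g])
        (auto simp: norm_mult)
    also have "\<dots> = M * K * q ^ i"
      by (simp add: q_def power_divide power_mult power2_eq_square power_mult_distrib)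
    finally show ?thesis .
  qed
  have sum_q: "summable (\<lambda>i. M * K * q ^ i)" using q by (intro summable_mult summable_geometric) simp
  have inner: "circle_mean r (\<lambda>z. f (z, w) * cnj (g (z, w))) =
      (\<Sum>i. ?a i w * cnj (?b i w) * of_real (r ^ (2 * i)))" if w: "w \<in> disc" for w
  proof -
    note h = holomorphic_bidisc_fst[OF f w] holomorphic_bidisc_fst[OF g w]
    show ?thesis
      unfolding circle_mean_mult_cnj(1)[OF h r] slice_coeff_def
      by (rule sums_unique[OF has_sum_imp_sums[OF has_sum_infsum[OF
            abs_summable_summable[OF circle_mean_mult_cnj(2)[OF h r]]]]])
  qed
  have "torus_mean r (\<lambda>p. f p * cnj (g p)) = circle_mean r (\<lambda>w. circle_mean r (\<lambda>z. f (z, w) * cnj (g (z, w))))"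
    by (rule torus_mean_iterated) (intro continuous_intros cont f g)
  also have "\<dots> = (LINT t:{0..2*pi}|lborel. \<Sum>i. ?a i (?c t) * cnj (?b i (?c t)) * of_real (r ^ (2 * i))) / (2 * pi)"
    unfolding circle_mean_def[of r "\<lambda>w. circle_mean r (\<lambda>z. f (z, w) * cnj (g (z, w)))"]
    by (simp only: inner[OF in_disc])
  finally have tm: "torus_mean r (\<lambda>p. f p * cnj (g p)) =
    (LINT t:{0..2*pi}|lborel. \<Sum>i. ?a i (?c t) * cnj (?b i (?c t)) * of_real (r ^ (2 * i))) / (2 * pi)" .
  have "(\<lambda>i. LINT t:{0..2*pi}|lborel. ?a i (?c t) * cnj (?b i (?c t)) * of_real (r ^ (2 * i))) sums
      (LINT t:{0..2*pi}|lborel. \<Sum>i. ?a i (?c t) * cnj (?b i (?c t)) * of_real (r ^ (2 * i)))"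
    by (rule series_set_integral[OF _ _ bound sum_q]) (auto intro!: continuous_intros cont_slice f g)
  from sums_divide[OF this, of "2 * pi"]
  have sums1: "(\<lambda>i. circle_mean r (\<lambda>w. ?a i w * cnj (?b i w)) * of_real (r ^ (2 * i))) sums
      torus_mean r (\<lambda>p. f p * cnj (g p))"
    unfolding tm by (simp add: circle_mean_def)
  let ?d = "\<lambda>p. coeff2 f p * cnj (coeff2 g p) * of_real (r ^ (2 * (fst p + snd p)))"
  have sd: "?d summable_on Sigma UNIV (\<lambda>_. UNIV)"
    using abs_summable_summable[OF coeff2_product_summable[OF f g r]] by simp
  have "(\<lambda>i. circle_mean r (\<lambda>w. ?a i w * cnj (?b i w)) * of_real (r ^ (2 * i))) = (\<lambda>i. \<Sum>\<^sub>\<infinity>n. ?d (i, n))"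
  proof
    fix i
    note h = slice_coeff_holomorphic[OF f, of i] slice_coeff_holomorphic[OF g, of i]
    show "circle_mean r (\<lambda>w. ?a i w * cnj (?b i w)) * of_real (r ^ (2 * i)) = (\<Sum>\<^sub>\<infinity>n. ?d (i, n))"
      unfolding circle_mean_mult_cnj(1)[OF h r] infsum_cmult_left'[symmetric]
      by (simp add: coeff2_def power_add distrib_left mult_ac)
  qed
  with sums1 have "(\<lambda>i. \<Sum>\<^sub>\<infinity>n. ?d (i, n)) sums torus_mean r (\<lambda>p. f p * cnj (g p))" by simp
  \<comment> \<open>The same series summed a second time: absolute summability identifies the
    iterated sum with the sum over pairs.\<close>
  moreover have "(\<lambda>i. \<Sum>\<^sub>\<infinity>n. ?d (i, n)) sums (\<Sum>\<^sub>\<infinity>i. \<Sum>\<^sub>\<infinity>n. ?d (i, n))"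
    using summable_on_SigmaD[OF sd summable_on_SigmaD1[of "\<lambda>i n. ?d (i, n)" UNIV "\<lambda>_. UNIV"]] sd
    by (intro has_sum_imp_sums has_sum_infsum) (simp add: case_prod_unfold)
  ultimately show ?thesis
    using sums_unique2 infsum_Sigma_banach[OF sd] by fastforce
qed

definition hardy2_ip :: "(complex \<times> complex \<Rightarrow> complex) \<Rightarrow> (complex \<times> complex \<Rightarrow> complex) \<Rightarrow> complex" where
  "hardy2_ip f g = Lim (at_left 1) (\<lambda>r. torus_mean r (\<lambda>p. f p * cnj (g p)))"

lemma hardy2_fun_space: "hardy2 = fun_space (hcarrier hardy2) hardy2_ip"
  by (simp add: hardy2_def hardy2_ip_def[abs_def])

lemma hinner_hardy2: "hinner hardy2 = hardy2_ip"
  by (subst hardy2_fun_space) simp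

lemma hardy2_simps [simp]:
  "hzero hardy2 = (\<lambda>x. 0)"
  "hadd hardy2 = (\<lambda>f g x. f x + g x)" "hscale hardy2 = (\<lambda>c f x. c * f x)"
  "hdiff hardy2 = (\<lambda>f g x. f x - g x)"
  by (simp_all add: hardy2_def)

lemma hardy2_carrier_iff:
  "f \<in> hcarrier hardy2 \<longleftrightarrow> holomorphic_bidisc f \<and> (\<forall>p. p \<notin> disc \<times> disc \<longrightarrow> f p = 0) \<and>
    square_summable (coeff2 f)"
proof -
  have "(\<exists>C. \<forall>r\<in>{0..<1}. Re (torus_mean r (\<lambda>p. of_real ((cmod (f p))\<^sup>2))) \<le> C) \<longleftrightarrow>
      square_summable (coeff2 f)" if f: "holomorphic_bidisc f"
  proof (rule square_summable_iff_abel[where d = "\<lambda>p. fst p + snd p"])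
    fix r :: real assume r: "r \<in> {0..<1}"
    have eq: "coeff2 f p * cnj (coeff2 f p) * of_real (r ^ (2 * (fst p + snd p))) =
        of_real ((cmod (coeff2 f p))\<^sup>2 * r ^ (2 * (fst p + snd p)))" for p
      by (simp add: cmod_sq)
    show s: "(\<lambda>p. (cmod (coeff2 f p))\<^sup>2 * r ^ (2 * (fst p + snd p))) summable_on UNIV"
      using coeff2_product_summable[OF f f r] r unfolding eq norm_of_real by simp
    show "Re (torus_mean r (\<lambda>p. of_real ((cmod (f p))\<^sup>2))) =
        (\<Sum>\<^sub>\<infinity>p. (cmod (coeff2 f p))\<^sup>2 * r ^ (2 * (fst p + snd p)))"
    proof -
      have "(\<Sum>\<^sub>\<infinity>p. complex_of_real ((cmod (coeff2 f p))\<^sup>2 * r ^ (2 * (fst p + snd p)))) =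
          of_real (\<Sum>\<^sub>\<infinity>p. (cmod (coeff2 f p))\<^sup>2 * r ^ (2 * (fst p + snd p)))"
        by (intro infsumI has_sum_of_real has_sum_infsum s)
      then show ?thesis
        using torus_mean_mult_cnj[OF f f r] unfolding eq cmod_sq by simp
    qed
  qed
  then show ?thesis by (auto simp: hardy2_def)
qed

lemma hardy2_ip_coeff:
  assumes f: "f \<in> hcarrier hardy2" and g: "g \<in> hcarrier hardy2"
  shows "hardy2_ip f g = (\<Sum>\<^sub>\<infinity>p. coeff2 f p * cnj (coeff2 g p))"
  unfolding hardy2_ip_def
  using Lim_abel(2)[OF square_summable_mult torus_mean_mult_cnj] f g
  unfolding hardy2_carrier_iff by blast

section \<open>Algebraic operations on the bidisc and their effect on coefficients\<close>

lemma holomorphic_bidisc_add: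
  assumes "holomorphic_bidisc f" "holomorphic_bidisc g"
  shows "holomorphic_bidisc (\<lambda>p. f p + g p)"
  unfolding holomorphic_bidisc_def
proof
  fix p :: "complex \<times> complex" assume "p \<in> disc \<times> disc"
  then obtain a b c d where "(f has_derivative (\<lambda>(u, v). a * u + b * v)) (at p)"
    "(g has_derivative (\<lambda>(u, v). c * u + d * v)) (at p)"
    using assms unfolding holomorphic_bidisc_def by blast
  from has_derivative_add[OF this]
  have "((\<lambda>p. f p + g p) has_derivative (\<lambda>(u, v). (a + c) * u + (b + d) * v)) (at p)"
    by (simp add: case_prod_unfold algebra_simps)
  then show "\<exists>a b. ((\<lambda>p. f p + g p) has_derivative (\<lambda>(u, v). a * u + b * v)) (at p)" by blast
qed

lemma holomorphic_bidisc_mult: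
  assumes "holomorphic_bidisc f" "holomorphic_bidisc g"
  shows "holomorphic_bidisc (\<lambda>p. f p * g p)"
  unfolding holomorphic_bidisc_def
proof
  fix p :: "complex \<times> complex" assume "p \<in> disc \<times> disc"
  then obtain a b c d where "(f has_derivative (\<lambda>(u, v). a * u + b * v)) (at p)"
    "(g has_derivative (\<lambda>(u, v). c * u + d * v)) (at p)"
    using assms unfolding holomorphic_bidisc_def by blast
  from has_derivative_mult[OF this]
  have "((\<lambda>p. f p * g p) has_derivative (\<lambda>(u, v). (f p * c + a * g p) * u + (f p * d + b * g p) * v)) (at p)"
    by (simp add: case_prod_unfold algebra_simps)
  then show "\<exists>a b. ((\<lambda>p. f p * g p) has_derivative (\<lambda>(u, v). a * u + b * v)) (at p)" by blast
qed

lemma holomorphic_bidisc_of_snd: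
  assumes g: "g holomorphic_on disc"
  shows "holomorphic_bidisc (\<lambda>(z, w). g w)"
  unfolding holomorphic_bidisc_def
proof
  fix p :: "complex \<times> complex" assume p: "p \<in> disc \<times> disc"
  then obtain b where "(g has_field_derivative b) (at (snd p))"
    using g by (metis holomorphic_on_imp_differentiable_at open_ball field_differentiable_def mem_Times_iff)
  then have "((\<lambda>q. g (snd q)) has_derivative (\<lambda>q. b * snd q)) (at p)"
    unfolding has_field_derivative_def
    by (rule has_derivative_compose[rotated]) (auto intro!: derivative_eq_intros)
  then have "((\<lambda>(z, w). g w) has_derivative (\<lambda>(u, v). 0 * u + b * v)) (at p)"
    by (simp add: case_prod_unfold)
  then show "\<exists>a b. ((\<lambda>(z, w). g w) has_derivative (\<lambda>(u, v). a * u + b * v)) (at p)" by blast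
qed

lemma holomorphic_bidisc_fst_coordinate: "holomorphic_bidisc (\<lambda>(z, w). z)"
  unfolding holomorphic_bidisc_def
proof
  fix p :: "complex \<times> complex"
  have "((\<lambda>(z, w). z) has_derivative (\<lambda>(u, v). 1 * u + 0 * v)) (at p)"
    by (auto intro!: derivative_eq_intros simp: case_prod_unfold)
  then show "\<exists>a b. ((\<lambda>(z, w). z) has_derivative (\<lambda>(u, v). a * u + b * v)) (at p)" by blast
qed

lemma slice_coeff_add:
  assumes f: "holomorphic_bidisc f" and g: "holomorphic_bidisc g" and w: "w \<in> disc"
  shows "slice_coeff (\<lambda>p. f p + g p) i w = slice_coeff f i w + slice_coeff g i w"
  unfolding slice_coeff_def using assms by (intro taylor_coeff_add holomorphic_bidisc_fst)

lemma slice_coeff_mult_snd: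
  assumes f: "holomorphic_bidisc f" and w: "w \<in> disc"
  shows "slice_coeff (\<lambda>(z, w). g w * f (z, w)) i w = g w * slice_coeff f i w"
  using taylor_coeff_scale[OF holomorphic_bidisc_fst[OF f w]] by (simp add: slice_coeff_def)

lemma slice_coeff_mult_fst:
  assumes f: "holomorphic_bidisc f" and w: "w \<in> disc"
  shows "slice_coeff (\<lambda>(z, w). z * f (z, w)) i w = (case i of 0 \<Rightarrow> 0 | Suc k \<Rightarrow> slice_coeff f k w)"
  using taylor_coeff_shift[OF holomorphic_bidisc_fst[OF f w]]
  by (simp add: slice_coeff_def split: nat.split)

lemma coeff2_add:
  assumes f: "holomorphic_bidisc f" and g: "holomorphic_bidisc g"
  shows "coeff2 (\<lambda>p. f p + g p) = (\<lambda>p. coeff2 f p + coeff2 g p)"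
proof
  fix p :: "nat \<times> nat"
  show "coeff2 (\<lambda>p. f p + g p) p = coeff2 f p + coeff2 g p"
    unfolding coeff2_def case_prod_unfold taylor_coeff_add[OF slice_coeff_holomorphic[OF f]
      slice_coeff_holomorphic[OF g], symmetric]
    by (intro taylor_coeff_cong slice_coeff_add f g holomorphic_on_add slice_coeff_holomorphic)
qed

lemma coeff2_scale:
  assumes f: "holomorphic_bidisc f"
  shows "coeff2 (\<lambda>p. k * f p) = (\<lambda>p. k * coeff2 f p)"
proof
  fix p :: "nat \<times> nat"
  have "slice_coeff (\<lambda>p. k * f p) i w = k * slice_coeff f i w" if "w \<in> disc" for i w
    using taylor_coeff_scale[OF holomorphic_bidisc_fst[OF f that]] by (simp add: slice_coeff_def)
  then show "coeff2 (\<lambda>p. k * f p) p = k * coeff2 f p"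
    unfolding coeff2_def case_prod_unfold taylor_coeff_scale[OF slice_coeff_holomorphic[OF f], symmetric]
    by (intro taylor_coeff_cong holomorphic_on_mult holomorphic_on_const slice_coeff_holomorphic f)
qed

lemma holomorphic_bidisc_const: "holomorphic_bidisc (\<lambda>p. k)"
  using holomorphic_bidisc_of_snd[of "\<lambda>_. k"] by (simp add: case_prod_unfold)

interpretation Hc2: coefficient_space "hcarrier hardy2" hardy2_ip coeff2
proof
  have "coeff2 (\<lambda>x. 0) = (\<lambda>p. 0 * coeff2 (\<lambda>x. 0) p)"
    using coeff2_scale[OF holomorphic_bidisc_const[of 0], of 0] by simp
  then have "square_summable (coeff2 (\<lambda>x. 0))" by (simp add: square_summable_def)
  then show "(\<lambda>x. 0) \<in> hcarrier hardy2"
    by (simp add: hardy2_carrier_iff holomorphic_bidisc_const)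
  show "(\<lambda>x. f x + g x) \<in> hcarrier hardy2" if "f \<in> hcarrier hardy2" "g \<in> hcarrier hardy2" for f g
    using that square_summable_add[of "coeff2 f" "coeff2 g"]
    by (auto simp: hardy2_carrier_iff coeff2_add intro!: holomorphic_bidisc_add)
  show "(\<lambda>x. k * f x) \<in> hcarrier hardy2" if "f \<in> hcarrier hardy2" for f k
    using that square_summable_scale[of "coeff2 f" k]
    by (auto simp: hardy2_carrier_iff coeff2_scale intro!: holomorphic_bidisc_mult holomorphic_bidisc_const)
  show "f = (\<lambda>x. 0)" if f: "f \<in> hcarrier hardy2" and c: "\<And>p. coeff2 f p = 0" for f
  proof
    fix p
    have h: "holomorphic_bidisc f" using f by (simp add: hardy2_carrier_iff)
    show "f p = 0"
    proof (cases "p \<in> disc \<times> disc")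
      case True
      then obtain z w where p: "p = (z, w)" "z \<in> disc" "w \<in> disc" by auto
      have "slice_coeff f i w = 0" for i
        using c[of "(i, _)"] p by (intro taylor_coeff_eq_0[OF slice_coeff_holomorphic[OF h]])
          (auto simp: coeff2_def)
      then show ?thesis
        using slice_coeff_sums[OF h p(2,3)] sums_unique2[OF _ sums_zero] p(1) by simp
    qed (use f hardy2_carrier_iff in blast)
  qed
qed (auto simp: hardy2_carrier_iff coeff2_add coeff2_scale hardy2_ip_coeff)

lemma hardy2_holomorphic: "f \<in> hcarrier hardy2 \<Longrightarrow> holomorphic_bidisc f"
  by (simp add: hardy2_carrier_iff)

lemma hardy2_zero_off: "f \<in> hcarrier hardy2 \<Longrightarrow> p \<notin> disc \<times> disc \<Longrightarrow> f p = 0"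
  unfolding hardy2_carrier_iff by blast

section \<open>Slicing and reassembling functions of the bidisc Hardy space\<close>

lemma slice_coeff_hardy:
  assumes f: "f \<in> hcarrier hardy2"
  shows "slice_coeff f i \<in> hcarrier hardy"
proof -
  have s: "(\<lambda>p. (cmod (coeff2 f p))\<^sup>2) summable_on Sigma UNIV (\<lambda>_. UNIV)"
    using Hc2.c_square_summable[OF f] by (simp add: square_summable_def)
  have "(\<lambda>n. (cmod (coeff2 f (i, n)))\<^sup>2) summable_on UNIV"
    using summable_on_SigmaD1[of "\<lambda>i n. (cmod (coeff2 f (i, n)))\<^sup>2" UNIV "\<lambda>_. UNIV" i] s
    by (simp add: case_prod_unfold)
  then show ?thesis
    using slice_coeff_holomorphic[OF hardy2_holomorphic[OF f]] slice_coeff_zero_off[OF hardy2_zero_off[OF f]]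
    by (auto simp: hardy_carrier_iff square_summable_def coeff2_def)
qed

lemma hardy2_ip_slices:
  assumes f: "f \<in> hcarrier hardy2" and g: "g \<in> hcarrier hardy2"
  shows "((\<lambda>i. hardy_ip (slice_coeff f i) (slice_coeff g i)) has_sum hardy2_ip f g) UNIV"
proof (rule has_sum_SigmaD)
  show "((\<lambda>p. coeff2 f p * cnj (coeff2 g p)) has_sum hardy2_ip f g) (Sigma UNIV (\<lambda>_. UNIV))"
    unfolding hardy2_ip_coeff[OF f g] using Hc2.summable_product[OF f g] by simp
  show "((\<lambda>n. coeff2 f (i, n) * cnj (coeff2 g (i, n))) has_sum
      hardy_ip (slice_coeff f i) (slice_coeff g i)) UNIV" for i
    using Hc.summable_product[OF slice_coeff_hardy[OF f] slice_coeff_hardy[OF g], of i i]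
    by (simp add: hardy_ip_coeff slice_coeff_hardy f g coeff2_def)
qed

text \<open>The norms of the \<open>g i\<close> are bounded by B, so point evaluation bounds the
  functions uniformly on each disc |w| \<le> r, as \<open>holomorphic_bidisc_series\<close>
  requires. Monomials, multiples by z and the functions \<open>E_fun\<close> enter
  \<open>hardy2\<close> this way.\<close>

lemma hardy2_from_slices:
  assumes g: "\<And>i. g i \<in> hcarrier hardy" and s: "(\<lambda>i. (hnorm hardy (g i))\<^sup>2) summable_on UNIV"
  obtains F where "F \<in> hcarrier hardy2" "\<And>i. slice_coeff F i = g i"
    "\<And>z w. z \<in> disc \<Longrightarrow> w \<in> disc \<Longrightarrow> (\<lambda>i. g i w * z ^ i) sums F (z, w)"
proof -
  define F where "F = zero_off (disc \<times> disc) (\<lambda>(z, w). \<Sum>i. g i w * z ^ i)"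
  define B where "B = sqrt (\<Sum>\<^sub>\<infinity>i. (hnorm hardy (g i))\<^sup>2)"
  have B: "hnorm hardy (g i) \<le> B" for i
    unfolding B_def using finite_sum_le_infsum[OF s, of "{i}"] by (intro real_le_rsqrt) simp
  have bound: "\<exists>C. \<forall>i w. cmod w \<le> r \<longrightarrow> cmod (g i w) \<le> C" if r: "0 < r" "r < 1" for r
  proof -
    have "cmod (g i w) \<le> B / sqrt (1 - r\<^sup>2)" if "cmod w \<le> r" for i w
    proof -
      have "cmod (g i w) \<le> hnorm hardy (g i) / sqrt (1 - r\<^sup>2)"
        by (rule hardy_pointwise_bound) (use g r that in auto)
      also have "\<dots> \<le> B / sqrt (1 - r\<^sup>2)"
        using B r by (intro divide_right_mono) (auto simp: abs_square_le_1)
      finally show ?thesis .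
    qed
    then show ?thesis by blast
  qed
  have Feq: "F (z, w) = (\<Sum>i. g i w * z ^ i)" if "z \<in> disc" "w \<in> disc" for z w
    using that by (simp add: F_def zero_off_def)
  note ser = holomorphic_bidisc_series[of g F, OF hardy_holomorphic[OF g] bound Feq]
  have zero: "F p = 0" if "p \<notin> disc \<times> disc" for p using that by (simp add: F_def zero_off_def)
  have slice: "slice_coeff F i = g i" for i
  proof
    fix w show "slice_coeff F i w = g i w"
      using ser(3)[of w i] slice_coeff_zero_off[of F w i, OF zero] hardy_zero_off[OF g, of w i]
      by (cases "w \<in> disc") auto
  qed
  have "(\<lambda>p. (cmod (coeff2 F p))\<^sup>2) summable_on Sigma UNIV (\<lambda>_. UNIV)"
  proof (rule summable_on_SigmaI)
    show "((\<lambda>n. (cmod (coeff2 F (i, n)))\<^sup>2) has_sum (hnorm hardy (g i))\<^sup>2) UNIV" for i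
      using Hc.norm_sq_coef[OF g, of i] Hc.c_square_summable[OF g, of i]
      unfolding hardy_fun_space[symmetric]
      by (simp add: coeff2_def slice square_summable_def)
  qed (use s in auto)
  then have "F \<in> hcarrier hardy2"
    using ser(2) zero by (simp add: hardy2_carrier_iff square_summable_def)
  with slice ser(1) that show thesis by blast
qed

lemma hardy2_hilbert: "complex_hilbert_space hardy2"
proof (subst hardy2_fun_space, rule Hc2.hilbert)
  fix a :: "nat \<times> nat \<Rightarrow> complex" assume "square_summable a"
  then have s: "(\<lambda>p. (cmod (a p))\<^sup>2) summable_on Sigma UNIV (\<lambda>_. UNIV)"
    by (simp add: square_summable_def)
  have si: "(\<lambda>n. (cmod (a (i, n)))\<^sup>2) summable_on UNIV" for i
    using summable_on_SigmaD1[of "\<lambda>i n. (cmod (a (i, n)))\<^sup>2" UNIV "\<lambda>_. UNIV" i] s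
    by (simp add: case_prod_unfold)
  then have "\<exists>f. f \<in> hcarrier hardy \<and> (\<forall>n. taylor_coeff f n = a (i, n))" for i
    using hardy_from_coeff[of "\<lambda>n. a (i, n)"] by (metis square_summable_def)
  then obtain g where g: "\<And>i. g i \<in> hcarrier hardy" "\<And>i n. taylor_coeff (g i) n = a (i, n)" by metis
  have "(\<lambda>i. (hnorm hardy (g i))\<^sup>2) summable_on UNIV"
    using summable_on_SigmaD[OF s si] Hc.norm_sq_coef[OF g(1)]
    unfolding hardy_fun_space[symmetric] by (simp add: g(2))
  from hardy2_from_slices[OF g(1) this] obtain F where
    "F \<in> hcarrier hardy2" "\<And>i. slice_coeff F i = g i" by metis
  then show "\<exists>f\<in>hcarrier hardy2. \<forall>p. coeff2 f p = a p"
    by (intro bexI[of _ F]) (auto simp: coeff2_def g(2))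
qed

interpretation hardy2: pre_hilbert_space hardy2
  by (subst hardy2_fun_space, rule Hc2.pre_hilbert)

lemma hardy2_bounded_subset: "hardy2_bounded \<subseteq> hcarrier hardy2"
proof
  fix f assume f: "f \<in> hardy2_bounded"
  then obtain K where K: "\<And>p. cmod (f p) \<le> K"
    by (auto simp: hardy2_bounded_def bounded_iff)
  have h: "holomorphic_bidisc f" using f by (simp add: hardy2_bounded_def)
  have "Re (torus_mean r (\<lambda>p. of_real ((cmod (f p))\<^sup>2))) \<le> K\<^sup>2" if r: "r \<in> {0..<1}" for r
  proof -
    let ?S = "{0..2*pi} \<times> {0..2*pi}"
    let ?c = "\<lambda>t. of_real r * cis t :: complex"
    let ?u = "\<lambda>p. (cmod (f (?c (fst p), ?c (snd p))))\<^sup>2"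
    have in_disc: "?c t \<in> disc" for t using r by (simp add: norm_mult)
    have "continuous_on ?S (\<lambda>p. f (?c (fst p), ?c (snd p)))"
      by (rule continuous_on_compose2[OF holomorphic_bidisc_continuous[OF h]])
         (use in_disc in \<open>auto intro!: continuous_intros\<close>)
    then have "integrable lborel (\<lambda>p. indicator ?S p *\<^sub>R ?u p)"
      by (intro borel_integrable_compact compact_Times compact_Icc continuous_intros)
    moreover have "integrable lborel (\<lambda>p. indicator ?S p *\<^sub>R K\<^sup>2)"
      by (intro borel_integrable_compact compact_Times compact_Icc continuous_intros)
    ultimately have "(\<integral>p. indicator ?S p *\<^sub>R ?u p \<partial>lborel) \<le> (\<integral>p. indicator ?S p *\<^sub>R K\<^sup>2 \<partial>lborel)"
      using K by (intro integral_mono) (auto simp: indicator_def power_mono)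
    also have "\<dots> = (2 * pi)\<^sup>2 * K\<^sup>2"
    proof -
      have "measure lborel ?S = (2 * pi)\<^sup>2"
        by (simp add: measure_def lborel.emeasure_pair_measure_Times power2_eq_square
            flip: lborel_prod ennreal_mult)
      then show ?thesis by (simp add: measure_def)
    qed
    finally have le: "(LINT p:?S|lborel. ?u p) \<le> (2 * pi)\<^sup>2 * K\<^sup>2"
      by (simp add: set_lebesgue_integral_def)
    have tm: "torus_mean r (\<lambda>p. of_real ((cmod (f p))\<^sup>2)) = of_real ((LINT p:?S|lborel. ?u p) / (2 * pi)\<^sup>2)"
      unfolding torus_mean_def set_lebesgue_integral_def
      by (simp add: scaleR_conv_of_real flip: of_real_power of_real_mult)
    show ?thesis
      unfolding tm Re_complex_of_real using le by (subst pos_divide_le_eq) (simp_all add: mult.commute)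
  qed
  then have "\<exists>C. \<forall>r\<in>{0..<1}. Re (torus_mean r (\<lambda>p. of_real ((cmod (f p))\<^sup>2))) \<le> C" by blast
  then show "f \<in> hcarrier hardy2"
    using f unfolding hardy2_def hardy2_bounded_def by simp
qed

section \<open>The Bergman space\<close>

lemma has_sum_sum:
  fixes f :: "'k \<Rightarrow> 'i \<Rightarrow> complex"
  assumes "\<And>k. k \<in> A \<Longrightarrow> (f k has_sum s k) B"
  shows "((\<lambda>n. \<Sum>k\<in>A. f k n) has_sum (\<Sum>k\<in>A. s k)) B"
  using assms by (induction A rule: infinite_finite_induct) (auto intro: has_sum_add)

section \<open>Area integrals of power series by rotation invariance\<close>

lemma nn_integral_translate:
  fixes f :: "complex \<Rightarrow> ennreal"
  assumes f: "f \<in> borel_measurable borel"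
  shows "(\<integral>\<^sup>+x. f (x + d) \<partial>lborel) = (\<integral>\<^sup>+x. f x \<partial>lborel)"
  using nn_integral_distr[of "(+) d" lborel borel f] f lborel_distr_plus[of d]
  by (simp add: add.commute)

text \<open>Uniqueness of Haar measure, applied to the image of Lebesgue measure under the rotation; the
  invariant unit disc shows that the two measures agree and not merely up to a factor.\<close>

lemma nn_integral_rotate:
  fixes a :: "complex \<Rightarrow> ennreal"
  assumes a[measurable]: "a \<in> borel_measurable borel" and c: "cmod c = 1"
  shows "(\<integral>\<^sup>+x. a (c * x) \<partial>lborel) = (\<integral>\<^sup>+x. a x \<partial>lborel)"
proof -
  \<comment> \<open>A rotation invariant weight of mass pi; this finite positive factor is cancelled
    at the end.\<close>
  define b where "b x = (indicator (ball 0 1) x :: ennreal)" for x :: complex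
  have b[measurable]: "b \<in> borel_measurable borel" unfolding b_def by (rule borel_measurable_indicator) simp
  have b_rot: "b (- (c * x)) = b x" for x using c by (simp add: b_def indicator_def norm_mult)
  have c0: "c \<noteq> 0" using c by auto
  have "emeasure lborel (ball (0::complex) 1) = ennreal pi"
    using emeasure_ball[of 1 "0::complex"] by (simp add: unit_ball_vol_2)
  then have B: "(\<integral>\<^sup>+x. b x \<partial>lborel) = ennreal pi" unfolding b_def by simp
  have "(\<integral>\<^sup>+x. a (c * x) \<partial>lborel) * ennreal pi =
      (\<integral>\<^sup>+x. (\<integral>\<^sup>+y. a (c * x) * b y \<partial>lborel) \<partial>lborel)"
    by (simp add: nn_integral_cmult nn_integral_multc B)
  also have "\<dots> = (\<integral>\<^sup>+x. (\<integral>\<^sup>+y. a (c * x) * b (y - c * x) \<partial>lborel) \<partial>lborel)"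
    using nn_integral_translate[of "\<lambda>y. a (c * x) * b y" "- (c * x)" for x] by simp
  also have "\<dots> = (\<integral>\<^sup>+y. (\<integral>\<^sup>+x. a (c * x) * b (y - c * x) \<partial>lborel) \<partial>lborel)"
    by (intro lborel_pair.Fubini'[symmetric]) simp
  \<comment> \<open>Translating x by y / c moves y from \<open>b\<close> into \<open>a\<close>; once
    the order is exchanged, translating y by c x removes the rotation from \<open>a\<close>.\<close>
  also have "\<dots> = (\<integral>\<^sup>+y. (\<integral>\<^sup>+x. a (c * x + y) * b (- (c * x)) \<partial>lborel) \<partial>lborel)"
    using nn_integral_translate[of "\<lambda>x. a (c * x) * b (y - c * x)" "y / c" for y] c0
    by (simp add: distrib_left)
  also have "\<dots> = (\<integral>\<^sup>+x. (\<integral>\<^sup>+y. a (c * x + y) * b (- (c * x)) \<partial>lborel) \<partial>lborel)"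
    by (intro lborel_pair.Fubini') simp
  also have "\<dots> = (\<integral>\<^sup>+x. (\<integral>\<^sup>+y. a y \<partial>lborel) * b x \<partial>lborel)"
    using nn_integral_translate[of a "c * x" for x]
    by (simp add: nn_integral_multc b_rot add.commute)
  also have "\<dots> = (\<integral>\<^sup>+y. a y \<partial>lborel) * ennreal pi"
    by (simp add: nn_integral_cmult B)
  finally have "ennreal pi * (\<integral>\<^sup>+x. a (c * x) \<partial>lborel) = ennreal pi * (\<integral>\<^sup>+x. a x \<partial>lborel)"
    by (simp add: mult.commute)
  then show ?thesis
    by (subst (asm) ennreal_mult_cancel_left) auto
qed

text \<open>A layer cake argument in place of polar coordinates: 1 - |z|^(2 n) is the integral of
  the derivative g of s^(2 n) over |z| \<le> s \<le> 1, and Fubini reduces it to areas of discs. The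
  complementary function 1 - |z|^(2 n) is chosen because its layers are discs rather than
  annuli.\<close>

lemma nn_integral_disc_monomial:
  "(\<integral>\<^sup>+z. ennreal (cmod z ^ (2 * n)) * indicator disc z \<partial>lborel) = ennreal (pi / real (Suc n))"
proof -
  \<comment> \<open>For n = 0 the truncated exponent is harmless, since the factor n makes g
    zero.\<close>
  define g where "g s = 2 * real n * s ^ (2 * n - 1)" for s :: real
  have g[measurable]: "g \<in> borel_measurable borel" unfolding g_def by measurable
  have g0: "0 \<le> g s" if "0 \<le> s" for s using that by (simp add: g_def)
  have gD: "DERIV (\<lambda>s. s ^ (2 * n)) s :> g s" for s
    unfolding g_def by (auto intro!: derivative_eq_intros)
  have disc_area: "emeasure lborel (ball (0::complex) 1) = ennreal pi"
    using emeasure_ball[of 1 "0::complex"] by (simp add: unit_ball_vol_2)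
  have cdisc_area: "emeasure lborel (cball (0::complex) s) = ennreal (pi * s\<^sup>2)" if "0 \<le> s" for s
    using emeasure_cball[OF that, of "0::complex"] by (simp add: unit_ball_vol_2)
  have "(\<integral>\<^sup>+z. ennreal (1 - cmod z ^ (2 * n)) * indicator (ball 0 1) z \<partial>lborel) =
      (\<integral>\<^sup>+z. (\<integral>\<^sup>+s. ennreal (g s) * (indicator {0..1} s * indicator (cball (0::complex) s) z) \<partial>lborel) \<partial>lborel)"
    (is "?L = (\<integral>\<^sup>+z. (\<integral>\<^sup>+s. ?h s z \<partial>lborel) \<partial>lborel)")
  proof (rule nn_integral_cong)
    fix z :: complex
    show "ennreal (1 - cmod z ^ (2 * n)) * indicator (ball 0 1) z = (\<integral>\<^sup>+s. ?h s z \<partial>lborel)"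
    proof (cases "cmod z \<le> 1")
      \<comment> \<open>This includes |z| = 1: the open disc excludes such points on the left, and
        on the right the interval of integration is a single point.\<close>
      case True
      have "(\<integral>\<^sup>+s. ?h s z \<partial>lborel) = (\<integral>\<^sup>+s. ennreal (g s) * indicator {cmod z..1} s \<partial>lborel)"
        by (intro nn_integral_cong) (use order_trans[OF norm_ge_zero[of z]] in \<open>auto simp: indicator_def\<close>)
      also have "\<dots> = ennreal (1 ^ (2 * n) - cmod z ^ (2 * n))"
        using True by (intro nn_integral_FTC_Icc gD g0)
          (auto intro: order_trans[OF norm_ge_zero] simp: has_field_derivative_at_within)
      finally show ?thesis using True by (auto simp: indicator_def)
    next
      case False
      then have "(\<integral>\<^sup>+s. ?h s z \<partial>lborel) = (\<integral>\<^sup>+(s::real). 0 \<partial>lborel)"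
        by (intro nn_integral_cong) (auto simp: indicator_def)
      then show ?thesis using False by (simp add: indicator_def del: indicator_simps)
    qed
  qed
  also have "\<dots> = (\<integral>\<^sup>+s. (\<integral>\<^sup>+z. ?h s z \<partial>lborel) \<partial>lborel)"
  proof (rule lborel_pair.Fubini')
    have "(\<lambda>(s, z::complex). ?h s z) = (\<lambda>p. ennreal (g (fst p)) * (indicator {0..1} (fst p) *
        indicator {q. cmod (snd q) \<le> fst q} p))"
      by (auto simp: fun_eq_iff indicator_def)
    also have "\<dots> \<in> borel_measurable (lborel \<Otimes>\<^sub>M lborel)" by measurable
    finally show "(\<lambda>(s, z::complex). ?h s z) \<in> borel_measurable (lborel \<Otimes>\<^sub>M lborel)" .
  qed
  also have "\<dots> = (\<integral>\<^sup>+s. ennreal (2 * real n * pi * s ^ (2 * n + 1)) * indicator {0..1} s \<partial>lborel)"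
  proof (rule nn_integral_cong)
    fix s :: real
    show "(\<integral>\<^sup>+z. ?h s z \<partial>lborel) = ennreal (2 * real n * pi * s ^ (2 * n + 1)) * indicator {0..1} s"
    proof (cases "s \<in> {0..1}")
      case True
      then have "(\<integral>\<^sup>+z. ?h s z \<partial>lborel) = ennreal (g s) * emeasure lborel (cball (0::complex) s)"
        by (simp add: nn_integral_cmult_indicator)
      also have "\<dots> = ennreal (g s * (pi * s\<^sup>2))"
        using True g0 by (simp add: cdisc_area ennreal_mult)
      also have "g s * (pi * s\<^sup>2) = 2 * real n * pi * s ^ (2 * n + 1)"
        by (cases n) (simp_all add: g_def power2_eq_square)
      finally show ?thesis using True by simp
    qed simp
  qed
  also have "\<dots> = ennreal (2 * real n * pi / real (2 * n + 2) * 1 ^ (2 * n + 2) - 2 * real n * pi / real (2 * n + 2) * 0 ^ (2 * n + 2))"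
  proof (rule nn_integral_FTC_Icc)
    fix s :: real
    have "DERIV (\<lambda>s. 2 * real n * pi / real (2 * n + 2) * s ^ (2 * n + 2)) s :>
        2 * real n * pi / real (2 * n + 2) * (real (2 * n + 2) * s ^ (2 * n + 2 - Suc 0))"
      by (intro DERIV_cmult DERIV_pow)
    also have "2 * real n * pi / real (2 * n + 2) * (real (2 * n + 2) * s ^ (2 * n + 2 - Suc 0)) =
        2 * real n * pi * s ^ (2 * n + 1)"
      by (simp del: of_nat_add of_nat_mult power_Suc)
    finally show "DERIV (\<lambda>s. 2 * real n * pi / real (2 * n + 2) * s ^ (2 * n + 2)) s :>
        2 * real n * pi * s ^ (2 * n + 1)" .
  qed auto
  finally have L: "?L = ennreal (pi * real n / real (Suc n))"
    by (simp add: field_simps)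
  let ?R = "\<integral>\<^sup>+z. ennreal (cmod z ^ (2 * n)) * indicator (ball 0 1) z \<partial>lborel"
  have "?L + ?R = (\<integral>\<^sup>+z. indicator (ball (0::complex) 1) z \<partial>lborel)"
  proof (subst nn_integral_add[symmetric])
    show "(\<integral>\<^sup>+z. ennreal (1 - cmod z ^ (2 * n)) * indicator (ball 0 1) z +
        ennreal (cmod z ^ (2 * n)) * indicator (ball 0 1) z \<partial>lborel) =
        (\<integral>\<^sup>+z. indicator (ball (0::complex) 1) z \<partial>lborel)"
      by (intro nn_integral_cong)
         (auto simp: indicator_def power_le_one simp flip: ennreal_plus)
  qed (intro borel_measurable_times_ennreal borel_measurable_indicator; simp)+
  then have *: "ennreal (pi * real n / real (Suc n)) + ?R = ennreal pi"
    unfolding L by (simp add: disc_area)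
  have "ennreal pi = ennreal (pi * real n / real (Suc n)) + ennreal (pi / real (Suc n))"
  proof -
    have "pi * real n / real (Suc n) + pi / real (Suc n) = pi"
      unfolding add_divide_distrib[symmetric] by (subst divide_eq_eq) (simp add: algebra_simps)
    then show ?thesis by (simp flip: ennreal_plus del: of_nat_Suc)
  qed
  \<comment> \<open>Subtraction is replaced by cancelling a finite summand of extended
    reals.\<close>
  with * show ?thesis
    by (simp only: ennreal_add_left_cancel) auto
qed

text \<open>Averaging g over rotations preserves its area integral and replaces g by its mean over
  the circle through z, where Parseval applies; the monomials are then integrated one by one.
  Nonnegative integrals keep the identity valid when both sides are infinite.\<close>

lemma nn_integral_disc_series:
  assumes f: "f holomorphic_on disc"
  shows "(\<integral>\<^sup>+z. ennreal ((cmod (f z))\<^sup>2) * indicator disc z \<partial>lborel) =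
    (\<Sum>n. ennreal (pi * (cmod (taylor_coeff f n))\<^sup>2 / real (Suc n)))"
proof -
  define h where "h z = indicator (ball 0 1) z *\<^sub>R f z" for z :: complex
  have h[measurable]: "h \<in> borel_measurable borel"
    unfolding h_def
    by (rule borel_measurable_continuous_on_indicator) (use f in \<open>auto intro: holomorphic_on_imp_continuous_on\<close>)
  define g where "g z = ennreal ((cmod (h z))\<^sup>2)" for z
  have g[measurable]: "g \<in> borel_measurable borel" unfolding g_def by measurable
  have g_eq: "ennreal ((cmod (f z))\<^sup>2) * indicator disc z = g z" for z
    by (simp add: g_def h_def indicator_def)
  have cis_meas[measurable]: "cis \<in> borel_measurable borel"
    by (intro borel_measurable_continuous_onI continuous_intros)
  have inner: "(\<integral>\<^sup>+t. indicator {0..2*pi} t * g (cis t * z) \<partial>lborel) =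
      2 * pi * (\<Sum>n. ennreal ((cmod (taylor_coeff f n))\<^sup>2 * cmod z ^ (2 * n)) * indicator disc z)" for z
  proof (cases "z \<in> disc")
    case True
    define A where "A n = taylor_coeff f n * z ^ n" for n
    have A: "summable (\<lambda>n. cmod (A n))"
      using taylor_summable[OF f, of "cmod z"] True by (simp add: A_def norm_mult norm_power)
    define F where "F t = (\<Sum>n. A n * cis (real n * t))" for t
    have in_disc: "cis t * z \<in> disc" for t using True by (simp add: norm_mult)
    have fF: "f (cis t * z) = F t" for t
      using taylor_sums[OF f in_disc, of t]
      by (simp add: sums_iff F_def A_def power_mult_distrib Complex.DeMoivre mult_ac)
    have gF: "g (cis t * z) = ennreal ((cmod (F t))\<^sup>2)" for t
      using in_disc[of t] by (simp add: g_def h_def fF[symmetric] indicator_def)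
    have A2: "(\<lambda>n. (cmod (A n))\<^sup>2) sums (\<Sum>n. (cmod (A n))\<^sup>2)"
      using summable_cmod_mult_cnj[OF A A] by (intro summable_sums) (simp add: norm_mult power2_eq_square)
    have F_cont: "continuous_on UNIV F"
      unfolding F_def
      by (rule uniform_limit_theorem[OF _ Weierstrass_m_test[OF _ A]])
         (auto intro!: always_eventually continuous_intros simp: norm_mult)
    have int: "set_integrable lborel {0..2*pi} (\<lambda>t. (cmod (F t))\<^sup>2)"
      by (intro borel_integrable_atLeastAtMost' continuous_intros continuous_on_subset[OF F_cont]) auto
    have "complex_of_real (LINT t:{0..2*pi}|lborel. (cmod (F t))\<^sup>2) =
        (LINT t:{0..2*pi}|lborel. F t * cnj (F t))"
      unfolding cmod_sq set_lebesgue_integral_def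
      by (subst integral_complex_of_real[symmetric]) (simp add: scaleR_conv_of_real)
    also have "\<dots> = 2 * pi * (\<Sum>n. A n * cnj (A n))"
      unfolding F_def by (rule circle_integral_series[OF A A])
    also have "(\<Sum>n. A n * cnj (A n)) = of_real (\<Sum>n. (cmod (A n))\<^sup>2)"
      unfolding cmod_sq using sums_of_real[OF A2, where 'a = complex] by (simp add: sums_iff)
    finally have eq: "(LINT t:{0..2*pi}|lborel. (cmod (F t))\<^sup>2) = 2 * pi * (\<Sum>n. (cmod (A n))\<^sup>2)"
      by (metis of_real_eq_iff of_real_mult of_real_numeral)
    have "(\<integral>\<^sup>+t. indicator {0..2*pi} t * g (cis t * z) \<partial>lborel) =
        (\<integral>\<^sup>+t. ennreal (indicator {0..2*pi} t *\<^sub>R (cmod (F t))\<^sup>2) \<partial>lborel)"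
      unfolding gF by (intro nn_integral_cong) (simp add: indicator_def)
    also have "\<dots> = ennreal (LINT t:{0..2*pi}|lborel. (cmod (F t))\<^sup>2)"
      using int unfolding set_integrable_def set_lebesgue_integral_def
      by (intro nn_integral_eq_integral) auto
    also have "\<dots> = 2 * pi * (\<Sum>n. ennreal ((cmod (A n))\<^sup>2))"
      unfolding eq using A2
      by (subst suminf_ennreal2) (auto simp: sums_iff ennreal_mult suminf_nonneg)
    finally show ?thesis
      using True by (simp add: A_def norm_mult norm_power power_mult_distrib power_mult[symmetric] mult.commute)
  next
    case False
    then have "g (cis t * z) = 0" for t by (simp add: g_def h_def norm_mult indicator_def)
    then show ?thesis using False by simp
  qed
  have "ennreal (2 * pi) * (\<integral>\<^sup>+z. g z \<partial>lborel) =
      (\<integral>\<^sup>+t. indicator {0..2*pi} t * (\<integral>\<^sup>+z. g z \<partial>lborel) \<partial>lborel)"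
    by (simp add: nn_integral_multc)
  also have "\<dots> = (\<integral>\<^sup>+t. (\<integral>\<^sup>+z. indicator {0..2*pi} t * g (cis t * z) \<partial>lborel) \<partial>lborel)"
    using nn_integral_rotate[OF g, of "cis t" for t] by (simp add: nn_integral_cmult)
  also have "\<dots> = (\<integral>\<^sup>+z. (\<integral>\<^sup>+t. indicator {0..2*pi} t * g (cis t * z) \<partial>lborel) \<partial>lborel)"
    by (intro lborel_pair.Fubini'[symmetric]) simp
  also have "\<dots> = 2 * pi * (\<integral>\<^sup>+z. (\<Sum>n. ennreal ((cmod (taylor_coeff f n))\<^sup>2 * cmod z ^ (2 * n)) * indicator disc z) \<partial>lborel)"
    unfolding inner
    by (rule nn_integral_cmult, intro borel_measurable_suminf_order borel_measurable_times_ennreal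
        borel_measurable_indicator) simp_all
  also have "(\<integral>\<^sup>+z. (\<Sum>n. ennreal ((cmod (taylor_coeff f n))\<^sup>2 * cmod z ^ (2 * n)) * indicator disc z) \<partial>lborel) =
      (\<Sum>n. \<integral>\<^sup>+z. ennreal ((cmod (taylor_coeff f n))\<^sup>2 * cmod z ^ (2 * n)) * indicator disc z \<partial>lborel)"
    by (intro nn_integral_suminf borel_measurable_times_ennreal borel_measurable_indicator) simp_all
  also have "\<dots> = (\<Sum>n. ennreal ((cmod (taylor_coeff f n))\<^sup>2) * ennreal (pi / real (Suc n)))"
  proof -
    have "(\<lambda>z. ennreal (cmod z ^ (2 * n)) * indicator disc z) \<in> borel_measurable lborel" for n
      by (intro borel_measurable_times_ennreal borel_measurable_indicator) simp_all
    from nn_integral_cmult[OF this] show ?thesis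
      by (simp add: ennreal_mult mult.assoc nn_integral_disc_monomial del: of_nat_Suc)
  qed
  also have "\<dots> = (\<Sum>n. ennreal (pi * (cmod (taylor_coeff f n))\<^sup>2 / real (Suc n)))"
    by (simp add: mult.commute flip: ennreal_mult)
  finally show ?thesis
    unfolding g_eq by (subst (asm) ennreal_mult_cancel_left) auto
qed

text \<open>The coefficient with respect to \<open>bergman_basis\<close>: dividing by sqrt(n + 1)
  turns the weighted sum for the area norm into a plain l2 sum.\<close>

definition bergman_coeff :: "(complex \<Rightarrow> complex) \<Rightarrow> nat \<Rightarrow> complex" where
  "bergman_coeff f n = taylor_coeff f n / of_real (sqrt (real (Suc n)))"

lemma cmod_bergman_coeff: "pi * (cmod (bergman_coeff f n))\<^sup>2 = pi * (cmod (taylor_coeff f n))\<^sup>2 / real (Suc n)"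
  by (simp add: bergman_coeff_def norm_divide power_divide del: of_nat_Suc)

lemma disc_norm_sq_measurable:
  assumes f: "f holomorphic_on disc"
  shows "(\<lambda>z. indicator disc z *\<^sub>R (cmod (f z))\<^sup>2) \<in> borel_measurable lborel"
proof -
  have "(\<lambda>z. indicator disc z *\<^sub>R (cmod (f z))\<^sup>2) \<in> borel_measurable borel"
    by (rule borel_measurable_continuous_on_indicator)
       (auto intro!: continuous_intros holomorphic_on_imp_continuous_on f)
  then show ?thesis by simp
qed

lemma set_integrable_disc_iff:
  assumes f: "f holomorphic_on disc"
  shows "set_integrable lborel disc (\<lambda>z. (cmod (f z))\<^sup>2) \<longleftrightarrow> square_summable (bergman_coeff f)"
    and "square_summable (bergman_coeff f) \<Longrightarrow>
      (LINT z:disc|lborel. (cmod (f z))\<^sup>2) = pi * (\<Sum>\<^sub>\<infinity>n. (cmod (bergman_coeff f n))\<^sup>2)"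
proof -
  have meas: "(\<lambda>z. indicator disc z *\<^sub>R (cmod (f z))\<^sup>2) \<in> borel_measurable lborel"
    using f by (rule disc_norm_sq_measurable)
  have nn: "(\<integral>\<^sup>+z. ennreal (indicator disc z *\<^sub>R (cmod (f z))\<^sup>2) \<partial>lborel) =
      (\<Sum>n. ennreal (pi * (cmod (bergman_coeff f n))\<^sup>2))"
    unfolding cmod_bergman_coeff nn_integral_disc_series[OF f, symmetric]
    by (intro nn_integral_cong) (simp add: indicator_def)
  have ss: "square_summable (bergman_coeff f) \<longleftrightarrow> summable (\<lambda>n. pi * (cmod (bergman_coeff f n))\<^sup>2)"
    unfolding square_summable_def by (subst summable_on_UNIV_nonneg_real_iff) (auto simp: summable_cmult_iff)
  show iff: "set_integrable lborel disc (\<lambda>z. (cmod (f z))\<^sup>2) \<longleftrightarrow> square_summable (bergman_coeff f)"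
  proof
    assume "set_integrable lborel disc (\<lambda>z. (cmod (f z))\<^sup>2)"
    then have "(\<Sum>n. ennreal (pi * (cmod (bergman_coeff f n))\<^sup>2)) < \<infinity>"
      unfolding nn[symmetric] set_integrable_def integrable_iff_bounded by simp
    then show "square_summable (bergman_coeff f)"
      unfolding ss by (intro summable_suminf_not_top) auto
  next
    assume "square_summable (bergman_coeff f)"
    then have "(\<Sum>n. ennreal (pi * (cmod (bergman_coeff f n))\<^sup>2)) < \<infinity>"
      unfolding ss by (subst suminf_ennreal2) auto
    then show "set_integrable lborel disc (\<lambda>z. (cmod (f z))\<^sup>2)"
      unfolding set_integrable_def integrable_iff_bounded using meas nn by simp
  qed
  assume s: "square_summable (bergman_coeff f)"
  have "ennreal (LINT z:disc|lborel. (cmod (f z))\<^sup>2) = (\<Sum>n. ennreal (pi * (cmod (bergman_coeff f n))\<^sup>2))"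
    unfolding nn[symmetric] set_lebesgue_integral_def using s iff
    by (intro nn_integral_eq_integral[symmetric]) (auto simp: set_integrable_def)
  also have "\<dots> = ennreal (\<Sum>n. pi * (cmod (bergman_coeff f n))\<^sup>2)"
    using s unfolding ss by (intro suminf_ennreal2) auto
  finally have "(LINT z:disc|lborel. (cmod (f z))\<^sup>2) = (\<Sum>n. pi * (cmod (bergman_coeff f n))\<^sup>2)"
    using s unfolding ss by (subst (asm) ennreal_inj)
      (auto intro!: suminf_nonneg simp: set_lebesgue_integral_def)
  also have "\<dots> = (\<Sum>\<^sub>\<infinity>n. pi * (cmod (bergman_coeff f n))\<^sup>2)"
    using s unfolding ss by (intro infsumI[symmetric] sums_nonneg_imp_has_sum summable_sums) auto
  finally show "(LINT z:disc|lborel. (cmod (f z))\<^sup>2) = pi * (\<Sum>\<^sub>\<infinity>n. (cmod (bergman_coeff f n))\<^sup>2)"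
    by (simp add: infsum_cmult_right')
qed

definition bergman_ip :: "(complex \<Rightarrow> complex) \<Rightarrow> (complex \<Rightarrow> complex) \<Rightarrow> complex" where
  "bergman_ip f g = (LINT z:disc|lborel. f z * cnj (g z)) / of_real pi"

lemma bergman_fun_space: "bergman = fun_space (hcarrier bergman) bergman_ip"
  by (simp add: bergman_def bergman_ip_def[abs_def])

lemma hinner_bergman: "hinner bergman = bergman_ip"
  by (subst bergman_fun_space) simp

lemma bergman_simps [simp]:
  "hzero bergman = (\<lambda>x. 0)"
  "hadd bergman = (\<lambda>f g x. f x + g x)" "hscale bergman = (\<lambda>c f x. c * f x)"
  "hdiff bergman = (\<lambda>f g x. f x - g x)"
  by (simp_all add: bergman_def)

lemma bergman_carrier_iff:
  "f \<in> hcarrier bergman \<longleftrightarrow> f holomorphic_on disc \<and> (\<forall>z. z \<notin> disc \<longrightarrow> f z = 0) \<and>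
    square_summable (bergman_coeff f)"
  using set_integrable_disc_iff(1)[of f] by (auto simp: bergman_def)

lemma bergman_coeff_add:
  "f holomorphic_on disc \<Longrightarrow> g holomorphic_on disc \<Longrightarrow>
    bergman_coeff (\<lambda>x. f x + g x) n = bergman_coeff f n + bergman_coeff g n"
  by (simp add: bergman_coeff_def taylor_coeff_add add_divide_distrib)

lemma bergman_coeff_scale:
  "f holomorphic_on disc \<Longrightarrow> bergman_coeff (\<lambda>x. k * f x) n = k * bergman_coeff f n"
  by (simp add: bergman_coeff_def taylor_coeff_scale)

lemma bergman_add_closed:
  assumes "f \<in> hcarrier bergman" "g \<in> hcarrier bergman"
  shows "(\<lambda>x. f x + g x) \<in> hcarrier bergman"
  using assms square_summable_add[of "bergman_coeff f" "bergman_coeff g"]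
    ext[of "bergman_coeff (\<lambda>x. f x + g x)", OF bergman_coeff_add[of f g]]
  by (auto simp: bergman_carrier_iff intro!: holomorphic_intros)

lemma bergman_scale_closed:
  assumes "f \<in> hcarrier bergman"
  shows "(\<lambda>x. k * f x) \<in> hcarrier bergman"
  using assms square_summable_scale[of "bergman_coeff f" k]
    ext[of "bergman_coeff (\<lambda>x. k * f x)", OF bergman_coeff_scale[of f k]]
  by (auto simp: bergman_carrier_iff intro!: holomorphic_intros)

lemma polarization:
  "a * cnj b = (\<Sum>k<4. (\<i> ^ k / 4) * of_real ((cmod (a + \<i> ^ k * b))\<^sup>2))"
  by (simp only: cmod_sq[symmetric]) (simp add: numeral_eq_Suc algebra_simps)

text \<open>So far only squared moduli have been integrated; polarization with the four functions
  \<open>u k\<close>, all in \<open>bergman\<close>, yields the mixed inner product.\<close>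

lemma bergman_ip_coeff:
  assumes f: "f \<in> hcarrier bergman" and g: "g \<in> hcarrier bergman"
  shows "bergman_ip f g = (\<Sum>\<^sub>\<infinity>n. bergman_coeff f n * cnj (bergman_coeff g n))"
proof -
  define u where "u k = (\<lambda>z. f z + \<i> ^ k * g z)" for k :: nat
  have u: "u k \<in> hcarrier bergman" for k
    unfolding u_def by (intro bergman_add_closed bergman_scale_closed f g)
  have uh: "u k holomorphic_on disc" and us: "square_summable (bergman_coeff (u k))" for k
    using u by (auto simp: bergman_carrier_iff)
  have uc: "bergman_coeff (u k) n = bergman_coeff f n + \<i> ^ k * bergman_coeff g n" for k n
    using f g unfolding u_def
    by (simp add: bergman_coeff_add bergman_coeff_scale bergman_carrier_iff holomorphic_intros)
  have int: "set_integrable lborel disc (\<lambda>z. (\<i> ^ k / 4) * complex_of_real ((cmod (u k z))\<^sup>2))" for k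
  proof -
    have "integrable lborel (\<lambda>z. indicator disc z *\<^sub>R (cmod (u k z))\<^sup>2)"
      using set_integrable_disc_iff(1)[OF uh] us by (simp add: set_integrable_def)
    from integrable_of_real[OF this, where 'a = complex]
    show ?thesis
      by (intro set_integrable_mult_right) (simp add: set_integrable_def scaleR_conv_of_real)
  qed
  have "(LINT z:disc|lborel. f z * cnj (g z)) =
      (LINT z:disc|lborel. (\<Sum>k<4. (\<i> ^ k / 4) * complex_of_real ((cmod (u k z))\<^sup>2)))"
    unfolding polarization u_def ..
  also have "\<dots> = (\<Sum>k<4. LINT z:disc|lborel. (\<i> ^ k / 4) * complex_of_real ((cmod (u k z))\<^sup>2))"
    using int unfolding set_lebesgue_integral_def set_integrable_def
    by (simp only: scaleR_sum_right) (rule Bochner_Integration.integral_sum, simp)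
  also have "\<dots> = (\<Sum>k<4. (\<i> ^ k / 4) * of_real (pi * (\<Sum>\<^sub>\<infinity>n. (cmod (bergman_coeff (u k) n))\<^sup>2)))"
    by (simp only: set_integral_mult_right set_integral_complex_of_real set_integrable_disc_iff(2)[OF uh us])
  also have "\<dots> = (\<Sum>k<4. \<Sum>\<^sub>\<infinity>n. of_real pi * ((\<i> ^ k / 4) * of_real ((cmod (bergman_coeff (u k) n))\<^sup>2)))"
  proof (rule sum.cong)
    fix k :: nat
    have "(\<Sum>\<^sub>\<infinity>n. complex_of_real ((cmod (bergman_coeff (u k) n))\<^sup>2)) =
        of_real (\<Sum>\<^sub>\<infinity>n. (cmod (bergman_coeff (u k) n))\<^sup>2)"
      using us by (intro infsumI has_sum_of_real has_sum_infsum) (simp add: square_summable_def)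
    then show "(\<i> ^ k / 4) * of_real (pi * (\<Sum>\<^sub>\<infinity>n. (cmod (bergman_coeff (u k) n))\<^sup>2)) =
        (\<Sum>\<^sub>\<infinity>n. of_real pi * ((\<i> ^ k / 4) * of_real ((cmod (bergman_coeff (u k) n))\<^sup>2)))"
      by (simp only: infsum_cmult_right') simp
  qed simp
  also have "\<dots> = (\<Sum>\<^sub>\<infinity>n. \<Sum>k<4. of_real pi * ((\<i> ^ k / 4) * of_real ((cmod (bergman_coeff (u k) n))\<^sup>2)))"
  proof (intro infsumI[symmetric] has_sum_sum has_sum_infsum)
    show "(\<lambda>n. of_real pi * ((\<i> ^ k / 4) * of_real ((cmod (bergman_coeff (u k) n))\<^sup>2))) summable_on UNIV" for k
      using us by (intro summable_on_cmult_right summable_on_of_real) (simp add: square_summable_def)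
  qed
  also have "\<dots> = (\<Sum>\<^sub>\<infinity>n. of_real pi * (bergman_coeff f n * cnj (bergman_coeff g n)))"
    unfolding polarization uc sum_distrib_left ..
  finally show ?thesis
    by (simp add: bergman_ip_def infsum_cmult_right')
qed

lemma bergman_zero_off: "f \<in> hcarrier bergman \<Longrightarrow> z \<notin> disc \<Longrightarrow> f z = 0"
  by (simp add: bergman_carrier_iff)

lemma bergman_holomorphic: "f \<in> hcarrier bergman \<Longrightarrow> f holomorphic_on disc"
  by (simp add: bergman_carrier_iff)

interpretation Bc: coefficient_space "hcarrier bergman" bergman_ip bergman_coeff
proof
  show "(\<lambda>x. 0) \<in> hcarrier bergman"
    using taylor_coeff_eqI[of "\<lambda>_. 0" "\<lambda>_. 0"]
    by (simp add: bergman_carrier_iff square_summable_def bergman_coeff_def)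
  show "f = (\<lambda>x. 0)" if "f \<in> hcarrier bergman" "\<And>i. bergman_coeff f i = 0" for f
  proof
    fix x
    have "taylor_coeff f n = 0" for n using that(2)[of n] by (simp add: bergman_coeff_def)
    then show "f x = 0"
      using taylor_coeff_eq_0[OF bergman_holomorphic[OF that(1)]] bergman_zero_off[OF that(1)] by blast
  qed
qed (simp_all only: bergman_holomorphic bergman_coeff_add bergman_coeff_scale bergman_ip_coeff
  bergman_add_closed bergman_scale_closed, simp add: bergman_carrier_iff)

lemma bergman_hilbert: "complex_hilbert_space bergman"
proof (subst bergman_fun_space, rule Bc.hilbert)
  fix a :: "nat \<Rightarrow> complex" assume a: "square_summable a"
  \<comment> \<open>Undoes the normalization in \<open>bergman_coeff\<close>: these are the Taylor
    coefficients of the function to be built.\<close>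
  define b where "b n = a n * of_real (sqrt (real (Suc n)))" for n
  define f where "f = zero_off disc (\<lambda>z. \<Sum>n. b n * z ^ n)"
  obtain K where K: "\<And>n. cmod (a n) \<le> K" using square_summable_bounded[OF a] by blast
  have ss: "(\<lambda>n. b n * z ^ n) sums f z" if z: "z \<in> disc" for z
  proof -
    have "summable (\<lambda>n. b n * z ^ n)"
    proof (rule summable_norm_cancel, rule summable_comparison_test')
      \<comment> \<open>The growth sqrt(n + 1) is at most n + 1, so a differentiated geometric
        series dominates.\<close>
      have "summable (\<lambda>n. diffs (\<lambda>_. 1) n * cmod z ^ n)"
        using z by (intro termdiff_converges[of _ 1]) (auto intro!: summable_geometric)
      then show "summable (\<lambda>n. K * (real (Suc n) * cmod z ^ n))"
        by (intro summable_mult) (simp add: diffs_def)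
      fix n
      have "sqrt (real (Suc n)) \<le> real (Suc n)"
        by (intro real_le_lsqrt) (auto simp: power2_eq_square)
      then have "cmod (a n) * sqrt (real (Suc n)) * cmod z ^ n \<le> K * real (Suc n) * cmod z ^ n"
        by (intro mult_right_mono mult_mono K) (auto intro: order_trans[OF norm_ge_zero K])
      then show "norm (cmod (b n * z ^ n)) \<le> K * (real (Suc n) * cmod z ^ n)"
        by (simp add: b_def norm_mult norm_power mult.assoc del: of_nat_Suc)
    qed
    then show ?thesis using z by (simp add: f_def zero_off_def summable_sums)
  qed
  have c: "bergman_coeff f n = a n" for n
    using taylor_coeff_eqI[OF ss, of n] by (simp add: bergman_coeff_def b_def del: of_nat_Suc)
  have "f \<in> hcarrier bergman"
    using power_series_holomorphic_disc[OF ss] a ext[of "bergman_coeff f" a, OF c]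
    by (auto simp: bergman_carrier_iff f_def zero_off_def)
  with c show "\<exists>f\<in>hcarrier bergman. \<forall>i. bergman_coeff f i = a i" by blast
qed

interpretation bergman: pre_hilbert_space bergman
  by (subst bergman_fun_space, rule Bc.pre_hilbert)

lemma bergman_coeff_basis: "bergman_coeff (bergman_basis j) n = (if n = j then 1 else 0)"
proof -
  have "taylor_coeff (bergman_basis j) n = (if n = j then of_real (sqrt (real (Suc j))) else 0)"
  proof (rule taylor_coeff_eqI)
    fix z :: complex assume "z \<in> disc"
    then show "(\<lambda>n. (if n = j then of_real (sqrt (real (Suc j))) else 0) * z ^ n) sums bergman_basis j z"
      using sums_single[of j "\<lambda>n. of_real (sqrt (real (Suc j))) * z ^ n"]
      by (simp add: bergman_basis_def zero_off_def if_distrib[of "\<lambda>x. x * _"] add.commute cong: if_cong)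
  qed
  then show ?thesis by (simp add: bergman_coeff_def del: of_nat_Suc)
qed

lemma bergman_basis_closed: "bergman_basis j \<in> hcarrier bergman"
proof -
  have "bergman_basis j holomorphic_on disc"
    by (rule holomorphic_transform[of "\<lambda>z. of_real (sqrt (real j + 1)) * z ^ j"])
       (auto simp: bergman_basis_def zero_off_def intro!: holomorphic_intros)
  moreover have "square_summable (bergman_coeff (bergman_basis j))"
    unfolding square_summable_def bergman_coeff_basis
    by (rule finite_nonzero_values_imp_summable_on) (rule finite_subset[of _ "{j}"], auto)
  ultimately show ?thesis by (simp add: bergman_carrier_iff bergman_basis_def zero_off_def)
qed

lemma bergman_ip_basis:
  assumes f: "f \<in> hcarrier bergman"
  shows "bergman_ip f (bergman_basis j) = bergman_coeff f j"
proof -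
  have "bergman_ip f (bergman_basis j) = (\<Sum>\<^sub>\<infinity>k\<in>{j}. bergman_coeff f k)"
    unfolding bergman_ip_coeff[OF f bergman_basis_closed] bergman_coeff_basis
    by (rule infsum_cong_neutral) auto
  then show ?thesis by simp
qed

lemma bergman_basis_total: "bergman.orthonormal UNIV bergman_basis" "bergman.total UNIV bergman_basis"
  using Bc.c_inj
  by (auto simp: bergman.orthonormal_def bergman.total_def bergman_basis_closed hinner_bergman
      bergman_ip_basis bergman_coeff_basis)

lemma bergman_shift_closed:
  assumes f: "f \<in> hcarrier bergman"
  shows "bergman_shift f \<in> hcarrier bergman"
proof -
  have h: "bergman_shift f holomorphic_on disc"
    unfolding bergman_shift_def by (intro holomorphic_intros bergman_holomorphic f)
  have "set_integrable lborel disc (\<lambda>z. (cmod (bergman_shift f z))\<^sup>2)"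
    unfolding set_integrable_def
  proof (rule Bochner_Integration.integrable_bound)
    show "integrable lborel (\<lambda>z. indicator disc z *\<^sub>R (cmod (f z))\<^sup>2)"
      using f by (simp add: bergman_def set_integrable_def)
    show "(\<lambda>z. indicator disc z *\<^sub>R (cmod (bergman_shift f z))\<^sup>2) \<in> borel_measurable lborel"
      using h by (rule disc_norm_sq_measurable)
    have "cmod (bergman_shift f z) \<le> cmod (f z)" if "z \<in> disc" for z
      using that by (simp add: bergman_shift_def norm_mult mult_left_le_one_le)
    then show "AE z in lborel. norm (indicator disc z *\<^sub>R (cmod (bergman_shift f z))\<^sup>2)
        \<le> norm (indicator disc z *\<^sub>R (cmod (f z))\<^sup>2)"
      by (intro AE_I2) (auto simp: indicator_def power_mono)
  qed
  then show ?thesis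
    using f h unfolding bergman_def by (simp add: bergman_shift_def)
qed

text \<open>The weight is the quotient of the normalizations at j - 1 and j;
  \<open>hardy2_ip_mult_z_E_fun\<close> produces the same one.\<close>

lemma bergman_coeff_shift:
  assumes f: "f \<in> hcarrier bergman"
  shows "bergman_coeff (bergman_shift f) j =
    (case j of 0 \<Rightarrow> 0 | Suc k \<Rightarrow> of_real (sqrt (real j / real (Suc j))) * bergman_coeff f k)"
  unfolding bergman_coeff_def bergman_shift_def taylor_coeff_shift[OF bergman_holomorphic[OF f]]
  by (simp add: real_sqrt_divide del: of_nat_Suc split: nat.split)

section \<open>Multiplication by an inner function\<close>

lemma circle_mean_norm_sq:
  assumes f: "f holomorphic_on disc" and r: "r \<in> {0..<1}"
  shows "Re (circle_mean r (\<lambda>z. of_real ((cmod (f z))\<^sup>2))) =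
      (LINT t:{0..2*pi}|lborel. (cmod (f (of_real r * cis t)))\<^sup>2) / (2 * pi)"
    and "set_integrable lborel {0..2*pi} (\<lambda>t. (cmod (f (of_real r * cis t)))\<^sup>2)"
proof -
  have "continuous_on {0..2*pi} (\<lambda>t. f (of_real r * cis t))"
    by (rule continuous_on_compose2[OF holomorphic_on_imp_continuous_on[OF f]])
       (use r in \<open>auto intro!: continuous_intros simp: norm_mult\<close>)
  then show "set_integrable lborel {0..2*pi} (\<lambda>t. (cmod (f (of_real r * cis t)))\<^sup>2)"
    by (intro borel_integrable_atLeastAtMost' continuous_intros)
  have "circle_mean r (\<lambda>z. of_real ((cmod (f z))\<^sup>2)) =
      of_real ((LINT t:{0..2*pi}|lborel. (cmod (f (of_real r * cis t)))\<^sup>2) / (2 * pi))"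
    by (simp only: circle_mean_def set_integral_complex_of_real) simp
  then show "Re (circle_mean r (\<lambda>z. of_real ((cmod (f z))\<^sup>2))) =
      (LINT t:{0..2*pi}|lborel. (cmod (f (of_real r * cis t)))\<^sup>2) / (2 * pi)"
    by (simp only: Re_complex_of_real)
qed

lemma circle_mean_norm_sq_tendsto:
  assumes f: "f \<in> hcarrier hardy"
  shows "((\<lambda>r. Re (circle_mean r (\<lambda>z. of_real ((cmod (f z))\<^sup>2)))) \<longlongrightarrow> (hnorm hardy f)\<^sup>2) (at_left 1)"
  using tendsto_Re[OF circle_mean_tendsto(1)[OF f f]] hardy.norm_sq[OF f]
  unfolding hinner_hardy hardy_ip_coeff[OF f f] cmod_sq by simp

text \<open>The pointwise bound is integrated over each circle; bounded means give membership, and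
  their limits the norm estimate.\<close>

lemma hardy_mult_bounded:
  assumes g: "g holomorphic_on disc" and C: "\<And>z. z \<in> disc \<Longrightarrow> cmod (g z) \<le> C"
    and f: "f \<in> hcarrier hardy"
  shows "(\<lambda>w. g w * f w) \<in> hcarrier hardy"
    and "hnorm hardy (\<lambda>w. g w * f w) \<le> C * hnorm hardy f"
proof -
  let ?h = "\<lambda>w. g w * f w"
  have C0: "0 \<le> C" using order_trans[OF norm_ge_zero C[of 0]] by simp
  have fh: "f holomorphic_on disc" by (rule hardy_holomorphic[OF f])
  have hh: "?h holomorphic_on disc" by (intro holomorphic_intros g fh)
  have le: "Re (circle_mean r (\<lambda>z. of_real ((cmod (?h z))\<^sup>2))) \<le>
      C\<^sup>2 * Re (circle_mean r (\<lambda>z. of_real ((cmod (f z))\<^sup>2)))" if r: "r \<in> {0..<1}" for r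
  proof -
    have "(LINT t:{0..2*pi}|lborel. (cmod (?h (of_real r * cis t)))\<^sup>2) \<le>
        (LINT t:{0..2*pi}|lborel. C\<^sup>2 * (cmod (f (of_real r * cis t)))\<^sup>2)"
    proof (rule set_integral_mono)
      show "set_integrable lborel {0..2*pi} (\<lambda>t. (cmod (?h (of_real r * cis t)))\<^sup>2)"
        by (rule circle_mean_norm_sq(2)[OF hh r])
      show "set_integrable lborel {0..2*pi} (\<lambda>t. C\<^sup>2 * (cmod (f (of_real r * cis t)))\<^sup>2)"
        by (intro set_integrable_mult_right circle_mean_norm_sq(2)[OF fh r])
      fix t :: real
      have "of_real r * cis t \<in> disc" using r by (simp add: norm_mult)
      then show "(cmod (?h (of_real r * cis t)))\<^sup>2 \<le> C\<^sup>2 * (cmod (f (of_real r * cis t)))\<^sup>2"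
        unfolding norm_mult power_mult_distrib by (intro mult_right_mono power_mono C) auto
    qed
    then show ?thesis
      unfolding circle_mean_norm_sq(1)[OF hh r] circle_mean_norm_sq(1)[OF fh r]
      by (simp add: divide_right_mono)
  qed
  have "\<exists>B. \<forall>r\<in>{0..<1}. Re (circle_mean r (\<lambda>z. of_real ((cmod (f z))\<^sup>2))) \<le> B"
    using f by (simp add: hardy_def)
  then obtain B where B: "\<And>r. r \<in> {0..<1} \<Longrightarrow> Re (circle_mean r (\<lambda>z. of_real ((cmod (f z))\<^sup>2))) \<le> B"
    by blast
  have "Re (circle_mean r (\<lambda>z. of_real ((cmod (?h z))\<^sup>2))) \<le> C\<^sup>2 * B" if r: "r \<in> {0..<1}" for r
    using le[OF r] mult_left_mono[OF B[OF r], of "C\<^sup>2"] by simp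
  then have "\<exists>B. \<forall>r\<in>{0..<1}. Re (circle_mean r (\<lambda>z. of_real ((cmod (?h z))\<^sup>2))) \<le> B"
    by blast
  then show h: "?h \<in> hcarrier hardy"
    using hh hardy_zero_off[OF f] by (simp add: hardy_def)
  have "(hnorm hardy ?h)\<^sup>2 \<le> C\<^sup>2 * (hnorm hardy f)\<^sup>2"
  proof (rule tendsto_le)
    show "((\<lambda>r. C\<^sup>2 * Re (circle_mean r (\<lambda>z. of_real ((cmod (f z))\<^sup>2)))) \<longlongrightarrow> C\<^sup>2 * (hnorm hardy f)\<^sup>2) (at_left 1)"
      by (intro tendsto_mult tendsto_const circle_mean_norm_sq_tendsto f)
    show "((\<lambda>r. Re (circle_mean r (\<lambda>z. of_real ((cmod (?h z))\<^sup>2)))) \<longlongrightarrow> (hnorm hardy ?h)\<^sup>2) (at_left 1)"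
      by (rule circle_mean_norm_sq_tendsto[OF h])
    note eventually_at_left_1
    then show "\<forall>\<^sub>F r in at_left 1. Re (circle_mean r (\<lambda>z. of_real ((cmod (?h z))\<^sup>2))) \<le>
        C\<^sup>2 * Re (circle_mean r (\<lambda>z. of_real ((cmod (f z))\<^sup>2)))"
      by eventually_elim (rule le)
  qed simp
  then have "(hnorm hardy ?h)\<^sup>2 \<le> (C * hnorm hardy f)\<^sup>2" by (simp add: power_mult_distrib)
  then show "hnorm hardy ?h \<le> C * hnorm hardy f"
    by (rule power2_le_imp_le) (use C0 hardy.norm_nonneg[OF f] in simp)
qed

lemma hardy_norm_triangle:
  assumes f: "f \<in> hcarrier hardy" and g: "g \<in> hcarrier hardy"
  shows "hnorm hardy f \<le> hnorm hardy g + hnorm hardy (\<lambda>x. f x - g x)"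
  using hardy.norm_add_le[OF g Hc.S_diff[OF f g]] by simp

locale nonconstant_inner =
  fixes \<phi> :: "complex \<Rightarrow> complex"
  assumes inner: "inner_function \<phi>" and nonconstant: "\<not> \<phi> constant_on disc"
begin

abbreviation mul :: "(complex \<Rightarrow> complex) \<Rightarrow> complex \<Rightarrow> complex" where
  "mul f \<equiv> (\<lambda>w. \<phi> w * f w)"

lemma holomorphic: "\<phi> holomorphic_on disc"
  using inner by (simp add: inner_function_def)

lemma bounded_on_disc: obtains C where "\<And>z. z \<in> disc \<Longrightarrow> cmod (\<phi> z) \<le> C"
proof -
  obtain C where "\<forall>x\<in>\<phi> ` disc. cmod x \<le> C"
    using inner unfolding inner_function_def bounded_iff by blast
  then show thesis using that by blast
qed

lemma mul_closed: "f \<in> hcarrier hardy \<Longrightarrow> mul f \<in> hcarrier hardy"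
  by (metis bounded_on_disc hardy_mult_bounded(1) holomorphic)

text \<open>For bounded \<open>f\<close> dominated convergence applies to \<open>|f|\<^sup>2 (|\<phi>|\<^sup>2 - 1)\<close> on circles.\<close>

lemma norm_mul_bounded:
  assumes f: "f \<in> hcarrier hardy" and K: "\<And>z. z \<in> disc \<Longrightarrow> cmod (f z) \<le> K"
  shows "hnorm hardy (mul f) = hnorm hardy f"
proof -
  obtain C where C: "\<And>z. z \<in> disc \<Longrightarrow> cmod (\<phi> z) \<le> C" using bounded_on_disc by blast
  have fh: "f holomorphic_on disc" by (rule hardy_holomorphic[OF f])
  have mh: "mul f holomorphic_on disc" by (rule hardy_holomorphic[OF mul_closed[OF f]])
  \<comment> \<open>Dominated convergence runs along sequences, so 1 is approached from the left
    through 1 - 1 / (n + 2).\<close>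
  define r where "r n = 1 - inverse (real (Suc (Suc n)))" for n
  have r: "r n \<in> {0..<1}" for n by (simp add: r_def field_simps)
  have r_lim: "r \<longlonglongrightarrow> 1"
    unfolding r_def using tendsto_diff[OF tendsto_const LIMSEQ_Suc[OF LIMSEQ_inverse_real_of_nat], of 1] by simp
  have r_left: "filterlim r (at_left 1) sequentially"
    unfolding filterlim_at using r r_lim by (auto intro!: always_eventually simp: less_imp_neq)
  let ?c = "\<lambda>n t. of_real (r n) * cis t :: complex"
  have in_disc: "?c n t \<in> disc" for n t using r[of n] by (simp add: norm_mult)
  define s where "s n t = indicator {0..2*pi} t *\<^sub>R ((cmod (mul f (?c n t)))\<^sup>2 - (cmod (f (?c n t)))\<^sup>2)" for n t
  let ?A = "\<lambda>h n. LINT t:{0..2*pi}|lborel. (cmod (h (?c n t)))\<^sup>2"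
  have int_s: "(\<integral>t. s n t \<partial>lborel) = 2 * pi * (Re (circle_mean (r n) (\<lambda>z. of_real ((cmod (mul f z))\<^sup>2)))
      - Re (circle_mean (r n) (\<lambda>z. of_real ((cmod (f z))\<^sup>2))))" for n
  proof -
    have "(\<integral>t. s n t \<partial>lborel) = ?A (mul f) n - ?A f n"
      using set_integral_diff(2)[OF circle_mean_norm_sq(2)[OF mh r] circle_mean_norm_sq(2)[OF fh r], of n n]
      by (simp add: s_def set_lebesgue_integral_def)
    also have "\<dots> = 2 * pi * (?A (mul f) n / (2 * pi) - ?A f n / (2 * pi))"
      unfolding right_diff_distrib by simp
    finally show ?thesis
      unfolding circle_mean_norm_sq(1)[OF mh r] circle_mean_norm_sq(1)[OF fh r] .
  qed
  have int_s': "integrable lborel (s n)" for n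
    using set_integral_diff(1)[OF circle_mean_norm_sq(2)[OF mh r] circle_mean_norm_sq(2)[OF fh r], of n n]
    by (simp add: s_def[abs_def] set_integrable_def)
  have "(\<lambda>n. \<integral>t. s n t \<partial>lborel) \<longlonglongrightarrow> (\<integral>t. 0 \<partial>(lborel :: real measure))"
  proof (rule integral_dominated_convergence[where w = "\<lambda>t. indicator {0..2*pi} t *\<^sub>R ((C * K)\<^sup>2 + K\<^sup>2)"])
    show "s n \<in> borel_measurable lborel" for n using int_s' by (rule borel_measurable_integrable)
    show "integrable lborel (\<lambda>t::real. indicator {0..2*pi} t *\<^sub>R ((C * K)\<^sup>2 + K\<^sup>2))"
      using borel_integrable_atLeastAtMost'[of 0 "2*pi" "\<lambda>_. (C * K)\<^sup>2 + K\<^sup>2"] by (simp add: set_integrable_def)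
    show "AE t in lborel. norm (s n t) \<le> indicator {0..2*pi} t *\<^sub>R ((C * K)\<^sup>2 + K\<^sup>2)" for n
    proof (rule AE_I2)
      fix t :: real
      have a: "(cmod (f (?c n t)))\<^sup>2 \<le> K\<^sup>2" by (intro power_mono K in_disc) auto
      have "cmod (mul f (?c n t)) \<le> C * K"
        unfolding norm_mult by (intro mult_mono C K in_disc) (auto intro: order_trans[OF norm_ge_zero C[OF in_disc]])
      then have b: "(cmod (mul f (?c n t)))\<^sup>2 \<le> (C * K)\<^sup>2" by (intro power_mono) auto
      have "\<bar>(cmod (mul f (?c n t)))\<^sup>2 - (cmod (f (?c n t)))\<^sup>2\<bar> \<le> (C * K)\<^sup>2 + K\<^sup>2"
        using a b zero_le_power2[of "cmod (f (?c n t))"] zero_le_power2[of "cmod (mul f (?c n t))"]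
        by linarith
      then show "norm (s n t) \<le> indicator {0..2*pi} t *\<^sub>R ((C * K)\<^sup>2 + K\<^sup>2)"
        by (simp add: s_def indicator_def)
    qed
    \<comment> \<open>Radial limits of \<phi> have modulus 1 almost everywhere, so |\<phi>|^2 - 1
      tends to 0; f enters only through its bound K.\<close>
    have "AE t in lborel. \<exists>l. ((\<lambda>r. \<phi> (of_real r * cis t)) \<longlongrightarrow> l) (at_left 1) \<and> cmod l = 1"
      using inner by (simp add: inner_function_def)
    then show "AE t in lborel. (\<lambda>n. s n t) \<longlonglongrightarrow> 0"
    proof eventually_elim
      case (elim t)
      then obtain l where l: "((\<lambda>r. \<phi> (of_real r * cis t)) \<longlongrightarrow> l) (at_left 1)" "cmod l = 1" by blast
      have "(\<lambda>n. \<phi> (?c n t)) \<longlonglongrightarrow> l" by (rule filterlim_compose[OF l(1) r_left])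
      then have "(\<lambda>n. K\<^sup>2 * \<bar>(cmod (\<phi> (?c n t)))\<^sup>2 - 1\<bar>) \<longlonglongrightarrow> K\<^sup>2 * \<bar>(cmod l)\<^sup>2 - 1\<bar>"
        by (intro tendsto_intros)
      then have z: "(\<lambda>n. K\<^sup>2 * \<bar>(cmod (\<phi> (?c n t)))\<^sup>2 - 1\<bar>) \<longlonglongrightarrow> 0" by (simp add: l(2))
      have "norm (s n t) \<le> K\<^sup>2 * \<bar>(cmod (\<phi> (?c n t)))\<^sup>2 - 1\<bar>" for n
      proof -
        have "norm (s n t) \<le> \<bar>(cmod (f (?c n t)))\<^sup>2 * ((cmod (\<phi> (?c n t)))\<^sup>2 - 1)\<bar>"
          by (simp add: s_def indicator_def norm_mult power_mult_distrib algebra_simps)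
        also have "\<dots> \<le> K\<^sup>2 * \<bar>(cmod (\<phi> (?c n t)))\<^sup>2 - 1\<bar>"
          unfolding abs_mult by (intro mult_right_mono) (auto intro!: power_mono K in_disc)
        finally show ?thesis .
      qed
      then show ?case by (intro Lim_null_comparison[OF _ z] always_eventually) auto
    qed
  qed auto
  then have "(\<lambda>n. 2 * pi * (Re (circle_mean (r n) (\<lambda>z. of_real ((cmod (mul f z))\<^sup>2)))
      - Re (circle_mean (r n) (\<lambda>z. of_real ((cmod (f z))\<^sup>2))))) \<longlonglongrightarrow> 0"
    unfolding int_s by simp
  moreover have "(\<lambda>n. 2 * pi * (Re (circle_mean (r n) (\<lambda>z. of_real ((cmod (mul f z))\<^sup>2)))
      - Re (circle_mean (r n) (\<lambda>z. of_real ((cmod (f z))\<^sup>2))))) \<longlonglongrightarrow>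
      2 * pi * ((hnorm hardy (mul f))\<^sup>2 - (hnorm hardy f)\<^sup>2)"
    by (intro tendsto_mult tendsto_const tendsto_diff
        filterlim_compose[OF circle_mean_norm_sq_tendsto[OF f] r_left]
        filterlim_compose[OF circle_mean_norm_sq_tendsto[OF mul_closed[OF f]] r_left])
  ultimately have "2 * pi * ((hnorm hardy (mul f))\<^sup>2 - (hnorm hardy f)\<^sup>2) = 0"
    using LIMSEQ_unique by blast
  then show ?thesis
    using hardy.norm_nonneg[OF f] hardy.norm_nonneg[OF mul_closed[OF f]]
    by (simp add: power2_eq_iff_nonneg)
qed

text \<open>Polynomials are bounded on the disc, so \<open>norm_mul_bounded\<close> covers the
  partial sums \<open>p n\<close>, and both norms are continuous in f. C is just some bound of
  \<phi>; that 1 is a bound is deduced later from this isometry.\<close>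

lemma norm_mul:
  assumes f: "f \<in> hcarrier hardy"
  shows "hnorm hardy (mul f) = hnorm hardy f"
proof -
  obtain C where C: "\<And>z. z \<in> disc \<Longrightarrow> cmod (\<phi> z) \<le> C" using bounded_on_disc by blast
  define p where "p = hardy.psum UNIV (\<lambda>i. hinner hardy f (hmonom i)) hmonom"
  have p: "p n \<in> hcarrier hardy" for n
    unfolding p_def by (rule hardy.psum_closed[OF hmonom_basis(1)])
  have lim: "(\<lambda>n. hnorm hardy (\<lambda>x. p n x - f x)) \<longlonglongrightarrow> 0"
    using complex_hilbert_space.basis_expansion[OF hardy_hilbert hmonom_basis f]
    unfolding p_def by simp
  have "\<exists>K. \<forall>z. cmod (hardy.psum UNIV a hmonom n z) \<le> K" for a n
  proof (induction n)
    case (Suc n)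
    then obtain K where K: "\<And>z. cmod (hardy.psum UNIV a hmonom n z) \<le> K" by blast
    have "cmod (hmonom n z) \<le> 1" for z
      by (simp add: hmonom_def zero_off_def norm_power power_le_one)
    then have "cmod (a n * hmonom n z + hardy.psum UNIV a hmonom n z) \<le> cmod (a n) * 1 + K" for z
      by (intro norm_triangle_le add_mono K) (simp add: norm_mult mult_left_le)
    then show ?case by auto
  qed (auto intro: exI[of _ 0])
  then have pn: "hnorm hardy (mul (p n)) = hnorm hardy (p n)" for n
    using norm_mul_bounded[OF p] unfolding p_def by blast
  have "\<bar>hnorm hardy (mul f) - hnorm hardy f\<bar> \<le> (C + 1) * hnorm hardy (\<lambda>x. p n x - f x)" for n
  proof -
    have d: "(\<lambda>x. p n x - f x) \<in> hcarrier hardy" by (rule Hc.S_diff[OF p f])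
    have "(\<lambda>x. mul (p n) x - mul f x) = mul (\<lambda>x. p n x - f x)"
      by (simp add: algebra_simps)
    then have m: "hnorm hardy (\<lambda>x. mul (p n) x - mul f x) \<le> C * hnorm hardy (\<lambda>x. p n x - f x)"
      using hardy_mult_bounded(2)[OF holomorphic C d] by simp
    show ?thesis
      using m pn[of n] hardy_norm_triangle[OF mul_closed[OF f] mul_closed[OF p[of n]]]
        hardy_norm_triangle[OF mul_closed[OF p[of n]] mul_closed[OF f]]
        hardy_norm_triangle[OF f p[of n]] hardy_norm_triangle[OF p[of n] f]
        hardy.norm_diff_commute[OF f p[of n]]
        hardy.norm_diff_commute[OF mul_closed[OF f] mul_closed[OF p[of n]]]
      by (simp add: distrib_right abs_le_iff)
  qed
  then have "\<bar>hnorm hardy (mul f) - hnorm hardy f\<bar> \<le> (C + 1) * 0"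
    by (intro tendsto_lowerbound[OF tendsto_mult[OF tendsto_const lim]]) auto
  then show ?thesis by simp
qed

lemma mul_add: "mul (\<lambda>w. f w + g w) = (\<lambda>w. mul f w + mul g w)"
  by (simp add: distrib_left)

lemma mul_scale: "mul (\<lambda>w. c * f w) = (\<lambda>w. c * mul f w)"
  by (simp add: mult.left_commute)

lemma ip_mul:
  assumes f: "f \<in> hcarrier hardy" and g: "g \<in> hcarrier hardy"
  shows "hardy_ip (mul f) (mul g) = hardy_ip f g"
proof -
  have "hnorm hardy (\<lambda>w. mul f w + \<i> ^ k * mul g w) = hnorm hardy (\<lambda>w. f w + \<i> ^ k * g w)" for k :: nat
    using norm_mul[OF Hc.S_add[OF f Hc.S_scale[OF g]], of "\<i> ^ k"]
    by (simp add: distrib_left mult.left_commute)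
  then show ?thesis
    using hardy.inner_polarization[OF f g] hardy.inner_polarization[OF mul_closed[OF f] mul_closed[OF g]]
    by (simp add: hinner_hardy)
qed

lemma mulpow_closed: "f \<in> hcarrier hardy \<Longrightarrow> (\<lambda>w. \<phi> w ^ n * f w) \<in> hcarrier hardy"
proof (induction n)
  case (Suc n)
  from mul_closed[OF Suc.IH[OF Suc.prems]] show ?case by (simp add: mult.assoc)
qed simp

lemma norm_mulpow: "f \<in> hcarrier hardy \<Longrightarrow> hnorm hardy (\<lambda>w. \<phi> w ^ n * f w) = hnorm hardy f"
proof (induction n)
  case (Suc n)
  with norm_mul[OF mulpow_closed[OF Suc.prems, of n]] show ?case by (simp add: mult.assoc)
qed simp

text \<open>The powers \<phi>^n all have the norm of the constant function 1, so point evaluation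
  keeps |\<phi>(z)|^n bounded in n.\<close>

lemma le_one:
  assumes z: "z \<in> disc"
  shows "cmod (\<phi> z) \<le> 1"
proof (rule ccontr)
  let ?K = "hnorm hardy (hmonom 0) / sqrt (1 - (cmod z)\<^sup>2)"
  assume "\<not> ?thesis"
  then obtain n where n: "?K < cmod (\<phi> z) ^ n"
    using real_arch_pow[of "cmod (\<phi> z)" ?K] by auto
  have "cmod (\<phi> z ^ n * hmonom 0 z) \<le> hnorm hardy (\<lambda>w. \<phi> w ^ n * hmonom 0 w) / sqrt (1 - (cmod z)\<^sup>2)"
    by (rule hardy_pointwise_bound[OF mulpow_closed[OF hmonom_hardy]]) (use z in auto)
  then show False
    using n z by (simp add: norm_mulpow[OF hmonom_hardy] norm_power norm_mult) (simp add: hmonom_def zero_off_def)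
qed

text \<open>Maximum modulus principle; here \<phi> being non-constant is used.\<close>

lemma less_one:
  assumes z: "z \<in> disc"
  shows "cmod (\<phi> z) < 1"
proof (rule ccontr)
  assume "\<not> ?thesis"
  then have "cmod (\<phi> w) \<le> cmod (\<phi> z)" if "w \<in> disc" for w
    using le_one[OF that] by simp
  then have "\<phi> constant_on disc"
    using maximum_modulus_principle[OF holomorphic open_ball connected_ball open_ball subset_refl z] by blast
  with nonconstant show False ..
qed

text \<open>By isometry all \<open>f n\<close> share the norm of \<open>f 0\<close>, so their values
  at z have one bound B, while the factor \<phi>(z)^n in front of them tends to 0.\<close>

lemma zero_if_infinitely_divisible:
  assumes f: "\<And>n. f n \<in> hcarrier hardy" and step: "\<And>n. f n = mul (f (Suc n))"
  shows "f 0 = (\<lambda>_. 0)"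
proof
  fix z
  show "f 0 z = 0"
  proof (cases "z \<in> disc")
    case True
    have f0: "f 0 = (\<lambda>w. \<phi> w ^ n * f n w)" for n
    proof (induction n)
      case (Suc n)
      then show ?case using fun_cong[OF step[of n]] by (simp add: mult.left_commute mult.assoc)
    qed simp
    define B where "B = hnorm hardy (f 0) / sqrt (1 - (cmod z)\<^sup>2)"
    have "cmod (f 0 z) \<le> cmod (\<phi> z) ^ n * B" for n
    proof -
      have "hnorm hardy (f n) = hnorm hardy (f 0)"
        using norm_mulpow[OF f[of n], of n] f0[of n] by simp
      moreover have "cmod (f n z) \<le> hnorm hardy (f n) / sqrt (1 - (cmod z)\<^sup>2)"
        by (rule hardy_pointwise_bound[OF f]) (use True in auto)
      ultimately have "cmod (f n z) \<le> B" by (simp add: B_def)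
      then have "cmod (\<phi> z) ^ n * cmod (f n z) \<le> cmod (\<phi> z) ^ n * B" by (rule mult_left_mono) simp
      then show ?thesis using fun_cong[OF f0[of n], of z] by (simp add: norm_mult norm_power)
    qed
    moreover have "(\<lambda>n. cmod (\<phi> z) ^ n * B) \<longlonglongrightarrow> 0 * B"
      using less_one[OF True] by (intro tendsto_mult tendsto_const LIMSEQ_power_zero) simp
    ultimately have "cmod (f 0 z) \<le> 0 * B"
      by (intro tendsto_lowerbound[where f = "\<lambda>n. cmod (\<phi> z) ^ n * B" and F = sequentially]) auto
    then show ?thesis by simp
  qed (rule hardy_zero_off[OF f])
qed

section \<open>The model space and its orthogonal complement\<close>

abbreviation K :: "(complex \<Rightarrow> complex) cspace" where
  "K \<equiv> model_space \<phi>"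

lemma model_space_eq: "K = hardy \<ominus> (mul ` hcarrier hardy)"
  unfolding model_space_def by (rule arg_cong[where f = "(\<ominus>) hardy"]) auto

lemma model_space_simps:
  "hcarrier K = {f \<in> hcarrier hardy. \<forall>g\<in>hcarrier hardy. hardy_ip f (mul g) = 0}"
  "hinner K = hardy_ip" "hnorm K = hnorm hardy"
  "hzero K = hzero hardy" "hadd K = hadd hardy" "hscale K = hscale hardy"
  unfolding model_space_eq by (auto simp: hinner_hardy)

lemma model_space_pre_hilbert: "pre_hilbert_space K"
  unfolding model_space_eq
  by (rule pre_hilbert_ominus[OF hardy.pre_hilbert_space_axioms]) (auto intro: mul_closed)

lemma hardy_functional_zero:
  assumes add: "\<And>x y. x \<in> hcarrier hardy \<Longrightarrow> y \<in> hcarrier hardy \<Longrightarrow> F (\<lambda>w. x w + y w) = F x + F y"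
    and scale: "\<And>c x. x \<in> hcarrier hardy \<Longrightarrow> F (\<lambda>w. c * x w) = c * F x"
    and bound: "\<And>x. x \<in> hcarrier hardy \<Longrightarrow> cmod (F x) \<le> C * hnorm hardy x"
    and zero: "\<And>n. F (hmonom n) = 0" and x: "x \<in> hcarrier hardy"
  shows "F x = 0"
  by (rule hardy.functional_zero_on_closure[where S = "range hmonom" and F = F and C = C])
     (use assms hmonom_hardy complex_hilbert_space.closure_span_basis[OF hardy_hilbert hmonom_basis] in auto)

text \<open>Since multiplication by \<open>\<phi>\<close> is isometric, the functions \<open>\<phi> w\<^sup>n\<close> are an orthonormal basis of
  \<open>\<phi> H\<^sup>2\<close>, and the projection onto \<open>\<phi> H\<^sup>2\<close> can be written down.\<close>

lemma orthogonal_model_space_factor: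
  assumes g: "g \<in> hcarrier hardy" and orth: "\<And>k. k \<in> hcarrier K \<Longrightarrow> hardy_ip g k = 0"
  obtains h where "h \<in> hcarrier hardy" "g = mul h"
proof -
  have o: "hardy.orthonormal UNIV (\<lambda>n. mul (hmonom n))"
    using hmonom_basis(1) by (simp add: hardy.orthonormal_def mul_closed hinner_hardy ip_mul)
  \<comment> \<open>Coefficients of g along the orthonormal system \<phi> w^n; taken as Taylor
    coefficients of h they make \<phi> h the projection of g.\<close>
  define a where "a n = hardy_ip g (mul (hmonom n))" for n
  have "summable (\<lambda>n. (cmod (a n))\<^sup>2)"
    using hardy.bessel_summable[OF o g] by (simp add: a_def hinner_hardy)
  then have "square_summable a"
    unfolding square_summable_def by (rule summable_nonneg_imp_summable_on) simp
  then obtain h where h: "h \<in> hcarrier hardy" "\<And>n. taylor_coeff h n = a n"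
    using hardy_from_coeff by metis
  define d where "d = (\<lambda>x. g x - mul h x)"
  have mh: "mul h \<in> hcarrier hardy" by (rule mul_closed[OF h(1)])
  have d: "d \<in> hcarrier hardy" unfolding d_def by (rule Hc.S_diff[OF g mh])
  have d_ip: "hardy_ip d u = hardy_ip g u - hardy_ip (mul h) u" if "u \<in> hcarrier hardy" for u
    using hardy.inner_diff[OF g mh that] by (simp add: d_def hinner_hardy)
  have "hardy_ip (mul u) d = 0" if u: "u \<in> hcarrier hardy" for u
  proof (rule hardy_functional_zero[where F = "\<lambda>u. hardy_ip (mul u) d", OF _ _ _ _ u])
    show "hardy_ip (mul (\<lambda>w. x w + y w)) d = hardy_ip (mul x) d + hardy_ip (mul y) d"
      if "x \<in> hcarrier hardy" "y \<in> hcarrier hardy" for x y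
      using hardy.inner_add[OF mul_closed[OF that(1)] mul_closed[OF that(2)] d]
      by (simp add: mul_add hinner_hardy)
    show "hardy_ip (mul (\<lambda>w. c * x w)) d = c * hardy_ip (mul x) d" if "x \<in> hcarrier hardy" for c x
      using hardy.inner_scale[OF mul_closed[OF that] d, of c] by (simp add: mul_scale hinner_hardy)
    show "cmod (hardy_ip (mul x) d) \<le> hnorm hardy d * hnorm hardy x" if "x \<in> hcarrier hardy" for x
      using hardy.cauchy_schwarz[OF mul_closed[OF that] d] norm_mul[OF that]
      by (simp add: hinner_hardy mult.commute)
    show "hardy_ip (mul (hmonom n)) d = 0" for n
    proof -
      have "hardy_ip d (mul (hmonom n)) = 0"
        using d_ip[OF mul_closed[OF hmonom_hardy]] ip_mul[OF h(1) hmonom_hardy] hardy_ip_hmonom[OF h(1)] h(2)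
        by (simp add: a_def)
      then show ?thesis
        using hardy.inner_cnj[OF d mul_closed[OF hmonom_hardy[of n]]] by (simp add: hinner_hardy)
    qed
  qed
  then have dm: "hardy_ip d (mul u) = 0" if "u \<in> hcarrier hardy" for u
    using hardy.inner_cnj[OF mul_closed[OF that] d] that by (simp add: hinner_hardy)
  \<comment> \<open>As an element of K, d is orthogonal to g by hypothesis; it is orthogonal to
    \<phi> h by construction, hence to itself.\<close>
  then have "d \<in> hcarrier K" using d by (simp add: model_space_simps)
  then have "hardy_ip g d = 0" by (rule orth)
  moreover have "hardy_ip (mul h) d = 0"
    using dm[OF h(1)] hardy.inner_cnj[OF d mh] by (simp add: hinner_hardy)
  ultimately have "hardy_ip d d = 0" using d_ip[OF d] by simp
  then have "d = (\<lambda>_. 0)" using hardy.inner_definite[OF d] by (simp add: hinner_hardy)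
  then have "g = mul h" unfolding d_def by (simp add: fun_eq_iff)
  with h(1) that show thesis by blast
qed

end

section \<open>The space \<open>N\<close>\<close>

definition mult_z :: "(complex \<times> complex \<Rightarrow> complex) \<Rightarrow> complex \<times> complex \<Rightarrow> complex" where
  "mult_z f = (\<lambda>(z, w). z * f (z, w))"

lemma hardy_ip_zero:
  assumes "f \<in> hcarrier hardy"
  shows "hardy_ip f (\<lambda>_. 0) = 0" "hardy_ip (\<lambda>_. 0) f = 0"
  using hardy.inner_zero_right[OF assms] hardy.inner_zero[OF assms] by (simp_all add: hinner_hardy)

lemma mult_z_holomorphic: "holomorphic_bidisc f \<Longrightarrow> holomorphic_bidisc (mult_z f)"
  using holomorphic_bidisc_mult[OF holomorphic_bidisc_fst_coordinate, of f]
  by (simp add: mult_z_def case_prod_unfold)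

lemma slice_norm_summable:
  assumes "f \<in> hcarrier hardy2"
  shows "(\<lambda>i. (hnorm hardy (slice_coeff f i))\<^sup>2) summable_on UNIV"
  using summable_on_Re[OF has_sum_imp_summable[OF hardy2_ip_slices[OF assms assms]]]
  by (simp add: hardy.norm_sq[OF slice_coeff_hardy[OF assms]] hinner_hardy)

text \<open>Membership follows by reassembling z f from its slices, whose norms are those of f with
  a 0 in front.\<close>

lemma mult_z_hardy2:
  assumes f: "f \<in> hcarrier hardy2"
  shows "mult_z f \<in> hcarrier hardy2"
    and "slice_coeff (mult_z f) i = (case i of 0 \<Rightarrow> \<lambda>_. 0 | Suc k \<Rightarrow> slice_coeff f k)"
proof -
  note h = hardy2_holomorphic[OF f]
  have zero: "mult_z f p = 0" if "p \<notin> disc \<times> disc" for p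
    using hardy2_zero_off[OF f that] by (simp add: mult_z_def case_prod_unfold)
  show slice: "slice_coeff (mult_z f) i = (case i of 0 \<Rightarrow> \<lambda>_. 0 | Suc k \<Rightarrow> slice_coeff f k)" for i
  proof
    fix w
    show "slice_coeff (mult_z f) i w = (case i of 0 \<Rightarrow> \<lambda>_. 0 | Suc k \<Rightarrow> slice_coeff f k) w"
    proof (cases "w \<in> disc")
      case True
      then show ?thesis
        unfolding mult_z_def using slice_coeff_mult_fst[OF h True, of i] by (simp split: nat.split)
    next
      case False
      then show ?thesis
        using slice_coeff_zero_off[OF zero False] slice_coeff_zero_off[OF hardy2_zero_off[OF f] False]
        by (simp split: nat.split)
    qed
  qed
  let ?g = "slice_coeff (mult_z f)"
  have g: "?g i \<in> hcarrier hardy" for i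
    using slice_coeff_hardy[OF f] Hc.S_zero by (simp add: slice split: nat.split)
  have "summable (\<lambda>i. (hnorm hardy (?g (Suc i)))\<^sup>2)"
    using summable_on_imp_summable[OF slice_norm_summable[OF f]] by (simp add: slice)
  then have "summable (\<lambda>i. (hnorm hardy (?g i))\<^sup>2)"
    by (subst (asm) summable_Suc_iff)
  then have "(\<lambda>i. (hnorm hardy (?g i))\<^sup>2) summable_on UNIV"
    by (intro summable_nonneg_imp_summable_on) auto
  from hardy2_from_slices[OF g this] obtain F where F: "F \<in> hcarrier hardy2"
    "\<And>z w. z \<in> disc \<Longrightarrow> w \<in> disc \<Longrightarrow> (\<lambda>i. ?g i w * z ^ i) sums F (z, w)" by metis
  have "F = mult_z f"
  proof
    fix p
    show "F p = mult_z f p"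
    proof (cases "p \<in> disc \<times> disc")
      case True
      then obtain z w where p: "p = (z, w)" "z \<in> disc" "w \<in> disc" by auto
      show ?thesis
        unfolding p(1)
        using F(2)[OF p(2,3)] slice_coeff_sums[OF mult_z_holomorphic[OF h] p(2,3)] sums_unique2 by blast
    qed (use hardy2_zero_off[OF F(1)] zero in auto)
  qed
  with F(1) show "mult_z f \<in> hcarrier hardy2" by simp
qed

text \<open>The adjoint of multiplication by z is the backward shift of slices: slice 0 of z g
  vanishes, and the remaining sum is reindexed.\<close>

lemma hardy2_ip_mult_z:
  assumes f: "f \<in> hcarrier hardy2" and g: "g \<in> hcarrier hardy2"
  shows "(\<lambda>i. hardy_ip (slice_coeff f (Suc i)) (slice_coeff g i)) sums hardy2_ip f (mult_z g)"
proof -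
  have "(\<lambda>i. hardy_ip (slice_coeff f i) (slice_coeff (mult_z g) i)) sums hardy2_ip f (mult_z g)"
    by (intro has_sum_imp_sums hardy2_ip_slices f mult_z_hardy2(1) g)
  then show ?thesis
    using sums_Suc_iff[of "\<lambda>i. hardy_ip (slice_coeff f i) (slice_coeff (mult_z g) i)" "hardy2_ip f (mult_z g)"]
    by (simp add: mult_z_hardy2(2)[OF g] hardy_ip_zero[OF slice_coeff_hardy[OF f]])
qed

lemma norm_mult_z:
  assumes f: "f \<in> hcarrier hardy2"
  shows "hnorm hardy2 (mult_z f) = hnorm hardy2 f"
proof -
  have "(\<lambda>i. hardy_ip (slice_coeff f i) (slice_coeff f i)) sums hardy2_ip (mult_z f) (mult_z f)"
    using hardy2_ip_mult_z[OF mult_z_hardy2(1)[OF f] f] by (simp add: mult_z_hardy2(2)[OF f])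
  moreover have "(\<lambda>i. hardy_ip (slice_coeff f i) (slice_coeff f i)) sums hardy2_ip f f"
    by (intro has_sum_imp_sums hardy2_ip_slices f)
  ultimately have "hardy2_ip (mult_z f) (mult_z f) = hardy2_ip f f" by (rule sums_unique2)
  then show ?thesis by (simp add: hnorm_def hinner_hardy2)
qed

context nonconstant_inner
begin

definition mult_phi :: "(complex \<times> complex \<Rightarrow> complex) \<Rightarrow> complex \<times> complex \<Rightarrow> complex" where
  "mult_phi f = (\<lambda>(z, w). \<phi> w * f (z, w))"

text \<open>By |\<phi>| \<le> 1 both summands of (z - \<phi>) h remain bounded, so inner products
  with the generators of \<open>M_space\<close> can be split.\<close>

lemma mult_bounded_closed:
  assumes h: "h \<in> hardy2_bounded"
  shows "mult_z h \<in> hardy2_bounded" "mult_phi h \<in> hardy2_bounded"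
proof -
  obtain B where B: "\<And>p. cmod (h p) \<le> B"
    using h by (auto simp: hardy2_bounded_def bounded_iff)
  have hol: "holomorphic_bidisc h" and zero: "\<And>p. p \<notin> disc \<times> disc \<Longrightarrow> h p = 0"
    using h unfolding hardy2_bounded_def by blast+
  have le: "cmod (c * h p) \<le> B" if "p \<in> disc \<times> disc \<Longrightarrow> cmod c \<le> 1" for c p
  proof (cases "p \<in> disc \<times> disc")
    case True
    then show ?thesis
      using mult_mono[OF that[OF True] B[of p]] by (simp add: norm_mult)
  next
    case False
    then show ?thesis using zero[OF False] B[of p] by simp
  qed
  have "cmod (mult_z h p) \<le> B" for p
    using le[of p "fst p"] by (simp add: mult_z_def case_prod_unfold mem_Times_iff)
  then show "mult_z h \<in> hardy2_bounded"
    using mult_z_holomorphic[OF hol] zero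
    by (auto simp: hardy2_bounded_def bounded_iff mult_z_def)
  have "cmod (mult_phi h p) \<le> B" for p
    using le[of p "\<phi> (snd p)"] le_one[of "snd p"] by (simp add: mult_phi_def case_prod_unfold mem_Times_iff)
  moreover have "holomorphic_bidisc (mult_phi h)"
    using holomorphic_bidisc_mult[OF holomorphic_bidisc_of_snd[OF holomorphic] hol]
    by (simp add: mult_phi_def case_prod_unfold)
  ultimately show "mult_phi h \<in> hardy2_bounded"
    using zero by (auto simp: hardy2_bounded_def bounded_iff mult_phi_def)
qed

lemma slice_coeff_mult_phi:
  assumes h: "h \<in> hardy2_bounded"
  shows "slice_coeff (mult_phi h) i = mul (slice_coeff h i)"
proof
  fix w
  have hh: "h \<in> hcarrier hardy2" using h hardy2_bounded_subset by auto
  show "slice_coeff (mult_phi h) i w = \<phi> w * slice_coeff h i w"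
  proof (cases "w \<in> disc")
    case True
    then show ?thesis
      unfolding mult_phi_def by (rule slice_coeff_mult_snd[OF hardy2_holomorphic[OF hh]])
  next
    case False
    have "(\<lambda>z. mult_phi h (z, w)) = (\<lambda>z. 0)" "(\<lambda>z. h (z, w)) = (\<lambda>z. 0)"
      using hardy2_zero_off[OF hh] False by (auto simp: mult_phi_def)
    then show ?thesis
      using slice_coeff_zero_off[of h w i, OF hardy2_zero_off[OF hh] False] by (simp add: slice_coeff_def)
  qed
qed

text \<open>Multiplication by z shifts slices and multiplication by \<phi> acts slice by slice, so a
  generator compares neighbouring slices of f.\<close>

lemma hardy2_ip_generator:
  assumes f: "f \<in> hcarrier hardy2" and h: "h \<in> hardy2_bounded"
  shows "(\<lambda>i. hardy_ip (slice_coeff f (Suc i)) (slice_coeff h i)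
      - hardy_ip (slice_coeff f i) (mul (slice_coeff h i)))
    sums hardy2_ip f (\<lambda>(z, w). (z - \<phi> w) * h (z, w))"
    and "(\<lambda>(z, w). (z - \<phi> w) * h (z, w)) \<in> hcarrier hardy2"
proof -
  have hh: "h \<in> hcarrier hardy2" "mult_z h \<in> hcarrier hardy2" "mult_phi h \<in> hcarrier hardy2"
    using h mult_bounded_closed[OF h] hardy2_bounded_subset by auto
  have eq: "(\<lambda>(z, w). (z - \<phi> w) * h (z, w)) = (\<lambda>p. mult_z h p - mult_phi h p)"
    by (auto simp: mult_z_def mult_phi_def algebra_simps)
  show "(\<lambda>(z, w). (z - \<phi> w) * h (z, w)) \<in> hcarrier hardy2"
    unfolding eq by (rule Hc2.S_diff[OF hh(2,3)])
  have "(\<lambda>i. hardy_ip (slice_coeff f i) (mul (slice_coeff h i))) sums hardy2_ip f (mult_phi h)"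
    using has_sum_imp_sums[OF hardy2_ip_slices[OF f hh(3)]] by (simp add: slice_coeff_mult_phi[OF h])
  from sums_diff[OF hardy2_ip_mult_z[OF f hh(1)] this]
  show "(\<lambda>i. hardy_ip (slice_coeff f (Suc i)) (slice_coeff h i)
      - hardy_ip (slice_coeff f i) (mul (slice_coeff h i)))
    sums hardy2_ip f (\<lambda>(z, w). (z - \<phi> w) * h (z, w))"
    using hardy2.inner_diff_right[OF hh(2,3) f] unfolding eq by (simp add: hinner_hardy2)
qed

text \<open>The test function z^i w^n; its single nonzero slice isolates one index in the series of
  \<open>hardy2_ip_generator\<close>.\<close>

lemma bounded_monomial:
  obtains F where "F \<in> hardy2_bounded" "\<And>j. slice_coeff F j = (if j = i then hmonom n else (\<lambda>_. 0))"
proof -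
  define g where "g j = (if j = i then hmonom n else (\<lambda>_. 0))" for j :: nat
  have g: "g j \<in> hcarrier hardy" for j by (simp add: g_def hmonom_hardy Hc.S_zero)
  have "hnorm hardy (\<lambda>_. 0) = 0"
    using hardy_ip_zero(1)[OF Hc.S_zero] by (simp add: hnorm_def hinner_hardy)
  then have "(\<lambda>j. (hnorm hardy (g j))\<^sup>2) summable_on UNIV"
    by - (rule finite_nonzero_values_imp_summable_on, rule finite_subset[of _ "{i}"], auto simp: g_def)
  then obtain F where F: "F \<in> hcarrier hardy2" "\<And>j. slice_coeff F j = g j"
    "\<And>z w. z \<in> disc \<Longrightarrow> w \<in> disc \<Longrightarrow> (\<lambda>j. g j w * z ^ j) sums F (z, w)"
    by (rule hardy2_from_slices[OF g]) blast
  have "cmod (F p) \<le> 1" for p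
  proof (cases "p \<in> disc \<times> disc")
    case True
    then obtain z w where p: "p = (z, w)" "z \<in> disc" "w \<in> disc" by auto
    have "(\<lambda>j. g j w * z ^ j) = (\<lambda>j. if j = i then w ^ n * z ^ j else 0)"
      using p(3) by (auto simp: g_def hmonom_def zero_off_def)
    then have "F (z, w) = w ^ n * z ^ i"
      using F(3)[OF p(2,3)] sums_single[of i "\<lambda>j. w ^ n * z ^ j"] sums_unique2 by metis
    then show ?thesis
      using p by (simp add: norm_mult norm_power mult_le_one power_le_one)
  next
    case False
    then show ?thesis using hardy2_zero_off[OF F(1)] by simp
  qed
  then have "F \<in> hardy2_bounded"
    using F(1) unfolding hardy2_bounded_def hardy2_carrier_iff bounded_iff by auto
  with F(2) that show thesis by (simp add: g_def)
qed

lemma M_space_subset: "M_space \<phi> \<subseteq> hcarrier hardy2"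
  by (auto simp: M_space_def hclosure_def)

lemma N_space_hilbert: "complex_hilbert_space (N_space \<phi>)"
  unfolding N_space_def by (rule hilbert_ominus[OF hardy2_hilbert M_space_subset])

lemma N_space_subset: "f \<in> hcarrier (N_space \<phi>) \<Longrightarrow> f \<in> hcarrier hardy2"
  by (simp add: N_space_def)

lemma N_space_iff:
  "f \<in> hcarrier (N_space \<phi>) \<longleftrightarrow> f \<in> hcarrier hardy2 \<and>
    (\<forall>i. \<forall>h\<in>hcarrier hardy. hardy_ip (slice_coeff f (Suc i)) h = hardy_ip (slice_coeff f i) (mul h))"
  (is "_ \<longleftrightarrow> _ \<and> ?P")
proof (intro iffI conjI)
  let ?G = "{\<lambda>(z, w). (z - \<phi> w) * h (z, w) | h. h \<in> hardy2_bounded}"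
  have G: "?G \<subseteq> hcarrier hardy2"
    using hardy2_ip_generator(2)[OF Hc2.S_zero] by blast
  {
    assume f: "f \<in> hcarrier (N_space \<phi>)"
    note f2 = N_space_subset[OF f]
    show ?P
    proof (intro allI ballI)
      fix i h assume h: "h \<in> hcarrier hardy"
      note s = slice_coeff_hardy[OF f2]
      \<comment> \<open>Conjugated because the inner product is antilinear in its second slot, while
        the density argument asks for a linear functional.\<close>
      let ?F = "\<lambda>u. cnj (hardy_ip (slice_coeff f (Suc i)) u - hardy_ip (slice_coeff f i) (mul u))"
      have "?F h = 0"
      proof (rule hardy_functional_zero[where F = ?F, OF _ _ _ _ h])
        show "?F (\<lambda>w. x w + y w) = ?F x + ?F y" if "x \<in> hcarrier hardy" "y \<in> hcarrier hardy" for x y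
          using hardy.inner_add_right[OF that s, of "Suc i"]
            hardy.inner_add_right[OF mul_closed[OF that(1)] mul_closed[OF that(2)] s, of i]
          by (simp add: hinner_hardy mul_add)
        show "?F (\<lambda>w. c * x w) = c * ?F x" if "x \<in> hcarrier hardy" for c x
          using hardy.inner_scale_right[OF that s, of "Suc i" c]
            hardy.inner_scale_right[OF mul_closed[OF that] s, of i c]
          by (simp add: hinner_hardy mul_scale right_diff_distrib)
        show "cmod (?F x) \<le> (hnorm hardy (slice_coeff f (Suc i)) + hnorm hardy (slice_coeff f i)) * hnorm hardy x"
          if "x \<in> hcarrier hardy" for x
          using hardy.cauchy_schwarz[OF s[of "Suc i"] that] hardy.cauchy_schwarz[OF s[of i] mul_closed[OF that]]
            norm_triangle_ineq4[of "hardy_ip (slice_coeff f (Suc i)) x" "hardy_ip (slice_coeff f i) (mul x)"]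
          by (simp only: complex_mod_cnj) (simp add: hinner_hardy norm_mul[OF that] distrib_right)
        show "?F (hmonom n) = 0" for n
        proof -
          obtain F where F: "F \<in> hardy2_bounded" "\<And>j. slice_coeff F j = (if j = i then hmonom n else (\<lambda>_. 0))"
            using bounded_monomial by metis
          have "(\<lambda>(z, w). (z - \<phi> w) * F (z, w)) \<in> M_space \<phi>"
            unfolding M_space_def by (rule hardy2.subset_closure[OF _ G]) (use F(1) in blast)
          then have "hardy2_ip f (\<lambda>(z, w). (z - \<phi> w) * F (z, w)) = 0"
            using f by (simp add: N_space_def hinner_hardy2)
          with hardy2_ip_generator(1)[OF f2 F(1)]
          have "(\<lambda>j. hardy_ip (slice_coeff f (Suc j)) (slice_coeff F j)
              - hardy_ip (slice_coeff f j) (mul (slice_coeff F j))) sums 0" by simp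
          also have "(\<lambda>j. hardy_ip (slice_coeff f (Suc j)) (slice_coeff F j)
              - hardy_ip (slice_coeff f j) (mul (slice_coeff F j))) =
            (\<lambda>j. if j = i then hardy_ip (slice_coeff f (Suc j)) (hmonom n)
              - hardy_ip (slice_coeff f j) (mul (hmonom n)) else 0)"
            by (auto simp: F(2) hardy_ip_zero[OF s])
          finally show ?thesis
            using sums_unique2[OF _ sums_single[of i]] by fastforce
        qed
      qed
      then show "hardy_ip (slice_coeff f (Suc i)) h = hardy_ip (slice_coeff f i) (mul h)" by simp
    qed
  }
  {
    assume f: "f \<in> hcarrier hardy2 \<and> ?P"
    \<comment> \<open>The slice relations annihilate every term of the generator series, and
      continuity extends orthogonality to the closure.\<close>
    have "hinner hardy2 f y = 0" if "y \<in> M_space \<phi>" for y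
    proof (rule hardy2.orthogonal_closure[OF G])
      show "y \<in> hclosure hardy2 ?G" using that by (simp add: M_space_def)
      fix g assume "g \<in> ?G"
      then obtain h where h: "h \<in> hardy2_bounded" "g = (\<lambda>(z, w). (z - \<phi> w) * h (z, w))" by blast
      have "slice_coeff h i \<in> hcarrier hardy" for i
        using slice_coeff_hardy h(1) hardy2_bounded_subset by blast
      then have "(\<lambda>i. 0) sums hardy2_ip f g"
        using hardy2_ip_generator(1)[of f h] f h by simp
      then show "hinner hardy2 f g = 0" using sums_unique2[OF sums_zero] by (simp add: hinner_hardy2)
    qed (use f in blast)
    then show "f \<in> hcarrier (N_space \<phi>)" using f by (simp add: N_space_def)
  }
qed (rule N_space_subset)

section \<open>The functions E: slices, inner products and membership in N\<close>

lemma E_fun_hardy2: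
  assumes lam: "lam k \<in> hcarrier hardy"
  shows "E_fun \<phi> lam k j \<in> hcarrier hardy2"
    and "slice_coeff (E_fun \<phi> lam k j) i =
      (if i \<le> j then (\<lambda>w. (1 / of_real (sqrt (real j + 1))) * (\<phi> w ^ (j - i) * lam k w)) else (\<lambda>_. 0))"
proof -
  let ?c = "1 / of_real (sqrt (real j + 1)) :: complex"
  define g where "g i = (if i \<le> j then (\<lambda>w. ?c * (\<phi> w ^ (j - i) * lam k w)) else (\<lambda>_. 0))" for i
  have g: "g i \<in> hcarrier hardy" for i
    unfolding g_def using Hc.S_scale[OF mulpow_closed[OF lam, of "j - i"], of ?c] Hc.S_zero by simp
  have "hnorm hardy (\<lambda>_. 0) = 0"
    using hardy_ip_zero(1)[OF Hc.S_zero] by (simp add: hnorm_def hinner_hardy)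
  then have "(\<lambda>i. (hnorm hardy (g i))\<^sup>2) summable_on UNIV"
    by - (rule finite_nonzero_values_imp_summable_on, rule finite_subset[of _ "{..j}"], auto simp: g_def)
  then obtain F where F: "F \<in> hcarrier hardy2" "\<And>i. slice_coeff F i = g i"
    "\<And>z w. z \<in> disc \<Longrightarrow> w \<in> disc \<Longrightarrow> (\<lambda>i. g i w * z ^ i) sums F (z, w)"
    by (rule hardy2_from_slices[OF g]) blast
  have "F = E_fun \<phi> lam k j"
  proof
    fix p
    show "F p = E_fun \<phi> lam k j p"
    proof (cases "p \<in> disc \<times> disc")
      case True
      then obtain z w where p: "p = (z, w)" "z \<in> disc" "w \<in> disc" by auto
      have "(\<lambda>i. g i w * z ^ i) sums (\<Sum>i\<in>{..j}. g i w * z ^ i)"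
        by (rule sums_finite) (auto simp: g_def)
      then have "F (z, w) = (\<Sum>i\<le>j. g i w * z ^ i)" using F(3)[OF p(2,3)] sums_unique2 by blast
      also have "\<dots> = lam k w * e_fun j z (\<phi> w)"
        by (simp add: g_def e_fun_def sum_distrib_left sum_divide_distrib mult_ac)
      finally show ?thesis using True by (simp add: E_fun_def zero_off_def p(1))
    next
      case False
      then show ?thesis using hardy2_zero_off[OF F(1) False] by (auto simp: E_fun_def zero_off_def)
    qed
  qed
  with F(1,2) show "E_fun \<phi> lam k j \<in> hcarrier hardy2"
    "slice_coeff (E_fun \<phi> lam k j) i =
      (if i \<le> j then (\<lambda>w. (1 / of_real (sqrt (real j + 1))) * (\<phi> w ^ (j - i) * lam k w)) else (\<lambda>_. 0))"
    by (auto simp: g_def)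
qed

lemma hardy2_ip_E_fun:
  assumes f: "f \<in> hcarrier hardy2" and lam: "lam k \<in> hcarrier hardy"
  shows "hardy2_ip f (E_fun \<phi> lam k j) =
    (\<Sum>i\<le>j. hardy_ip (slice_coeff f i) (\<lambda>w. \<phi> w ^ (j - i) * lam k w)) / of_real (sqrt (real j + 1))"
proof -
  let ?E = "E_fun \<phi> lam k j"
  note E = E_fun_hardy2[where lam = lam and k = k, OF lam]
  have ip: "hardy_ip (slice_coeff f i) (slice_coeff ?E i) =
      (if i \<le> j then hardy_ip (slice_coeff f i) (\<lambda>w. \<phi> w ^ (j - i) * lam k w) / of_real (sqrt (real j + 1)) else 0)" for i
    using hardy.inner_scale_right[OF mulpow_closed[OF lam, of "j - i"] slice_coeff_hardy[OF f, of i],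
        of "1 / of_real (sqrt (real j + 1))"]
    by (simp add: E(2) hinner_hardy hardy_ip_zero[OF slice_coeff_hardy[OF f]])
  have "(\<lambda>i. hardy_ip (slice_coeff f i) (slice_coeff ?E i)) sums
      (\<Sum>i\<in>{..j}. hardy_ip (slice_coeff f i) (slice_coeff ?E i))"
    by (rule sums_finite) (auto simp: ip)
  then have "hardy2_ip f ?E = (\<Sum>i\<le>j. hardy_ip (slice_coeff f i) (slice_coeff ?E i))"
    using has_sum_imp_sums[OF hardy2_ip_slices[OF f E(1)]] sums_unique2 by blast
  then show ?thesis by (simp add: ip sum_divide_distrib)
qed

text \<open>Iterates the relation that characterizes N: each factor \<phi> taken off the second slot
  raises the slice index by one. All j + 1 terms of an inner product with \<open>E_fun\<close>
  thereby become equal.\<close>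

lemma N_space_slice_power:
  assumes f: "f \<in> hcarrier (N_space \<phi>)" and h: "h \<in> hcarrier hardy"
  shows "hardy_ip (slice_coeff f i) (\<lambda>w. \<phi> w ^ n * h w) = hardy_ip (slice_coeff f (i + n)) h"
  using h
proof (induction n arbitrary: h)
  case (Suc n)
  have "hardy_ip (slice_coeff f i) (\<lambda>w. \<phi> w ^ n * mul h w) = hardy_ip (slice_coeff f (i + n)) (mul h)"
    by (rule Suc.IH[OF mul_closed[OF Suc.prems]])
  also have "\<dots> = hardy_ip (slice_coeff f (i + Suc n)) h"
    using f Suc.prems by (simp add: N_space_iff)
  finally show ?case by (simp add: mult_ac)
qed simp

text \<open>Neighbouring slices up to index j differ by one factor \<phi>, which isometry removes;
  at the top index the orthogonality of \<open>lam k\<close> to \<phi> H2 takes over.\<close>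

lemma E_fun_N_space:
  assumes lam: "lam k \<in> hcarrier K"
  shows "E_fun \<phi> lam k j \<in> hcarrier (N_space \<phi>)"
  unfolding N_space_iff
proof (intro conjI allI ballI)
  define c :: complex where "c = 1 / of_real (sqrt (real j + 1))"
  have lh: "lam k \<in> hcarrier hardy" using lam by (simp add: model_space_simps)
  note E = E_fun_hardy2[where lam = lam and k = k and j = j, OF lh, folded c_def]
  show "E_fun \<phi> lam k j \<in> hcarrier hardy2" by (rule E(1))
  fix i h assume h: "h \<in> hcarrier hardy"
  have sc: "hardy_ip (\<lambda>w. c * (\<phi> w ^ n * lam k w)) u = c * hardy_ip (\<lambda>w. \<phi> w ^ n * lam k w) u"
    if "u \<in> hcarrier hardy" for n u
    using hardy.inner_scale[OF mulpow_closed[OF lh, of n] that, of c] by (simp add: hinner_hardy)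
  show "hardy_ip (slice_coeff (E_fun \<phi> lam k j) (Suc i)) h = hardy_ip (slice_coeff (E_fun \<phi> lam k j) i) (mul h)"
  proof (cases "i < j")
    case True
    then have "hardy_ip (\<lambda>w. \<phi> w ^ (j - i) * lam k w) (mul h) = hardy_ip (\<lambda>w. \<phi> w ^ (j - Suc i) * lam k w) h"
      using ip_mul[OF mulpow_closed[OF lh, of "j - Suc i"] h]
      by (simp add: mult.assoc[symmetric] power_Suc[symmetric] Suc_diff_Suc del: power_Suc)
    then show ?thesis using True by (simp add: E(2) sc h mul_closed)
  next
    \<comment> \<open>For i = j the next slice is 0, and what remains is that \<open>lam k\<close>
      is orthogonal to \<phi> h; for i > j both slices are 0.\<close>
    case False
    have "hardy_ip (\<lambda>w. lam k w) (mul h) = 0" using lam h by (simp add: model_space_simps)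
    then show ?thesis
      using False h sc[OF mul_closed[OF h], of 0]
      by (simp add: E(2) hardy_ip_zero mul_closed)
  qed
qed

lemma hardy2_ip_N_E_fun:
  assumes f: "f \<in> hcarrier (N_space \<phi>)" and lam: "lam k \<in> hcarrier hardy"
  shows "hardy2_ip f (E_fun \<phi> lam k j) = of_real (sqrt (real j + 1)) * hardy_ip (slice_coeff f j) (lam k)"
proof -
  have "(\<Sum>i\<le>j. hardy_ip (slice_coeff f i) (\<lambda>w. \<phi> w ^ (j - i) * lam k w)) =
      (\<Sum>i\<le>j. hardy_ip (slice_coeff f j) (lam k))"
    by (intro sum.cong) (simp_all add: N_space_slice_power[OF f lam])
  moreover have "(real j + 1) / sqrt (real j + 1) = sqrt (real j + 1)"
    by (rule real_div_sqrt) simp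
  then have "complex_of_real (real j + 1) / of_real (sqrt (real j + 1)) = of_real (sqrt (real j + 1))"
    by (metis of_real_divide)
  ultimately show ?thesis
    unfolding hardy2_ip_E_fun[where f = f, where lam = lam, where k = k, OF N_space_subset[OF f] lam]
    by (simp add: mult.commute[of _ "hardy_ip _ _"] add.commute flip: times_divide_eq_right)
qed

text \<open>z f need not lie in N, so the general formula \<open>hardy2_ip_E_fun\<close> is applied
  to it. Its term i = 0 vanishes and the others form the sum for index j - 1, up to the change of
  normalization.\<close>

lemma hardy2_ip_mult_z_E_fun:
  assumes f: "f \<in> hcarrier (N_space \<phi>)" and lam: "lam k \<in> hcarrier hardy"
  shows "hardy2_ip (mult_z f) (E_fun \<phi> lam k j) =
    (case j of 0 \<Rightarrow> 0 | Suc i \<Rightarrow> of_real (sqrt (real j / real (Suc j))) * hardy2_ip f (E_fun \<phi> lam k i))"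
proof -
  note f2 = N_space_subset[OF f]
  have *: "hardy2_ip (mult_z f) (E_fun \<phi> lam k j) =
    (\<Sum>i\<le>j. hardy_ip (slice_coeff (mult_z f) i) (\<lambda>w. \<phi> w ^ (j - i) * lam k w)) / of_real (sqrt (real j + 1))"
    by (rule hardy2_ip_E_fun[where lam = lam and k = k, OF mult_z_hardy2(1)[OF f2] lam])
  show ?thesis
  proof (cases j)
    case 0
    then show ?thesis using * by (simp add: mult_z_hardy2(2)[OF f2] hardy_ip_zero lam)
  next
    case (Suc n)
    have z: "hardy_ip (\<lambda>_. 0) (\<lambda>w. \<phi> w ^ Suc n * lam k w) = 0"
      by (rule hardy_ip_zero(2)[OF mulpow_closed[OF lam]])
    have "(\<Sum>i\<le>j. hardy_ip (slice_coeff (mult_z f) i) (\<lambda>w. \<phi> w ^ (j - i) * lam k w)) =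
        (\<Sum>i\<le>n. hardy_ip (slice_coeff f i) (\<lambda>w. \<phi> w ^ (n - i) * lam k w))"
      unfolding Suc sum.atMost_Suc_shift
      by (simp add: mult_z_hardy2(2)[OF f2] z del: power_Suc)
    also have "\<dots> = hardy2_ip f (E_fun \<phi> lam k n) * of_real (sqrt (real n + 1))"
      by (simp add: hardy2_ip_E_fun[where lam = lam and k = k, OF f2 lam])
    finally show ?thesis
      using * Suc by (simp add: real_sqrt_divide mult.commute add.commute)
  qed
qed

lemma model_basis:
  assumes lam: "orthonormal_basis K I lam"
  shows "k \<in> I \<Longrightarrow> lam k \<in> hcarrier K"
    and "k \<in> I \<Longrightarrow> lam k \<in> hcarrier hardy"
    and "k \<in> I \<Longrightarrow> l \<in> I \<Longrightarrow> hardy_ip (lam k) (lam l) = (if k = l then 1 else 0)"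
    and "hclosure K (hspan K (lam ` I)) = hcarrier K"
  using lam by (auto simp: orthonormal_basis_def model_space_simps(1,2))

text \<open>The first function lies in N, so only its slice j counts. This slice is zero for i < j,
  a multiple of \<open>lam l\<close> for i = j, and has a factor \<phi> for i > j, which makes it
  orthogonal to \<open>lam k\<close>.\<close>

lemma E_fun_orthonormal:
  assumes lam: "orthonormal_basis K I lam" and k: "k \<in> I" and l: "l \<in> I"
  shows "hardy2_ip (E_fun \<phi> lam l i) (E_fun \<phi> lam k j) = (if l = k \<and> i = j then 1 else 0)"
proof -
  note basis = model_basis[OF lam]
  note hk = basis(2)[OF k] and hl = basis(2)[OF l]
  define c :: complex where "c = 1 / of_real (sqrt (real i + 1))"
  note E = E_fun_hardy2[where lam = lam and k = l and j = i, OF hl, folded c_def]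
  have ip: "hardy2_ip (E_fun \<phi> lam l i) (E_fun \<phi> lam k j) =
      of_real (sqrt (real j + 1)) * hardy_ip (slice_coeff (E_fun \<phi> lam l i) j) (lam k)"
    by (rule hardy2_ip_N_E_fun[where lam = lam and k = k,
        OF E_fun_N_space[where lam = lam and k = l, OF basis(1)[OF l]] hk])
  have sc: "hardy_ip (\<lambda>w. c * (\<phi> w ^ n * lam l w)) (lam k) = c * hardy_ip (\<lambda>w. \<phi> w ^ n * lam l w) (lam k)" for n
    using hardy.inner_scale[OF mulpow_closed[OF hl, of n] hk, of c] by (simp add: hinner_hardy)
  consider "i < j" | "i = j" | "j < i" by linarith
  then show ?thesis
  proof cases
    case 1
    then show ?thesis using ip by (simp add: E(2) hardy_ip_zero hk)
  next
    case 2
    have "complex_of_real (sqrt (real j + 1)) * c = 1"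
      using 2 by (simp add: c_def)
    moreover have "slice_coeff (E_fun \<phi> lam l i) j = (\<lambda>w. c * (\<phi> w ^ 0 * lam l w))"
      using E(2)[of j] 2 by simp
    ultimately show ?thesis
      unfolding ip using 2 sc[of 0] basis(3)[OF l k] by (simp add: mult.assoc[symmetric])
  next
    case 3
    then obtain d where d: "i - j = Suc d" by (metis Suc_diff_Suc)
    have "hardy_ip (lam k) (mul (\<lambda>w. \<phi> w ^ d * lam l w)) = 0"
      using basis(1)[OF k] mulpow_closed[OF hl] by (simp add: model_space_simps(1))
    then have "hardy_ip (mul (\<lambda>w. \<phi> w ^ d * lam l w)) (lam k) = 0"
      using hardy.inner_cnj[OF hk mul_closed[OF mulpow_closed[OF hl, of d]]] by (simp add: hinner_hardy)
    then have "hardy_ip (\<lambda>w. \<phi> w ^ (i - j) * lam l w) (lam k) = 0"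
      by (simp add: d mult.assoc)
    then show ?thesis using ip 3 sc by (simp add: E(2))
  qed
qed

lemma E_fun_total:
  assumes lam: "orthonormal_basis K I lam" and f: "f \<in> hcarrier (N_space \<phi>)"
    and orth: "\<And>k j. k \<in> I \<Longrightarrow> hardy2_ip f (E_fun \<phi> lam k j) = 0"
  shows "f = (\<lambda>_. 0)"
proof -
  note basis = model_basis[OF lam]
  note f2 = N_space_subset[OF f]
  note s = slice_coeff_hardy[OF f2]
  interpret K: pre_hilbert_space K by (rule model_space_pre_hilbert)
  have perp: "hardy_ip (slice_coeff f j) (lam k) = 0" if k: "k \<in> I" for j k
  proof -
    have "complex_of_real (sqrt (real j + 1)) * hardy_ip (slice_coeff f j) (lam k) = 0"
      using orth[OF k, of j] hardy2_ip_N_E_fun[where lam = lam and k = k and j = j, OF f basis(2)[OF k]] by simp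
    moreover have "complex_of_real (sqrt (real j + 1)) \<noteq> 0"
      by (simp only: of_real_eq_0_iff real_sqrt_eq_0_iff)
    ultimately show ?thesis by simp
  qed
  have "hardy_ip g (slice_coeff f j) = 0" if g: "g \<in> hcarrier K" for g j
  proof (rule K.functional_zero_on_closure[where S = "lam ` I" and F = "\<lambda>g. hardy_ip g (slice_coeff f j)"
        and C = "hnorm hardy (slice_coeff f j)"])
    have KH: "u \<in> hcarrier hardy" if "u \<in> hcarrier K" for u using that by (simp add: model_space_simps(1))
    show "hardy_ip u (slice_coeff f j) = 0" if "u \<in> lam ` I" for u
      using that perp hardy.inner_cnj[OF s basis(2)] by (auto simp: hinner_hardy)
    show "hardy_ip (hadd K u v) (slice_coeff f j) = hardy_ip u (slice_coeff f j) + hardy_ip v (slice_coeff f j)"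
      if "u \<in> hcarrier K" "v \<in> hcarrier K" for u v
      using hardy.inner_add[OF KH[OF that(1)] KH[OF that(2)] s] by (simp add: hinner_hardy model_space_simps(5))
    show "hardy_ip (hscale K c u) (slice_coeff f j) = c * hardy_ip u (slice_coeff f j)"
      if "u \<in> hcarrier K" for c u
      using hardy.inner_scale[OF KH[OF that] s] by (simp add: hinner_hardy model_space_simps(6))
    show "cmod (hardy_ip u (slice_coeff f j)) \<le> hnorm hardy (slice_coeff f j) * hnorm K u"
      if "u \<in> hcarrier K" for u
      using hardy.cauchy_schwarz[OF KH[OF that] s, of j]
      by (simp add: hinner_hardy model_space_simps(3) mult.commute)
    show "g \<in> hclosure K (hspan K (lam ` I))" using g basis(4) by simp
    show "lam ` I \<subseteq> hcarrier K" using basis(1) by auto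
  qed
  then have perpK: "hardy_ip (slice_coeff f j) g = 0" if "g \<in> hcarrier K" for g j
    using that hardy.inner_cnj[of g "slice_coeff f j"] s by (simp add: hinner_hardy model_space_simps(1))
  have step: "slice_coeff f j = mul (slice_coeff f (Suc j))" for j
  proof -
    obtain g where g: "g \<in> hcarrier hardy" "slice_coeff f j = mul g"
      using orthogonal_model_space_factor[OF s perpK] by blast
    \<comment> \<open>The relation of N turns the inner product of the next slice with h into
      <\<phi> g, \<phi> h>, which isometry reduces to <g, h>.\<close>
    have "slice_coeff f (Suc j) = g"
    proof (rule hardy.inner_eqI[OF s g(1)])
      fix h assume h: "h \<in> hcarrier hardy"
      have "hardy_ip (slice_coeff f (Suc j)) h = hardy_ip (mul g) (mul h)"
        using f h g(2) unfolding N_space_iff by auto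
      then show "hinner hardy (slice_coeff f (Suc j)) h = hinner hardy g h"
        by (simp add: hinner_hardy ip_mul g(1) h)
    qed
    with g(2) show ?thesis by simp
  qed
  have "slice_coeff f j = (\<lambda>_. 0)" for j
  proof -
    have st: "slice_coeff f (j + n) = mul (slice_coeff f (j + Suc n))" for n
      using step[of "j + n"] by simp
    from zero_if_infinitely_divisible[where f = "\<lambda>n. slice_coeff f (j + n)", OF s st] show ?thesis by simp
  qed
  then have "(\<lambda>j. 0) sums hardy2_ip f f"
    using has_sum_imp_sums[OF hardy2_ip_slices[OF f2 f2]] hardy_ip_zero(1)[OF Hc.S_zero] by simp
  then have "hardy2_ip f f = 0" using sums_unique2[OF sums_zero] by simp
  then show ?thesis using hardy2.inner_definite[OF f2] by (simp add: hinner_hardy2)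
qed

end

text \<open>An operator prescribed on basis vectors is read as the unique bounded operator with
  these values, hence existence together with uniqueness. The tensor product is any pair (T, t) with
  the defining properties, so no particular model is singled out.\<close>

theorem mainTheorem12:
  fixes \<phi> :: "complex \<Rightarrow> complex"
    and m :: enat
    and lam :: "nat \<Rightarrow> complex \<Rightarrow> complex"
    and T :: "'t cspace"
    and t :: "(complex \<Rightarrow> complex) \<Rightarrow> (complex \<Rightarrow> complex) \<Rightarrow> 't"
  assumes "inner_function \<phi>"
    and "\<not> \<phi> constant_on disc"
    and "orthonormal_basis (model_space \<phi>) {k. enat k \<le> m} lam"
    and "hilbert_tensor_product (model_space \<phi>) bergman T t"
  shows "(\<forall>k j. enat k \<le> m \<longrightarrow> E_fun \<phi> lam k j \<in> hcarrier (N_space \<phi>)) \<and>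
    (\<exists>U. bounded_operator (N_space \<phi>) T U \<and>
       (\<forall>k j. enat k \<le> m \<longrightarrow> U (E_fun \<phi> lam k j) = t (lam k) (bergman_basis j)) \<and>
       (\<forall>V. bounded_operator (N_space \<phi>) T V \<and>
            (\<forall>k j. enat k \<le> m \<longrightarrow> V (E_fun \<phi> lam k j) = t (lam k) (bergman_basis j))
          \<longrightarrow> (\<forall>f\<in>hcarrier (N_space \<phi>). V f = U f)) \<and>
       unitary_operator (N_space \<phi>) T U \<and>
       (\<forall>f\<in>hcarrier (N_space \<phi>).
          U (S_z \<phi> f) = tensor_operator (model_space \<phi>) bergman T t (\<lambda>x. x) bergman_shift (U f)))"
proof -
  interpret nonconstant_inner \<phi> by unfold_locales (use assms in auto)
  note lam = assms(3) and tp = assms(4)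
  interpret N: complex_hilbert_space "N_space \<phi>" by (rule N_space_hilbert)
  interpret T: complex_hilbert_space T using tp by (simp add: hilbert_tensor_product_def)
  note preN = N.pre_hilbert_space_axioms and preT = T.pre_hilbert_space_axioms
  have hN: "hinner (N_space \<phi>) = hardy2_ip" "hzero (N_space \<phi>) = (\<lambda>_. 0)"
    "hnorm (N_space \<phi>) = hnorm hardy2"
    by (simp_all add: N_space_def hinner_hardy2)
  \<comment> \<open>Pairs (k, j) are coded as natural numbers, the index type of orthonormal
    systems; \<open>e\<close> and \<open>b\<close> below are the two bases in this coding.\<close>
  let ?J = "{k. enat k \<le> m}" and ?fst = "\<lambda>n. fst (prod_decode n)" and ?snd = "\<lambda>n. snd (prod_decode n)"
  define I where "I = {n. enat (?fst n) \<le> m}"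
  define e where "e n = E_fun \<phi> lam (?fst n) (?snd n)" for n
  define b where "b n = t (lam (?fst n)) (bergman_basis (?snd n))" for n
  have decode_eq: "(?fst i = ?fst j \<and> ?snd i = ?snd j) = (i = j)" for i j
    by (metis prod.expand prod_decode_inverse)
  have EN: "E_fun \<phi> lam k j \<in> hcarrier (N_space \<phi>)" if "enat k \<le> m" for k j
    by (rule E_fun_N_space) (use model_basis(1)[OF lam] that in auto)
  have encode: "prod_encode (k, j) \<in> I" "e (prod_encode (k, j)) = E_fun \<phi> lam k j"
    "b (prod_encode (k, j)) = t (lam k) (bergman_basis j)" if "enat k \<le> m" for k j
    using that by (simp_all add: I_def e_def b_def)
  have oe: "N.orthonormal I e"
    using E_fun_orthonormal[OF lam] EN decode_eq by (auto simp: N.orthonormal_def I_def e_def hN)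
  have te: "N.total I e"
    unfolding N.total_def
  proof (intro ballI impI)
    fix f assume f: "f \<in> hcarrier (N_space \<phi>)" and 0: "\<forall>i\<in>I. hinner (N_space \<phi>) f (e i) = 0"
    have "hardy2_ip f (E_fun \<phi> lam k j) = 0" if "k \<in> ?J" for k j
      using 0 encode[of k j] that by (metis hN(1) mem_Collect_eq)
    then show "f = hzero (N_space \<phi>)" using E_fun_total[OF lam f] hN(2) by simp
  qed
  have lamK: "lam k \<in> hcarrier K" if "enat k \<le> m" for k
    using model_basis(1)[OF lam] that by auto
  have tc: "t x y \<in> hcarrier T" if "x \<in> hcarrier K" "y \<in> hcarrier bergman" for x y
    using tp that unfolding hilbert_tensor_product_def by blast
  have ti: "hinner T (t x y) (t x' y') = hardy_ip x x' * bergman_ip y y'"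
    if "x \<in> hcarrier K" "x' \<in> hcarrier K" "y \<in> hcarrier bergman" "y' \<in> hcarrier bergman" for x x' y y'
    using tp that unfolding hilbert_tensor_product_def hinner_bergman model_space_simps(2) by blast
  have bb: "bergman_ip (bergman_basis i) (bergman_basis j) = (if i = j then 1 else 0)" for i j
    by (simp add: bergman_ip_basis bergman_basis_closed bergman_coeff_basis)
  have ob: "T.orthonormal I b"
    using model_basis(3)[OF lam] decode_eq
    by (auto simp: T.orthonormal_def I_def b_def ti bb tc lamK bergman_basis_closed)
  have tb: "T.total I b"
    unfolding T.total_def
  proof (intro ballI impI)
    fix x assume x: "x \<in> hcarrier T" and 0: "\<forall>i\<in>I. hinner T x (b i) = 0"
    show "x = hzero T"
    proof (rule tensor_basis_total[OF tp model_space_pre_hilbert bergman.pre_hilbert_space_axioms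
          _ model_basis(4)[OF lam] _ complex_hilbert_space.closure_span_basis[OF bergman_hilbert bergman_basis_total] x])
      fix s r assume "s \<in> lam ` ?J" "r \<in> range bergman_basis"
      then obtain k j where "enat k \<le> m" "s = lam k" "r = bergman_basis j" by auto
      then show "hinner T x (t s r) = 0" using 0 encode[of k j] by metis
    qed (use lamK bergman_basis_closed in auto)
  qed

  \<comment> \<open>The unitary operator and its uniqueness\<close>
  obtain U where U: "unitary_operator (N_space \<phi>) T U" and Ue: "\<And>i. i \<in> I \<Longrightarrow> U (e i) = b i"
    and Uc: "\<And>x i. x \<in> hcarrier (N_space \<phi>) \<Longrightarrow> i \<in> I \<Longrightarrow> hinner T (U x) (b i) = hinner (N_space \<phi>) x (e i)"
    using unitary_operator_of_bases[OF N_space_hilbert T.complex_hilbert_space_axioms oe te ob tb] by metis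
  have Ub: "bounded_operator (N_space \<phi>) T U" using U by (simp add: unitary_operator_def)
  have UE: "U (E_fun \<phi> lam k j) = t (lam k) (bergman_basis j)" if "enat k \<le> m" for k j
    using Ue encode[OF that] by metis
  have eN: "e ` I \<subseteq> hcarrier (N_space \<phi>)" using EN by (auto simp: I_def e_def)
  have unique: "V f = U f"
    if V: "bounded_operator (N_space \<phi>) T V"
      and VE: "\<forall>k j. enat k \<le> m \<longrightarrow> V (E_fun \<phi> lam k j) = t (lam k) (bergman_basis j)"
      and f: "f \<in> hcarrier (N_space \<phi>)" for V f
    by (rule bounded_operator_eqI[OF preN preT V Ub eN N.closure_span_basis[OF oe te] _ f])
       (use VE UE in \<open>auto simp: I_def e_def\<close>)

  \<comment> \<open>The compression in coordinates\<close>
  let ?S = "S_z \<phi>"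
  have S_eq: "?S f = hproj hardy2 (hcarrier (hardy2 \<ominus> M_space \<phi>)) (mult_z f)" for f
    by (simp add: S_z_def N_space_def mult_z_def)
  \<comment> \<open>S_z f lies in N, and <S_z f, s> = <z f, s> for s in N; all later statements
    about S_z come from these two facts.\<close>
  note proj = hproj_complement[OF hardy2.pre_hilbert_space_axioms N_space_hilbert[unfolded N_space_def]
      oe[unfolded N_space_def] te[unfolded N_space_def] mult_z_hardy2(1)[OF N_space_subset],
      folded S_eq N_space_def, unfolded hinner_hardy2]
  have U_inner: "hinner T (U f) (U g) = hinner (N_space \<phi>) f g"
    if "f \<in> hcarrier (N_space \<phi>)" "g \<in> hcarrier (N_space \<phi>)" for f g
    using U that by (simp add: unitary_operator_def)
  have U_bij: "bij_betw U (hcarrier (N_space \<phi>)) (hcarrier T)"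
    using U by (simp add: unitary_operator_def)
  have U_closed: "U f \<in> hcarrier T" if "f \<in> hcarrier (N_space \<phi>)" for f
    using U_bij that by (auto simp: bij_betw_def)
  have US_coeff: "hinner T (U (?S f)) (b (prod_encode (k, j))) =
      (case j of 0 \<Rightarrow> 0 | Suc i \<Rightarrow> of_real (sqrt (real j / real (Suc j))) * hinner T (U f) (b (prod_encode (k, i))))"
    if f: "f \<in> hcarrier (N_space \<phi>)" and k: "enat k \<le> m" for f k j
  proof -
    have "hinner T (U (?S f)) (b (prod_encode (k, j))) = hardy2_ip (mult_z f) (E_fun \<phi> lam k j)"
      using Uc[OF proj(1)[OF f] encode(1)[OF k]] proj(2)[OF f EN[OF k]] by (simp add: encode(2)[OF k] hN)
    also have "\<dots> = (case j of 0 \<Rightarrow> 0 | Suc i \<Rightarrow> of_real (sqrt (real j / real (Suc j))) * hardy2_ip f (E_fun \<phi> lam k i))"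
      using model_basis(2)[OF lam] k by (intro hardy2_ip_mult_z_E_fun f) auto
    finally show ?thesis
      using Uc[OF f encode(1)[OF k]] by (simp add: encode(2)[OF k] hN split: nat.split)
  qed
  have T_eqI: "x = y" if "x \<in> hcarrier T" "y \<in> hcarrier T"
    "\<And>k j. enat k \<le> m \<Longrightarrow> hinner T x (b (prod_encode (k, j))) = hinner T y (b (prod_encode (k, j)))" for x y
  proof (rule T.total_eqI[OF tb ob that(1,2)])
    fix i assume "i \<in> I"
    then show "hinner T x (b i) = hinner T y (b i)"
      using that(3)[of "?fst i" "?snd i"] by (simp add: I_def)
  qed

  \<comment> \<open>Identification of the tensor operator\<close>
  define G where "G = inv_into (hcarrier (N_space \<phi>)) U"
  have G: "G x \<in> hcarrier (N_space \<phi>)" "U (G x) = x" if "x \<in> hcarrier T" for x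
    using bij_betwE[OF bij_betw_inv_into[OF U_bij]] bij_betw_inv_into_right[OF U_bij] that
    by (auto simp: G_def)
  have GU: "G (U f) = f" if "f \<in> hcarrier (N_space \<phi>)" for f
    using U_bij that unfolding G_def by (simp add: bij_betw_def)
  \<comment> \<open>The conjugate of S_z by U, restricted to the carrier because
    \<open>tensor_operator\<close> asks for an extensional function.\<close>
  define R where "R = restrict (\<lambda>x. U (?S (G x))) (hcarrier T)"
  have Rc: "R x \<in> hcarrier T" if "x \<in> hcarrier T" for x
    using that by (simp add: R_def U_closed proj(1) G)
  \<comment> \<open>In coordinates R is a weighted shift; its linearity is read off from this
    formula.\<close>
  have R_coeff: "hinner T (R x) (b (prod_encode (k, j))) =
      (case j of 0 \<Rightarrow> 0 | Suc i \<Rightarrow> of_real (sqrt (real j / real (Suc j))) * hinner T x (b (prod_encode (k, i))))"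
    if x: "x \<in> hcarrier T" and k: "enat k \<le> m" for x k j
    using US_coeff[OF G(1)[OF x] k, of j, unfolded G(2)[OF x]] x by (simp add: R_def)
  have bT: "b (prod_encode (k, j)) \<in> hcarrier T" if "enat k \<le> m" for k j
    using that by (simp add: encode(3) tc lamK bergman_basis_closed)
  have R_bounded: "bounded_operator T T R"
    unfolding bounded_operator_def
  proof (intro conjI ballI allI exI[of _ 1])
    fix x y assume xy: "x \<in> hcarrier T" "y \<in> hcarrier T"
    show "R (hadd T x y) = hadd T (R x) (R y)"
      by (rule T_eqI)
         (use xy in \<open>auto simp: Rc T.closed R_coeff T.inner_add bT distrib_left split: nat.split\<close>)
  next
    fix c x assume x: "x \<in> hcarrier T"
    show "R (hscale T c x) = hscale T c (R x)"
      by (rule T_eqI)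
         (use x in \<open>auto simp: Rc T.closed R_coeff T.inner_scale bT mult_ac split: nat.split\<close>)
  next
    fix x assume x: "x \<in> hcarrier T"
    define f where "f = G x"
    have f: "f \<in> hcarrier (N_space \<phi>)" unfolding f_def by (rule G(1)[OF x])
    have nU: "hnorm T (U g) = hnorm hardy2 g" if "g \<in> hcarrier (N_space \<phi>)" for g
      using U_inner[OF that that] by (simp add: hnorm_def hN hinner_hardy2)
    note Sf = proj(1)[OF f]
    note Sf2 = N_space_subset[OF Sf] and f2 = N_space_subset[OF f]
    \<comment> \<open>Contractivity of S_z: <S_z f, S_z f> = <z f, S_z f>, then Cauchy-Schwarz and
      the isometry of multiplication by z.\<close>
    have "(hnorm hardy2 (?S f))\<^sup>2 = cmod (hardy2_ip (mult_z f) (?S f))"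
      using proj(2)[OF f Sf] hardy2.inner_self[OF Sf2] by (simp add: hinner_hardy2 norm_power)
    also have "\<dots> \<le> hnorm hardy2 f * hnorm hardy2 (?S f)"
      using hardy2.cauchy_schwarz[OF mult_z_hardy2(1)[OF f2] Sf2] by (simp add: hinner_hardy2 norm_mult_z[OF f2])
    finally have "hnorm hardy2 (?S f) \<le> hnorm hardy2 f"
      using hardy2.norm_nonneg[OF Sf2] hardy2.norm_nonneg[OF f2]
      by (cases "hnorm hardy2 (?S f) = 0") (auto simp: power2_eq_square)
    then show "hnorm T (R x) \<le> 1 * hnorm T x"
      using nU[OF f] nU[OF Sf] G(2)[OF x] x by (simp add: R_def f_def)
  qed (rule Rc)
  \<comment> \<open>Both sides have coefficients <x, lam_k> times a Bergman coefficient of y,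
    shifted with the same weights.\<close>
  have R_tensor: "R (t x y) = t x (bergman_shift y)"
    if x: "x \<in> hcarrier K" and y: "y \<in> hcarrier bergman" for x y
  proof (rule T_eqI)
    fix k j assume k: "enat k \<le> m"
    show "hinner T (R (t x y)) (b (prod_encode (k, j))) = hinner T (t x (bergman_shift y)) (b (prod_encode (k, j)))"
      unfolding R_coeff[OF tc[OF x y] k] using x y k lamK[OF k]
      by (simp add: tc encode(3) ti bergman_shift_closed bergman_basis_closed bergman_ip_basis
          bergman_coeff_shift split: nat.split)
  qed (use x y in \<open>auto simp: Rc tc bergman_shift_closed\<close>)
  have R_eq: "tensor_operator K bergman T t (\<lambda>x. x) bergman_shift = R"
    unfolding tensor_operator_def
  proof (rule the_equality)
    show "R \<in> extensional (hcarrier T) \<and> bounded_operator T T R \<and>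
        (\<forall>x\<in>hcarrier K. \<forall>y\<in>hcarrier bergman. R (t x y) = t x (bergman_shift y))"
      using R_bounded R_tensor by (auto simp: R_def)
    \<comment> \<open>A competing bounded operator agrees with R on elementary tensors, whose span
      is dense in T.\<close>
    fix Q assume Q: "Q \<in> extensional (hcarrier T) \<and> bounded_operator T T Q \<and>
        (\<forall>x\<in>hcarrier K. \<forall>y\<in>hcarrier bergman. Q (t x y) = t x (bergman_shift y))"
    show "Q = R"
    proof (rule extensionalityI[where A = "hcarrier T"])
      fix x assume x: "x \<in> hcarrier T"
      show "Q x = R x"
      proof (rule bounded_operator_eqI[OF preT preT _ R_bounded _ _ _ x])
        show "hclosure T (hspan T {t x y | x y. x \<in> hcarrier K \<and> y \<in> hcarrier bergman}) = hcarrier T"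
          using tp by (simp add: hilbert_tensor_product_def)
      qed (use Q R_tensor tc in auto)
    qed (use Q in \<open>auto simp: R_def\<close>)
  qed
  have intertwine: "U (?S f) = tensor_operator K bergman T t (\<lambda>x. x) bergman_shift (U f)"
    if f: "f \<in> hcarrier (N_space \<phi>)" for f
    unfolding R_eq using f by (simp add: R_def U_closed GU)
  show ?thesis
    using EN Ub UE unique U intertwine by blast
qed

end
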